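(* Let $\mathbb{F}$ be a field and let $\Gamma$ be a multilinear system of two partial difference equations in dimension $d = 2$ with coefficients in $\mathbb{F}$, proper over $\mathbb{Z}^2$, whose patterns $A$ and $B$ admit a finite percolating seed for $\mathbb{Z}^2$. Then $\Gamma$ is consistent over $\mathbb{Z}^2$ if and only if $\Gamma$ is consistent over the region $(\operatorname{conv} A + \operatorname{conv} B) \cap \mathbb{Z}^2$, where $+$ denotes Minkowski sum.
   Context: Systems. Let $\mathbb{F}$ be a field, let $x_\mathbf{a}$ ($\mathbf{a} \in \mathbb{Z}^d$) be distinct formal indeterminates, and let $X = \{x_\mathbf{a} \mid \mathbf{a} \in \mathbb{Z}^d\}$. The pattern of $P \in \mathbb{F}[X]$ is the finite set of all $\mathbf{a} \in \mathbb{Z}^d$ such that $x_\mathbf{a}$ occurs in $P$. The translation copy of $P$ by $\mathbf{t} \in \mathbb{Z}^d$ is obtained by replacing every $x_\mathbf{a}$ with $x_{\mathbf{a} + \mathbf{t}}$ simultaneously. A system $\Gamma$ of partial difference equations is specified by a finite collection $\mathcal{P} \subseteq \mathbb{F}[X]$ (one polynomial per equation): it is the system of all equations $Q = 0$ with $Q$ a translation copy of a member of $\mathcal{P}$. The patterns of the members of $\mathcal{P}$ are assumed pairwise distinct modulo translation; their collection is denoted $\mathcal{A}$. $\Gamma$ is multilinear if each member of $\mathcal{P}$ is linear (of degree $1$) in every indeterminate which occurs in it. Then for each translation copy $P$ of a member of $\mathcal{P}$ and each $\mathbf{a}$ in its pattern, $P = P_{\mathrm{Num}} + x_\mathbf{a}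 P_{\mathrm{Denom}}$ with $P_{\mathrm{Num}}, P_{\mathrm{Denom}} \in \mathbb{F}[X \setminus \{x_\mathbf{a}\}]$ uniquely determined, the numerator and denominator of $P$ at $\mathbf{a}$. Percolating seeds for a region. Let $T \subseteq \mathbb{Z}^d$ and $S \subseteq T$. Start with exactly the points of $S$ occupied, and repeatedly occupy vacant points of $T$ which are the unique vacant point of some translation copy of a pattern in $\mathcal{A}$ contained in $T$. $S$ is a percolating seed for $T$ if in this way every point of $T$ eventually becomes occupied. Runs. Let $S$ be a finite percolating seed for $T$ with $s = |S|$. A (computational) run from $S$ to $T$ is a pair $R = (\alpha, \Psi)$ of (finite or infinite) sequences such that: $\alpha$ is indexed from $1$; its terms are points of $T$; its first $s$ terms are the points of $S$; every point of $T$ occurs in it, repetitions being allowed; $\Psi$ is indexed from $s+1$, over the indices $i \ge s+1$ of $\alpha$; each $\Psi(i)$ is a subset of $\{1, 2, \ldots, i\}$ containing $i$ such that the points $\alpha(j)$, $j \in \Psi(i)$, are pairwise distinct and form a translation copy of some pattern in $\mathcal{A}$. Free computation. Fix a run $R$ from $S$ to $T$ and a bijection $\eta_{\mathrm{Var}}$ from $S$ to a set of new indeterminates $\{x_1, \ldots, x_s\}$. The free computation associated with $R$ is the sequence $\xi$ in $\mathbb{F}(x_1, \ldots, x_s)$ with the same indices as $\alpha$, defined recursively as follows. For $1 \le i \le s$, $\xi(i) = \eta_{\mathrm{Var}}(\alpha(i))$. For $i \ge s + 1$, let $P$ be the unique translation copy of a member of $\mathcal{P}$ whose pattern is $\{\alpha(j)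 \mid j \in \Psi(i)\}$, with numerator $P_{\mathrm{Num}}$ and denominator $P_{\mathrm{Denom}}$ at $\alpha(i)$; let $\eta_{\mathrm{Step}}(\alpha(j)) = \xi(j)$ for $j \in \Psi(i) \setminus \{i\}$; then $\xi(i) = -P_{\mathrm{Num}}(\eta_{\mathrm{Step}}) / P_{\mathrm{Denom}}(\eta_{\mathrm{Step}})$, where $Q(\eta_{\mathrm{Step}})$ means evaluating $Q$ with $x_\mathbf{b} = \eta_{\mathrm{Step}}(\mathbf{b})$. If $P_{\mathrm{Denom}}(\eta_{\mathrm{Step}}) = 0$ for some $i$, the free computation is not well-defined. Proper and consistent. $\Gamma$ (multilinear) is proper over $T$ if for every finite percolating seed $S$ for $T$ and every run $R$ from $S$ to $T$, the free computation associated with $R$ is well-defined. $\Gamma$ (multilinear and proper over $T$) is consistent from $S$ to $T$, where $S$ is a finite percolating seed for $T$, if for every run $R = (\alpha, \Psi)$ from $S$ to $T$ the associated free computation $\xi$ satisfies $\xi(i) = \xi(j)$ whenever $\alpha(i) = \alpha(j)$. $\Gamma$ is consistent over $T$ if there exists a finite percolating seed $S$ for $T$ such that $\Gamma$ is consistent from $S$ to $T$. *)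

theory Defs
  imports
    "HOL-Analysis.Analysis"
    "HOL-Library.Poly_Mapping"
    "HOL-Library.Extended_Nat"
    "HOL-Computational_Algebra.Fraction_Field"
begin

section \<open>Polynomials in arbitrarily many indeterminates\<close>

text \<open>A polynomial maps each monomial (a finitely supported exponent function) to its
  coefficient.\<close>

type_synonym ('v, 'a) mpoly = "('v \<Rightarrow>\<^sub>0 nat) \<Rightarrow>\<^sub>0 'a"

definition indet :: "'v \<Rightarrow> ('v, 'a::comm_ring_1) mpoly" where
  "indet a = Poly_Mapping.single (Poly_Mapping.single a 1) 1"

definition const :: "'a \<Rightarrow> ('v, 'a::comm_ring_1) mpoly" where
  "const c = Poly_Mapping.single 0 c"

definition pattern :: "('v, 'a::zero) mpoly \<Rightarrow> 'v set" where
  "pattern P = (\<Union>m\<in>Poly_Mapping.keys P. Poly_Mapping.keys m)"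

definition degree_in :: "('v, 'a::zero) mpoly \<Rightarrow> 'v \<Rightarrow> nat" where
  "degree_in P a = Max ((\<lambda>m. Poly_Mapping.lookup m a) ` Poly_Mapping.keys P)"

text \<open>Evaluation at \<open>v\<close>, where \<open>c\<close> embeds the coefficients into the target ring.\<close>

definition mpoly_eval ::
    "('a::zero \<Rightarrow> 'b::comm_semiring_1) \<Rightarrow> ('v \<Rightarrow> 'b) \<Rightarrow> ('v, 'a) mpoly \<Rightarrow> 'b" where
  "mpoly_eval c v P = (\<Sum>m\<in>Poly_Mapping.keys P. c (Poly_Mapping.lookup P m) *
     (\<Prod>a\<in>Poly_Mapping.keys m. v a ^ Poly_Mapping.lookup m a))"

definition num_denom ::
    "('v, 'a::comm_ring_1) mpoly \<Rightarrow> 'v \<Rightarrow> ('v, 'a) mpoly \<times> ('v, 'a) mpoly" where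
  "num_denom P a = (THE (N, D). a \<notin> pattern N \<and> a \<notin> pattern D \<and> P = N + indet a * D)"

definition numerator :: "('v, 'a::comm_ring_1) mpoly \<Rightarrow> 'v \<Rightarrow> ('v, 'a) mpoly" where
  "numerator P a = fst (num_denom P a)"

definition denominator :: "('v, 'a::comm_ring_1) mpoly \<Rightarrow> 'v \<Rightarrow> ('v, 'a) mpoly" where
  "denominator P a = snd (num_denom P a)"

lemma pattern_iff: "a \<in> pattern P \<longleftrightarrow> (\<exists>m. Poly_Mapping.lookup P m \<noteq> 0 \<and> Poly_Mapping.lookup m a \<noteq> 0)"
  unfolding pattern_def by (auto simp: in_keys_iff)

lemma mpoly_as_sum:
  "(P::'k \<Rightarrow>\<^sub>0 'a::comm_monoid_add) = (\<Sum>m\<in>Poly_Mapping.keys P. Poly_Mapping.single m (Poly_Mapping.lookup P m))"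
  by (rule poly_mapping_eqI)
     (simp add: lookup_sum lookup_single when_def in_keys_iff)

lemma indet_times:
  "indet a * (D :: ('v, 'a::comm_ring_1) mpoly) =
   (\<Sum>m\<in>Poly_Mapping.keys D. Poly_Mapping.single (Poly_Mapping.single a 1 + m) (Poly_Mapping.lookup D m))"
  by (subst mpoly_as_sum [of D]) (simp add: indet_def sum_distrib_left mult_single)

lemma lookup_indet_times:
  fixes D :: "('v, 'a::comm_ring_1) mpoly"
  shows "Poly_Mapping.lookup (indet a * D) m =
    (if Poly_Mapping.lookup m a = 0 then 0 else Poly_Mapping.lookup D (m - Poly_Mapping.single a 1))"
proof -
  have eq: "Poly_Mapping.single a 1 + k = m \<longleftrightarrow> Poly_Mapping.lookup m a \<noteq> 0 \<and> k = m - Poly_Mapping.single a 1"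
    for k :: "'v \<Rightarrow>\<^sub>0 nat"
    by (auto simp: poly_mapping_eq_iff fun_eq_iff lookup_add lookup_minus lookup_single when_def)
  show ?thesis
    unfolding indet_times lookup_sum lookup_single when_def eq
    by (simp add: in_keys_iff)
qed

text \<open>The pair described in \<^const>\<open>num_denom\<close> exists and is unique.\<close>

lemma num_denom_ex1:
  fixes P :: "('v, 'a::comm_ring_1) mpoly"
  assumes "a \<in> pattern P" "degree_in P a = 1"
  shows "\<exists>!(N, D). a \<notin> pattern N \<and> a \<notin> pattern D \<and> P = N + indet a * D"
proof -
  let ?x = "Poly_Mapping.single a (1::nat)"
  define N where "N = (\<Sum>m\<in>{m\<in>Poly_Mapping.keys P. Poly_Mapping.lookup m a = 0}.
    Poly_Mapping.single m (Poly_Mapping.lookup P m))"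
  define D where "D = (\<Sum>m\<in>{m\<in>Poly_Mapping.keys P. Poly_Mapping.lookup m a = 1}.
    Poly_Mapping.single (m - ?x) (Poly_Mapping.lookup P m))"
  have deg: "Poly_Mapping.lookup m a \<le> 1" if "Poly_Mapping.lookup P m \<noteq> 0" for m
    using assms(2) that unfolding degree_in_def
    by (metis Max_ge finite_imageI finite_keys image_eqI in_keys_iff)
  have N: "Poly_Mapping.lookup N m = (if Poly_Mapping.lookup m a = 0 then Poly_Mapping.lookup P m else 0)" for m
    by (auto simp: N_def lookup_sum lookup_single when_def in_keys_iff)
  have shift: "m - ?x = k \<longleftrightarrow> m = ?x + k" if "Poly_Mapping.lookup m a = 1" for m k
    using that by (auto simp: poly_mapping_eq_iff fun_eq_iff lookup_add lookup_minus lookup_single when_def)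
  have D: "Poly_Mapping.lookup D k = (if Poly_Mapping.lookup k a = 0 then Poly_Mapping.lookup P (?x + k) else 0)" for k
  proof -
    have "Poly_Mapping.lookup D k = (\<Sum>m\<in>{m\<in>Poly_Mapping.keys P. Poly_Mapping.lookup m a = 1}.
       if m = ?x + k then Poly_Mapping.lookup P m else 0)"
      unfolding D_def lookup_sum lookup_single when_def using shift by (intro sum.cong) auto
    also have "\<dots> = (if Poly_Mapping.lookup k a = 0 then Poly_Mapping.lookup P (?x + k) else 0)"
      by (auto simp: in_keys_iff lookup_add)
    finally show ?thesis .
  qed
  have "a \<notin> pattern N" "a \<notin> pattern D"
    by (auto simp: pattern_iff N D)
  moreover have "P = N + indet a * D"
  proof (rule poly_mapping_eqI)
    fix m
    have *: "?x + (m - ?x) = m" if "Poly_Mapping.lookup m a \<noteq> 0"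
      using that by (auto simp: poly_mapping_eq_iff fun_eq_iff lookup_add lookup_minus lookup_single when_def)
    show "Poly_Mapping.lookup P m = Poly_Mapping.lookup (N + indet a * D) m"
      using deg [of m] by (auto simp: lookup_add lookup_indet_times N D * [unfolded One_nat_def] lookup_minus)
  qed
  moreover have "N' = N \<and> D' = D"
    if N': "a \<notin> pattern N'" and D': "a \<notin> pattern D'" and P: "P = N' + indet a * D'" for N' D'
  proof
    have N'0: "Poly_Mapping.lookup N' m = 0" if "Poly_Mapping.lookup m a \<noteq> 0" for m
      using N' that unfolding pattern_iff by blast
    have D'0: "Poly_Mapping.lookup D' m = 0" if "Poly_Mapping.lookup m a \<noteq> 0" for m
      using D' that unfolding pattern_iff by blast
    have lookup_P: "Poly_Mapping.lookup P m = Poly_Mapping.lookup N' m +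
        (if Poly_Mapping.lookup m a = 0 then 0 else Poly_Mapping.lookup D' (m - ?x))" for m
      unfolding P lookup_add lookup_indet_times by (rule refl)
    show "N' = N"
      by (rule poly_mapping_eqI) (simp add: N lookup_P N'0)
    show "D' = D"
      by (rule poly_mapping_eqI) (simp add: D lookup_P N'0 D'0 lookup_add)
  qed
  ultimately have "a \<notin> pattern N \<and> a \<notin> pattern D \<and> P = N + indet a * D"
    and "\<And>N' D'. a \<notin> pattern N' \<and> a \<notin> pattern D' \<and> P = N' + indet a * D' \<Longrightarrow> N' = N \<and> D' = D"
    by blast+
  then show ?thesis
    by (intro ex1I [of _ "(N, D)"]) (clarsimp, blast)+
qed

section \<open>Systems of partial difference equations\<close>

definition translate :: "int ^ 'd \<Rightarrow> (int ^ 'd, 'a::comm_ring_1) mpoly \<Rightarrow> (int ^ 'd, 'a) mpoly" where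
  "translate t P = mpoly_eval const (\<lambda>a. indet (a + t)) P"

lemma prod_single:
  "finite I \<Longrightarrow> (\<Prod>i\<in>I. Poly_Mapping.single (k i) (1::'a::comm_ring_1)) = Poly_Mapping.single (\<Sum>i\<in>I. k i :: 'v \<Rightarrow>\<^sub>0 nat) 1"
  by (induction I rule: finite_induct) (auto simp: mult_single single_one)

lemma indet_power: "(indet a :: ('v, 'a::comm_ring_1) mpoly) ^ n = Poly_Mapping.single (Poly_Mapping.single a n) 1"
  by (induction n) (auto simp: indet_def mult_single single_add [symmetric] single_one)

lemma lookup_translate:
  "Poly_Mapping.lookup (translate t P) m =
   Poly_Mapping.lookup P (Poly_Mapping.map_key (\<lambda>a. a + t) m)"
proof -
  have inj: "inj (\<lambda>a. a + t)" by (simp add: inj_def)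
  let ?s = "\<lambda>m. (\<Sum>a\<in>Poly_Mapping.keys m. Poly_Mapping.single (a + t) (Poly_Mapping.lookup m a))"
  have s: "Poly_Mapping.lookup (?s m) b = Poly_Mapping.lookup m (b - t)" for m b
  proof -
    have "(a + t = b) = (a = b - t)" for a by auto
    then show ?thesis
      by (simp add: lookup_sum lookup_single when_def in_keys_iff)
  qed
  have s_eq: "?s k = m \<longleftrightarrow> k = Poly_Mapping.map_key (\<lambda>a. a + t) m" for k
    unfolding poly_mapping_eq_iff fun_eq_iff s
    by (simp add: map_key.rep_eq [OF inj]) (metis add_diff_cancel_right' diff_add_cancel)
  have "translate t P = (\<Sum>m\<in>Poly_Mapping.keys P. Poly_Mapping.single (?s m) (Poly_Mapping.lookup P m))"
    by (simp add: translate_def mpoly_eval_def const_def indet_power prod_single mult_single)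
  then show ?thesis
    by (simp add: lookup_sum lookup_single when_def s_eq in_keys_iff)
qed

lemma pattern_translate:
  fixes P :: "(int ^ 'd, 'a::comm_ring_1) mpoly"
  shows "pattern (translate t P) = (\<lambda>a. a + t) ` pattern P"
proof -
  have inj: "inj (\<lambda>a::int ^ 'd. a + t)" "inj (\<lambda>a::int ^ 'd. a - t)" by (simp_all add: inj_def)
  have inv: "Poly_Mapping.map_key (\<lambda>a. a + t) (Poly_Mapping.map_key (\<lambda>a. a - t) m) = m" for m :: "int ^ 'd \<Rightarrow>\<^sub>0 nat"
    by (simp add: poly_mapping_eq_iff fun_eq_iff map_key.rep_eq [OF inj(1)] map_key.rep_eq [OF inj(2)])
  have "b \<in> pattern (translate t P) \<longleftrightarrow> b - t \<in> pattern P" for b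
  proof
    assume "b \<in> pattern (translate t P)"
    then obtain m where "Poly_Mapping.lookup P (Poly_Mapping.map_key (\<lambda>a. a + t) m) \<noteq> 0" "Poly_Mapping.lookup m b \<noteq> 0"
      by (auto simp: pattern_iff lookup_translate)
    then show "b - t \<in> pattern P"
      unfolding pattern_iff by (intro exI conjI) (auto simp: map_key.rep_eq [OF inj(1)])
  next
    assume "b - t \<in> pattern P"
    then obtain m where m: "Poly_Mapping.lookup P m \<noteq> 0" "Poly_Mapping.lookup m (b - t) \<noteq> 0"
      by (auto simp: pattern_iff)
    then show "b \<in> pattern (translate t P)"
      unfolding pattern_iff lookup_translate
      by (intro exI [of _ "Poly_Mapping.map_key (\<lambda>a. a - t) m"]) (simp add: inv map_key.rep_eq [OF inj(2)])
  qed
  then show ?thesis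
    by (force simp: image_iff)
qed

text \<open>A system is represented by its finite set of polynomials, one for each equation
  up to translation.\<close>

definition pd_system :: "(int ^ 'd, 'a::comm_ring_1) mpoly set \<Rightarrow> bool" where
  "pd_system \<Gamma> \<longleftrightarrow> finite \<Gamma> \<and>
     (\<forall>P\<in>\<Gamma>. \<forall>Q\<in>\<Gamma>. P \<noteq> Q \<longrightarrow> (\<forall>t. pattern P \<noteq> (\<lambda>a. a + t) ` pattern Q))"

definition multilinear :: "(int ^ 'd, 'a::comm_ring_1) mpoly set \<Rightarrow> bool" where
  "multilinear \<Gamma> \<longleftrightarrow> (\<forall>P\<in>\<Gamma>. \<forall>a\<in>pattern P. degree_in P a = 1)"

definition copy_with_pattern ::
    "(int ^ 'd, 'a::comm_ring_1) mpoly set \<Rightarrow> (int ^ 'd) set \<Rightarrow> (int ^ 'd, 'a) mpoly" where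
  "copy_with_pattern \<Gamma> C = (THE Q. (\<exists>P\<in>\<Gamma>. \<exists>t. Q = translate t P) \<and> pattern Q = C)"

section \<open>Percolation and runs\<close>

definition copies :: "(int ^ 'd) set set \<Rightarrow> (int ^ 'd) set set" where
  "copies \<A> = {(\<lambda>a. a + t) ` A | A t. A \<in> \<A>}"

lemma finite_translate_self:
  fixes C :: "(int ^ 'd) set"
  assumes "finite C" "C \<noteq> {}" "(\<lambda>a. a + t) ` C = C"
  shows "t = 0"
proof -
  have "(\<Sum>a\<in>C. a) = (\<Sum>a\<in>(\<lambda>a. a + t) ` C. a)" using assms(3) by simp
  also have "\<dots> = (\<Sum>a\<in>C. a + t)" by (subst sum.reindex) (auto simp: inj_on_def)
  finally have "(\<Sum>a\<in>C. t) = 0" by (simp only: sum.distrib) simp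
  then have zero: "(\<Sum>a\<in>C. t) $ i = 0" for i by (simp only: zero_index)
  have "int (card C) * (t $ i) = 0" for i
    using zero [of i] unfolding sum_component by simp
  then show ?thesis using assms(1,2) by (simp add: vec_eq_iff)
qed

lemma finite_pattern: "finite (pattern P)" by (simp add: pattern_def)

lemma translate_translate_pattern:
  fixes C D :: "(int ^ 'd) set"
  assumes "(\<lambda>a. a + s) ` C = (\<lambda>a. a + t) ` D"
  shows "C = (\<lambda>a. a + (t - s)) ` D"
proof -
  from assms have "(\<lambda>a. a - s) ` (\<lambda>a. a + s) ` C = (\<lambda>a. a - s) ` (\<lambda>a. a + t) ` D" by simp
  then show ?thesis by (simp add: image_image algebra_simps)
qed

text \<open>The copy described in \<^const>\<open>copy_with_pattern\<close> exists and is unique for the sets met in a run.\<close>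

lemma copy_with_pattern_ex1:
  assumes "pd_system \<Gamma>" "C \<in> copies (pattern ` \<Gamma>)" "C \<noteq> {}"
  shows "\<exists>!Q. (\<exists>P\<in>\<Gamma>. \<exists>t. Q = translate t P) \<and> pattern Q = C"
proof -
  from assms(2) obtain P t where P: "P \<in> \<Gamma>" "C = pattern (translate t P)"
    by (auto simp: copies_def pattern_translate)
  have "translate t' P' = translate t P" if "P' \<in> \<Gamma>" "pattern (translate t' P') = C" for P' t'
  proof -
    have *: "pattern P' = (\<lambda>a. a + (t - t')) ` pattern P"
      using that(2) P(2) by (intro translate_translate_pattern) (simp add: pattern_translate)
    have sys: "P1 = P2" if "P1 \<in> \<Gamma>" "P2 \<in> \<Gamma>" "pattern P1 = (\<lambda>a. a + u) ` pattern P2" for P1 P2 u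
      using assms(1) that unfolding pd_system_def by metis
    have "P' = P"
      by (rule sys [OF that(1) P(1) *])
    moreover have "t - t' = 0"
    proof (rule finite_translate_self)
      show "finite (pattern P)" by (rule finite_pattern)
      show "pattern P \<noteq> {}" using assms(3) P(2) unfolding pattern_translate by blast
      show "(\<lambda>a. a + (t - t')) ` pattern P = pattern P"
        using * unfolding \<open>P' = P\<close> by (rule sym)
    qed
    ultimately show ?thesis by simp
  qed
  then show ?thesis
    using P by (intro ex1I [of _ "translate t P"]) (blast, clarify)
qed

text \<open>Patterns are finite, so the sequential process eventually occupies exactly the
  points of this least closed set; a point that is already occupied may harmlessly be occupied again.\<close>

inductive_set occupied :: "(int ^ 'd) set set \<Rightarrow> (int ^ 'd) set \<Rightarrow> (int ^ 'd) set \<Rightarrow> (int ^ 'd) set"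
  for \<A> S T where
  seed: "a \<in> S \<Longrightarrow> a \<in> occupied \<A> S T"
| step: "C \<in> copies \<A> \<Longrightarrow> C \<subseteq> T \<Longrightarrow> a \<in> C \<Longrightarrow>
         (\<And>b. b \<in> C - {a} \<Longrightarrow> b \<in> occupied \<A> S T) \<Longrightarrow> a \<in> occupied \<A> S T"

definition percolating_seed :: "(int ^ 'd) set set \<Rightarrow> (int ^ 'd) set \<Rightarrow> (int ^ 'd) set \<Rightarrow> bool" where
  "percolating_seed \<A> S T \<longleftrightarrow> S \<subseteq> T \<and> occupied \<A> S T = T"

text \<open>The index set of a sequence, indexed from 1, of finite or infinite length \<open>n\<close>.
  Values of the functions \<open>\<alpha>\<close>, \<open>\<Psi>\<close>, \<open>\<xi>\<close> below outside their index sets are irrelevant.\<close>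

definition indices :: "enat \<Rightarrow> nat set" where
  "indices n = {i. 1 \<le> i \<and> enat i \<le> n}"

definition run ::
    "(int ^ 'd) set set \<Rightarrow> (int ^ 'd) set \<Rightarrow> (int ^ 'd) set \<Rightarrow>
     enat \<Rightarrow> (nat \<Rightarrow> int ^ 'd) \<Rightarrow> (nat \<Rightarrow> nat set) \<Rightarrow> bool" where
  "run \<A> S T n \<alpha> \<Psi> \<longleftrightarrow>
     enat (card S) \<le> n \<and> bij_betw \<alpha> {1..card S} S \<and> \<alpha> ` indices n = T \<and>
     (\<forall>i\<in>indices n. card S < i \<longrightarrow>
        \<Psi> i \<subseteq> {1..i} \<and> i \<in> \<Psi> i \<and> inj_on \<alpha> (\<Psi> i) \<and> \<alpha> ` \<Psi> i \<in> copies \<A>)"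

section \<open>Free computations\<close>

text \<open>The field of rational functions in the indeterminates \<open>x\<^sub>n\<close> for all natural \<open>n\<close>;
  computations from a seed of size \<open>s\<close> take place in its subfield generated by
  \<open>x\<^sub>1, \<dots>, x\<^sub>s\<close> over \<open>'a\<close>.\<close>

type_synonym 'a ratfun = "(nat, 'a) mpoly fract"

definition rat_const :: "'a::field \<Rightarrow> 'a ratfun" where
  "rat_const c = Fract (const c) 1"

definition rat_indet :: "nat \<Rightarrow> 'a::field ratfun" where
  "rat_indet k = Fract (indet k) 1"

definition step_assignment ::
    "(nat \<Rightarrow> int ^ 'd) \<Rightarrow> (nat \<Rightarrow> nat set) \<Rightarrow> (nat \<Rightarrow> 'b) \<Rightarrow> nat \<Rightarrow> int ^ 'd \<Rightarrow> 'b" where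
  "step_assignment \<alpha> \<Psi> \<xi> i b = \<xi> (inv_into (\<Psi> i - {i}) \<alpha> b)"

text \<open>The equations determine \<open>\<xi>\<close> on the index set. A suitable \<open>\<xi>\<close> exists
  iff no denominator vanishes, i.e. iff the free computation is well-defined.\<close>

definition free_computation ::
    "(int ^ 'd, 'a::field) mpoly set \<Rightarrow> nat \<Rightarrow> (int ^ 'd \<Rightarrow> nat) \<Rightarrow>
     enat \<Rightarrow> (nat \<Rightarrow> int ^ 'd) \<Rightarrow> (nat \<Rightarrow> nat set) \<Rightarrow> (nat \<Rightarrow> 'a ratfun) \<Rightarrow> bool" where
  "free_computation \<Gamma> s \<eta> n \<alpha> \<Psi> \<xi> \<longleftrightarrow>
     (\<forall>i\<in>indices n.
        if i \<le> s then \<xi> i = rat_indet (\<eta> (\<alpha> i))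
        else
          let P = copy_with_pattern \<Gamma> (\<alpha> ` \<Psi> i);
              v = step_assignment \<alpha> \<Psi> \<xi> i;
              num = mpoly_eval rat_const v (numerator P (\<alpha> i));
              den = mpoly_eval rat_const v (denominator P (\<alpha> i))
          in den \<noteq> 0 \<and> \<xi> i = - num / den)"

definition proper_over :: "(int ^ 'd, 'a::field) mpoly set \<Rightarrow> (int ^ 'd) set \<Rightarrow> bool" where
  "proper_over \<Gamma> T \<longleftrightarrow> multilinear \<Gamma> \<and>
     (\<forall>S \<eta> n \<alpha> \<Psi>. finite S \<and> percolating_seed (pattern ` \<Gamma>) S T \<and>
        bij_betw \<eta> S {1..card S} \<and> run (pattern ` \<Gamma>) S T n \<alpha> \<Psi> \<longrightarrow>
        (\<exists>\<xi>. free_computation \<Gamma> (card S) \<eta> n \<alpha> \<Psi> \<xi>))"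

definition consistent_from ::
    "(int ^ 'd, 'a::field) mpoly set \<Rightarrow> (int ^ 'd) set \<Rightarrow> (int ^ 'd) set \<Rightarrow> bool" where
  "consistent_from \<Gamma> S T \<longleftrightarrow> proper_over \<Gamma> T \<and>
     finite S \<and> percolating_seed (pattern ` \<Gamma>) S T \<and>
     (\<forall>\<eta> n \<alpha> \<Psi> \<xi>. bij_betw \<eta> S {1..card S} \<and> run (pattern ` \<Gamma>) S T n \<alpha> \<Psi> \<and>
        free_computation \<Gamma> (card S) \<eta> n \<alpha> \<Psi> \<xi> \<longrightarrow>
        (\<forall>i\<in>indices n. \<forall>j\<in>indices n. \<alpha> i = \<alpha> j \<longrightarrow> \<xi> i = \<xi> j))"

definition consistent_over :: "(int ^ 'd, 'a::field) mpoly set \<Rightarrow> (int ^ 'd) set \<Rightarrow> bool" where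
  "consistent_over \<Gamma> T \<longleftrightarrow> (\<exists>S. consistent_from \<Gamma> S T)"

definition real_vec :: "int ^ 'd \<Rightarrow> real ^ 'd" where
  "real_vec a = (\<chi> i. real_of_int (a $ i))"

end

theory Submission
  imports Defs
begin

text \<open>A finite percolating seed of the plane forces at least one pattern to have a unique extreme point in each
  direction. Hence, if a support function, after subtracting those of \<open>A\<close> and \<open>B\<close>, has a linear minorant
  touching it near each direction, all these minorants are global. It follows that a finite
  convex set of lattice points \<open>T\<close> can be dismantled vertex by vertex, down to the region
  \<open>C = (conv A + conv B) \<inter> \<int>\<^sup>2\<close> or a vertex-deleted \<open>C\<close>, so that each removed vertex lies in at most one copy
  of \<open>A\<close> and one of \<open>B\<close>, and, if it lies in both, then both are part of a translate of \<open>C\<close>. Reversing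
  this, solutions extend from \<open>C\<close> to arbitrarily large regions: the only possible conflicts
  are those inside a translate of \<open>C\<close>, which are resolved by specialising the identity between rational functions
  given by consistency over \<open>C\<close>.

  The points which the dismantling removes from no copy at all form a seed. Counting solutions of the
  linear system over the field with two elements shows that no percolating seed is smaller,
  and a transcendence degree argument shows that the values of a consistent system at a seed of minimal size are
  algebraically independent, so that the system is consistent from this seed as well.\<close>

section \<open>Support functions and vertices of lattice sets\<close>

text \<open>Write h_X for \<open>supp_fun X\<close>. If the dismantling got stuck, every generic
  vertex of T outside F would lie in a copy of A and a copy of B inside T. In the directions where T
  exceeds F this gives h_T = h_Y + h_A = h_Z + h_B, with Y and Z the sets of admissible
  translations. Where B has a unique extreme point, h_B is linear nearby, so h_T - h_A - h_B is h_Y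
  minus a linear function and a point of Y supplies the minorant; symmetrically for A. A local
  minorant spreads along segments that avoid the origin.

  The two-element field serves because convolutions with A and with B commute, so its linear system
  can always be extended across a translate of C.

  Seeds are the second obstacle. Consistency is given from an unknown seed, while the extension
  needs seeds of C that also percolate C without a chosen vertex; comparing sizes bridges the gap.

  Runs are replaced by an inductive relation between points and values: properness speaks of whole,
  possibly infinite sequences, but only finite parts of them matter.\<close>

definition ip :: "int ^ 'd \<Rightarrow> real ^ 'd \<Rightarrow> real" where
  "ip z w = real_vec z \<bullet> w"

lemma real_vec_add: "real_vec (a + b) = real_vec a + real_vec b"
  and real_vec_diff: "real_vec (a - b) = real_vec a - real_vec b"
  and real_vec_zero [simp]: "real_vec 0 = 0"
  by (simp_all add: real_vec_def vec_eq_iff)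

lemma real_vec_eq_iff [simp]: "real_vec a = real_vec b \<longleftrightarrow> a = b"
  by (simp add: real_vec_def vec_eq_iff)

lemma ip_add: "ip (a + b) w = ip a w + ip b w"
  and ip_diff: "ip (a - b) w = ip a w - ip b w"
  and ip_zero [simp]: "ip 0 w = 0"
  and ip_zero_right [simp]: "ip a 0 = 0"
  by (simp_all add: ip_def real_vec_add real_vec_diff inner_simps)

lemma continuous_on_ip [continuous_intros]: "continuous_on X (ip z)"
  unfolding ip_def by (intro continuous_intros)

lemma ip_separates: "a \<noteq> b \<Longrightarrow> \<exists>w. ip a w \<noteq> ip b w"
  unfolding ip_def by (metis inner_diff_left inner_eq_zero_iff right_minus_eq real_vec_eq_iff)

definition unique_max :: "(int ^ 'd) set \<Rightarrow> real ^ 'd \<Rightarrow> int ^ 'd \<Rightarrow> bool" where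
  "unique_max X w a \<longleftrightarrow> a \<in> X \<and> (\<forall>x\<in>X. x \<noteq> a \<longrightarrow> ip x w < ip a w)"

definition supp_fun :: "(int ^ 'd) set \<Rightarrow> real ^ 'd \<Rightarrow> real" where
  "supp_fun X w = Max ((\<lambda>z. ip z w) ` X)"

lemma supp_fun_ge: "finite X \<Longrightarrow> x \<in> X \<Longrightarrow> ip x w \<le> supp_fun X w"
  by (simp add: supp_fun_def)

lemma supp_fun_attained:
  assumes "finite X" "X \<noteq> {}"
  obtains x where "x \<in> X" "supp_fun X w = ip x w"
proof -
  have "supp_fun X w \<in> (\<lambda>z. ip z w) ` X"
    unfolding supp_fun_def using assms by (intro Max_in) auto
  then show thesis using that by blast
qed

lemma supp_fun_le_iff: "finite X \<Longrightarrow> X \<noteq> {} \<Longrightarrow> supp_fun X w \<le> c \<longleftrightarrow> (\<forall>x\<in>X. ip x w \<le> c)"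
  by (simp add: supp_fun_def)

lemma supp_fun_less_iff: "finite X \<Longrightarrow> X \<noteq> {} \<Longrightarrow> supp_fun X w < c \<longleftrightarrow> (\<forall>x\<in>X. ip x w < c)"
  by (simp add: supp_fun_def)

lemma supp_fun_mono: "X \<subseteq> Y \<Longrightarrow> X \<noteq> {} \<Longrightarrow> finite Y \<Longrightarrow> supp_fun X w \<le> supp_fun Y w"
  by (metis finite_subset subsetD supp_fun_ge supp_fun_le_iff)

lemma unique_max_supp_fun: "finite X \<Longrightarrow> unique_max X w a \<Longrightarrow> supp_fun X w = ip a w"
  unfolding unique_max_def
  by (metis antisym empty_iff less_eq_real_def supp_fun_ge supp_fun_le_iff)

lemma continuous_on_supp_fun:
  assumes "finite X" "X \<noteq> {}"
  shows "continuous_on UNIV (supp_fun X)"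
  using assms
proof (induction rule: finite_ne_induct)
  case (singleton x)
  have "supp_fun {x} = ip x" by (simp add: supp_fun_def fun_eq_iff)
  then show ?case by (simp add: continuous_on_ip)
next
  case (insert x X)
  have "supp_fun (insert x X) = (\<lambda>w. max (ip x w) (supp_fun X w))"
    using insert.hyps by (simp add: supp_fun_def fun_eq_iff)
  then show ?case using insert.IH by (simp add: continuous_on_max continuous_on_ip)
qed

lemma unique_max_eventually:
  assumes "finite X" "unique_max X w a"
  shows "\<forall>\<^sub>F w' in nhds w. unique_max X w' a"
proof -
  have "\<forall>\<^sub>F w' in nhds w. ip x w' < ip a w'" if "x \<in> X - {a}" for x
  proof -
    have "open {w. ip x w < ip a w}"
      by (intro open_Collect_less continuous_on_ip)
    moreover have "w \<in> {w. ip x w < ip a w}"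
      using that assms(2) by (auto simp: unique_max_def)
    ultimately show ?thesis unfolding eventually_nhds by blast
  qed
  then have "\<forall>\<^sub>F w' in nhds w. \<forall>x\<in>X - {a}. ip x w' < ip a w'"
    using assms(1) by (intro eventually_ball_finite) auto
  then show ?thesis
    by eventually_elim (use assms(2) in \<open>auto simp: unique_max_def\<close>)
qed

text \<open>At the last maximiser of a tilted copy of the function along a segment, a local linear minorant
  would have to be constant.\<close>

lemma local_support_segment:
  fixes \<phi> :: "real \<Rightarrow> real"
  assumes cont: "continuous_on {0..1} \<phi>"
    and loc: "\<And>s. s \<in> {0<..<1} \<Longrightarrow> \<exists>k. \<forall>\<^sub>F r in nhds s. \<phi> s + k * (r - s) \<le> \<phi> r"
    and start: "\<phi> 0 = 0" "\<forall>\<^sub>F r in nhds 0. 0 \<le> r \<longrightarrow> 0 \<le> \<phi> r"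
  shows "0 \<le> \<phi> 1"
proof (rule ccontr)
  assume "\<not> 0 \<le> \<phi> 1"
  \<comment> \<open>Half of the supposed deficit: the tilted function is positive just after 0 and
    equals - c at 1, so its maximisers are interior.\<close>
  define c where "c = - \<phi> 1 / 2"
  have c: "0 < c" "\<phi> 1 = - 2 * c" using \<open>\<not> 0 \<le> \<phi> 1\<close> by (auto simp: c_def)
  define \<psi> where "\<psi> s = \<phi> s + c * s" for s
  have contp: "continuous_on {0..1} \<psi>"
    unfolding \<psi>_def by (intro continuous_intros cont)
  obtain m where m: "m \<in> {0..1}" "\<And>s. s \<in> {0..1} \<Longrightarrow> \<psi> s \<le> \<psi> m"
    using continuous_attains_sup [OF compact_Icc _ contp] by auto
  have "closed {s \<in> {0..1}. \<psi> s = \<psi> m}"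
    using continuous_closed_preimage_constant [OF contp] by simp
  then have "compact ({0..1} \<inter> {s \<in> {0..1}. \<psi> s = \<psi> m})"
    by (rule compact_Int_closed [OF compact_Icc])
  moreover have "{0..1} \<inter> {s \<in> {0..1}. \<psi> s = \<psi> m} = {s \<in> {0..1}. \<psi> s = \<psi> m}" by auto
  ultimately have comp: "compact {s \<in> {0..1}. \<psi> s = \<psi> m}" by simp
  obtain l where l: "l \<in> {0..1}" "\<psi> l = \<psi> m"
    and last: "\<And>s. s \<in> {0..1} \<Longrightarrow> \<psi> s = \<psi> m \<Longrightarrow> s \<le> l"
    using compact_attains_sup [OF comp] m(1) by auto
  have max: "\<psi> s \<le> \<psi> l" if "s \<in> {0..1}" for s using m(2) [OF that] l(2) by simp
  obtain d where d: "d > 0" "\<And>r. 0 \<le> r \<Longrightarrow> r < d \<Longrightarrow> 0 \<le> \<phi> r"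
    using start(2) unfolding eventually_nhds_metric by (auto simp: dist_real_def)
  define r where "r = min (d / 2) 1"
  have r: "0 < r" "r < d" "r \<le> 1" using d(1) by (auto simp: r_def)
  have "0 < \<psi> r" using d(2) [of r] r c(1) by (simp add: \<psi>_def add_nonneg_pos)
  then have pos: "0 < \<psi> l" using max [of r] r by simp
  have "\<psi> 0 = 0" "\<psi> 1 < 0" using start(1) c by (auto simp: \<psi>_def)
  then have inner: "l \<in> {0<..<1}" using pos l(1) by (cases "l = 0"; cases "l = 1") auto
  obtain k where "\<forall>\<^sub>F r in nhds l. \<phi> l + k * (r - l) \<le> \<phi> r" using loc [OF inner] by blast
  then obtain e where e: "e > 0" "\<And>r. \<bar>r - l\<bar> < e \<Longrightarrow> \<phi> l + k * (r - l) \<le> \<phi> r"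
    unfolding eventually_nhds_metric by (auto simp: dist_real_def)
  \<comment> \<open>Since l is the last maximiser, the tilted function drops strictly at l + t; the
    tilted minorant then has negative slope and forces a value above the maximum at l - t.\<close>
  define t where "t = Min {e / 2, l, 1 - l}"
  have t: "0 < t" "t < e" "l - t \<in> {0..1}" "l + t \<in> {0..1}"
    using e(1) inner by (auto simp: t_def)
  have "\<psi> l + (k + c) * t \<le> \<psi> (l + t)" "\<psi> l - (k + c) * t \<le> \<psi> (l - t)"
    using e(2) [of "l + t"] e(2) [of "l - t"] t(1,2) by (simp_all add: \<psi>_def algebra_simps)
  moreover have "\<psi> (l + t) < \<psi> l"
    using max [OF t(4)] last [OF t(4)] l(2) t(1) by (cases "\<psi> (l + t) = \<psi> m") auto
  ultimately have "\<psi> l < \<psi> (l - t)" by linarith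
  then show False using max [OF t(3)] by simp
qed

text \<open>The one-dimensional statement applies along the segment from w0 to w unless the segment
  meets the origin, the only place where no local minorant is assumed. In that case w is perturbed
  and continuity gives the limit.\<close>

lemma local_support_global:
  fixes f :: "real ^ 2 \<Rightarrow> real"
  assumes cont: "continuous_on UNIV f"
    and loc: "\<And>w. w \<noteq> 0 \<Longrightarrow> \<exists>g. f w = g \<bullet> w \<and> (\<forall>\<^sub>F w' in nhds w. g \<bullet> w' \<le> f w')"
    and w0: "w0 \<noteq> 0" "f w0 = g0 \<bullet> w0" "\<forall>\<^sub>F w' in nhds w0. g0 \<bullet> w' \<le> f w'"
  shows "g0 \<bullet> w \<le> f w"
proof -
  have off: "g0 \<bullet> w \<le> f w" if off: "\<And>s. s \<in> {0..1} \<Longrightarrow> w0 + s *\<^sub>R (w - w0) \<noteq> 0" for w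
  proof -
    define p where "p s = w0 + s *\<^sub>R (w - w0)" for s :: real
    define \<phi> where "\<phi> s = f (p s) - g0 \<bullet> p s" for s
    have pcont: "continuous_on X p" for X unfolding p_def by (intro continuous_intros)
    have ptends: "filterlim p (nhds (p s)) (nhds s)" for s
      using continuous_on_tendsto_compose [OF pcont [of UNIV] filterlim_ident, of s] by simp
    have "0 \<le> \<phi> 1"
    proof (rule local_support_segment)
      show "continuous_on {0..1} \<phi>"
        unfolding \<phi>_def
        by (intro continuous_intros pcont continuous_on_compose2 [OF cont pcont]) auto
      show "\<phi> 0 = 0" by (simp add: \<phi>_def p_def w0(2))
      have p0: "p 0 = w0" by (simp add: p_def)
      have "\<forall>\<^sub>F r in nhds 0. g0 \<bullet> p r \<le> f (p r)"
        using filterlim_iff [THEN iffD1, OF ptends [of 0], rule_format, OF w0(3) [folded p0]] .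
      then show "\<forall>\<^sub>F r in nhds 0. 0 \<le> r \<longrightarrow> 0 \<le> \<phi> r"
        by eventually_elim (simp add: \<phi>_def)
      fix s :: real assume s: "s \<in> {0<..<1}"
      then have "p s \<noteq> 0" using off [of s] by (simp add: p_def)
      then obtain g where g: "f (p s) = g \<bullet> p s" "\<forall>\<^sub>F w' in nhds (p s). g \<bullet> w' \<le> f w'"
        using loc by blast
      have "\<forall>\<^sub>F r in nhds s. g \<bullet> p r \<le> f (p r)"
        using filterlim_iff [THEN iffD1, OF ptends [of s], rule_format, OF g(2)] .
      then have "\<forall>\<^sub>F r in nhds s. \<phi> s + ((g - g0) \<bullet> (w - w0)) * (r - s) \<le> \<phi> r"
      proof eventually_elim
        case (elim r)
        have "p r = p s + (r - s) *\<^sub>R (w - w0)" by (simp add: p_def algebra_simps)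
        then have "(g - g0) \<bullet> p r = (g - g0) \<bullet> p s + (r - s) * ((g - g0) \<bullet> (w - w0))"
          by (simp add: inner_add_right)
        then show ?case using elim g(1) by (simp add: \<phi>_def inner_diff_left algebra_simps)
      qed
      then show "\<exists>k. \<forall>\<^sub>F r in nhds s. \<phi> s + k * (r - s) \<le> \<phi> r" by blast
    qed
    then show ?thesis by (simp add: \<phi>_def p_def)
  qed
  \<comment> \<open>A direction across the line through the origin and w0: endpoints moved along v
    leave this line, so their segments from w0 miss the origin.\<close>
  obtain v :: "real ^ 2" where v: "v \<noteq> 0" "w0 \<bullet> v = 0"
    by (rule that [of "vector [- (w0 $ 2), w0 $ 1]"]) (use w0(1) in \<open>auto simp: inner_vec_def vec_eq_iff sum_2 forall_2 vector_2\<close>)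
  show ?thesis
  proof (cases "\<forall>s\<in>{0..1}. w0 + s *\<^sub>R (w - w0) \<noteq> 0")
    case True
    then show ?thesis using off by blast
  next
    case False
    then obtain s where s: "s \<in> {0..1}" "w0 + s *\<^sub>R (w - w0) = 0" by blast
    have "w \<bullet> v = 0"
    proof -
      have "(w0 + s *\<^sub>R (w - w0)) \<bullet> v = 0" using s(2) by simp
      then have "s * (w \<bullet> v) = 0" using v(2) by (simp add: inner_simps)
      moreover have "s \<noteq> 0" using s w0(1) by auto
      ultimately show ?thesis by simp
    qed
    have near: "g0 \<bullet> (w + (1 / Suc n) *\<^sub>R v) \<le> f (w + (1 / Suc n) *\<^sub>R v)" for n
    proof (rule off)
      fix r :: real assume "r \<in> {0..1}"
      show "w0 + r *\<^sub>R (w + (1 / Suc n) *\<^sub>R v - w0) \<noteq> 0"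
      proof
        assume *: "w0 + r *\<^sub>R (w + (1 / Suc n) *\<^sub>R v - w0) = 0"
        then have "(w0 + r *\<^sub>R (w + (1 / Suc n) *\<^sub>R v - w0)) \<bullet> v = 0" by simp
        then have "r * (1 / Suc n) * (v \<bullet> v) = 0"
          using v(2) \<open>w \<bullet> v = 0\<close> by (simp add: inner_simps)
        then have "r = 0" using v(1) by simp
        then show False using * w0(1) by simp
      qed
    qed
    have "(\<lambda>n. w + (1 / Suc n) *\<^sub>R v) \<longlonglongrightarrow> w + 0 *\<^sub>R v"
      by (intro tendsto_intros LIMSEQ_Suc [OF lim_1_over_n])
    then have lim: "(\<lambda>n. w + (1 / Suc n) *\<^sub>R v) \<longlonglongrightarrow> w" by simp
    show ?thesis
    proof (rule LIMSEQ_le)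
      show "(\<lambda>n. g0 \<bullet> (w + (1 / Suc n) *\<^sub>R v)) \<longlonglongrightarrow> g0 \<bullet> w"
        by (intro tendsto_intros lim)
      show "(\<lambda>n. f (w + (1 / Suc n) *\<^sub>R v)) \<longlonglongrightarrow> f w"
        by (rule continuous_on_tendsto_compose [OF cont lim]) auto
    qed (use near in blast)
  qed
qed

text \<open>Finitely many hyperplanes cannot cover a nonempty open set. The induction keeps a whole
  open set of good directions, so that the next hyperplane can be removed as well.\<close>

lemma generic_direction:
  fixes U :: "(real ^ 'd) set"
  assumes "finite D" "open U" "U \<noteq> {}"
  shows "\<exists>w\<in>U. \<forall>d\<in>D. d \<noteq> 0 \<longrightarrow> ip d w \<noteq> 0"
proof -
  have "\<exists>V\<subseteq>U. open V \<and> V \<noteq> {} \<and> (\<forall>w\<in>V. \<forall>d\<in>D. d \<noteq> 0 \<longrightarrow> ip d w \<noteq> 0)"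
    using assms(1)
  proof (induction rule: finite_induct)
    case empty
    then show ?case using assms by blast
  next
    case (insert d D)
    then obtain V where V: "V \<subseteq> U" "open V" "V \<noteq> {}" "\<forall>w\<in>V. \<forall>d\<in>D. d \<noteq> 0 \<longrightarrow> ip d w \<noteq> 0"
      by (elim exE conjE) (rule that)
    show ?case
    proof (cases "d = 0")
      case True
      then show ?thesis using V by (intro exI [of _ V]) simp
    next
      case False
      have opn: "open (V \<inter> {w. ip d w \<noteq> 0})"
        by (intro open_Int V open_Collect_neq continuous_on_ip continuous_intros)
      have "V \<inter> {w. ip d w \<noteq> 0} \<noteq> {}"
      proof -
        obtain w where w: "w \<in> V" using V(3) by blast
        have "\<forall>\<^sub>F s in at_right 0. w + s *\<^sub>R real_vec d \<in> V"
        proof (rule topological_tendstoD [OF _ V(2)])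
          have "((\<lambda>s. w + s *\<^sub>R real_vec d) \<longlongrightarrow> w + 0 *\<^sub>R real_vec d) (at_right 0)"
            by (intro tendsto_intros)
          then show "((\<lambda>s. w + s *\<^sub>R real_vec d) \<longlongrightarrow> w) (at_right 0)" by simp
        qed (use w in simp)
        then obtain e where e: "e > 0" "\<And>s. 0 < s \<Longrightarrow> s < e \<Longrightarrow> w + s *\<^sub>R real_vec d \<in> V"
          unfolding eventually_at_right_field by auto
        \<comment> \<open>The product with d is affine in s with nonzero slope, so it vanishes for
          at most one of e / 2 and e / 4.\<close>
        define s where "s = (if ip d w = - (e / 2) * ip d (real_vec d) then e / 4 else e / 2)"
        have "ip d (real_vec d) \<noteq> 0" using False real_vec_eq_iff [of d 0] by (simp add: ip_def)
        moreover have "ip d (w + s *\<^sub>R real_vec d) = ip d w + s * ip d (real_vec d)"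
          by (simp add: ip_def inner_simps)
        ultimately have "ip d (w + s *\<^sub>R real_vec d) \<noteq> 0"
          using e(1) by (auto simp: s_def)
        moreover have "w + s *\<^sub>R real_vec d \<in> V" using e by (simp add: s_def)
        ultimately show ?thesis by blast
      qed
      then show ?thesis using V opn by (intro exI [of _ "V \<inter> {w. ip d w \<noteq> 0}"]) auto
    qed
  qed
  then obtain V where V: "V \<subseteq> U" "V \<noteq> {}" "\<forall>w\<in>V. \<forall>d\<in>D. d \<noteq> 0 \<longrightarrow> ip d w \<noteq> 0"
    by (elim exE conjE) (rule that)
  then obtain w where "w \<in> V" by auto
  then show ?thesis using V by (intro bexI [of _ w]) auto
qed

text \<open>These are the finite sets that contain all lattice points of their convex hull,
  expressed by strict separation so that no real hull has to be handled. The empty set is one of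
  them.\<close>

definition hull_closed :: "(int ^ 'd) set \<Rightarrow> bool" where
  "hull_closed X \<longleftrightarrow> finite X \<and> (\<forall>z. z \<notin> X \<longrightarrow> (\<exists>w. \<forall>x\<in>X. ip x w < ip z w))"

text \<open>The removed vertex is separated by the direction in which it was the unique maximum; the
  other outside points keep their separating directions.\<close>

lemma hull_closed_remove:
  assumes "hull_closed X" "unique_max X w z"
  shows "hull_closed (X - {z})"
  unfolding hull_closed_def
proof (intro conjI allI impI)
  fix y assume y: "y \<notin> X - {z}"
  show "\<exists>w. \<forall>x\<in>X - {z}. ip x w < ip y w"
  proof (cases "y = z")
    case True
    then show ?thesis using assms(2) by (auto simp: unique_max_def)
  next
    case False
    then show ?thesis using y assms(1) unfolding hull_closed_def by (metis DiffD1 Diff_iff singletonD)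
  qed
qed (use assms(1) in \<open>simp add: hull_closed_def\<close>)

abbreviation shift :: "int ^ 'd \<Rightarrow> (int ^ 'd) set \<Rightarrow> (int ^ 'd) set" where
  "shift t X \<equiv> (\<lambda>a. a + t) ` X"

text \<open>The region of the theorem, given by its supporting half-planes;
  \<open>hull_sum_eq\<close> identifies the two descriptions for finite nonempty sets.\<close>

definition hull_sum :: "(int ^ 'd) set \<Rightarrow> (int ^ 'd) set \<Rightarrow> (int ^ 'd) set" where
  "hull_sum A B = {z. \<forall>w. ip z w \<le> supp_fun A w + supp_fun B w}"

section \<open>Dismantling a convex region vertex by vertex\<close>

locale pattern_pair =
  fixes A B :: "(int ^ 2) set"
  assumes fin: "finite A" "finite B" and ne: "A \<noteq> {}" "B \<noteq> {}"
    and max_or: "w \<noteq> 0 \<Longrightarrow> (\<exists>a. unique_max A w a) \<or> (\<exists>b. unique_max B w b)"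
begin

abbreviation C :: "(int ^ 2) set" where "C \<equiv> hull_sum A B"

text \<open>Dual form of conv A + conv B being a Minkowski summand of the hull of F: the difference
  of the support functions is a pointwise maximum of linear functions. It supplies minorants in the
  directions where a larger region does not exceed F.\<close>

definition supported :: "(int ^ 2) set \<Rightarrow> bool" where
  "supported F \<longleftrightarrow> (\<forall>w. \<exists>g. supp_fun F w = supp_fun A w + supp_fun B w + g \<bullet> w \<and>
     (\<forall>w'. supp_fun A w' + supp_fun B w' + g \<bullet> w' \<le> supp_fun F w'))"

lemma generic_maxima:
  assumes T: "finite T" "T \<noteq> {}" and U: "open U" "U \<noteq> {}"
  obtains w z a b where "w \<in> U" "w \<noteq> 0" "unique_max T w z" "unique_max A w a" "unique_max B w b"
proof -
  define K where "K = T \<union> A \<union> B"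
  have K: "finite K" unfolding K_def using T fin by simp
  \<comment> \<open>The all-ones vector joins the differences to make w nonzero.\<close>
  obtain w where w: "w \<in> U" "\<forall>d\<in>insert 1 ((\<lambda>(x, y). x - y) ` (K \<times> K)). d \<noteq> 0 \<longrightarrow> ip d w \<noteq> 0"
    using generic_direction [of "insert 1 ((\<lambda>(x, y). x - y) ` (K \<times> K))" U] U K by auto
  have "\<exists>a. unique_max X w a" if X: "X \<subseteq> K" "X \<noteq> {}" for X
  proof -
    have "finite X" using X(1) K by (rule finite_subset)
    then obtain a where a: "a \<in> X" "supp_fun X w = ip a w" using X(2) by (rule supp_fun_attained)
    have "ip x w < ip a w" if x: "x \<in> X" "x \<noteq> a" for x
    proof -
      have "ip x w \<le> ip a w" using supp_fun_ge [OF \<open>finite X\<close> x(1), of w] a(2) by simp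
      moreover have "ip (x - a) w \<noteq> 0" using w(2) x a(1) X(1) by auto
      ultimately show ?thesis by (simp add: ip_diff)
    qed
    then show ?thesis using a(1) by (auto simp: unique_max_def)
  qed
  moreover have "ip 1 w \<noteq> 0" using w(2) by simp
  then have "w \<noteq> 0" by auto
  ultimately show thesis using that w(1) T(2) ne by (metis K_def Un_upper1 Un_upper2 le_sup_iff)
qed

text \<open>If all generic vertices outside F were bad, T would decompose both with summand A and
  with summand B. The two decompositions give h_T - h_A - h_B a touching linear minorant at every
  direction, hence a global one; at a generic direction it is z - a - b, which says that this
  translate of C lies in T after all.\<close>

lemma good_vertex:
  assumes T: "hull_closed T" and F: "hull_closed F" "F \<subseteq> T" "F \<noteq> T" "F = {} \<or> supported F"
  shows "\<exists>w z a b. z \<in> T - F \<and> unique_max T w z \<and> unique_max A w a \<and> unique_max B w b \<and>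
    (shift (z - a) A \<subseteq> T \<and> shift (z - b) B \<subseteq> T \<longrightarrow> shift (z - a - b) C \<subseteq> T)"
proof (rule ccontr)
  assume "\<not> ?thesis"
  then have bad: "shift (z - a) A \<subseteq> T" "shift (z - b) B \<subseteq> T" "\<not> shift (z - a - b) C \<subseteq> T"
    if "z \<notin> F" "unique_max T w z" "unique_max A w a" "unique_max B w b" for w z a b
    using that unfolding unique_max_def by blast+
  have finT: "finite T" and neT: "T \<noteq> {}" and finF: "finite F"
    using T F by (auto simp: hull_closed_def)
  \<comment> \<open>The directions in which T reaches beyond F; a vertex of T exposed in such a
    direction is outside F.\<close>
  define \<Omega> where "\<Omega> = {w. F = {} \<or> supp_fun F w < supp_fun T w}"
  have "open \<Omega>"
  proof (cases "F = {}")
    case False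
    then have "\<Omega> = {w. supp_fun F w < supp_fun T w}" by (simp add: \<Omega>_def)
    then show ?thesis
      using False finF finT neT by (simp add: open_Collect_less continuous_on_supp_fun)
  qed (simp add: \<Omega>_def)
  have "\<Omega> \<noteq> {}"
  proof (cases "F = {}")
    case False
    obtain z where z: "z \<in> T" "z \<notin> F" using F by blast
    then obtain w where "\<forall>x\<in>F. ip x w < ip z w" using F(1) unfolding hull_closed_def by blast
    then have "supp_fun F w < ip z w" using False finF by (simp add: supp_fun_less_iff)
    then have "w \<in> \<Omega>" using supp_fun_ge [OF finT z(1), of w] by (simp add: \<Omega>_def)
    then show ?thesis by blast
  qed (simp add: \<Omega>_def)
  have top: "z \<notin> F" if "w \<in> \<Omega>" "unique_max T w z" for w z
    using that finF supp_fun_ge [OF finF, of z w] unique_max_supp_fun [OF finT that(2)]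
    by (force simp: \<Omega>_def)
  have decomp: "\<exists>Y. finite Y \<and> Y \<noteq> {} \<and> (\<forall>w\<in>\<Omega>. supp_fun T w = supp_fun Y w + supp_fun E w)"
    if E: "E = A \<or> E = B" for E
  proof -
    define Y where "Y = {t. shift t E \<subseteq> T}"
    have finE: "finite E" "E \<noteq> {}" using E fin ne by auto
    obtain e where "e \<in> E" using finE by blast
    then have "Y \<subseteq> (\<lambda>z. z - e) ` T" unfolding Y_def by (force simp: image_iff)
    then have finY: "finite Y" using finT finite_surj by blast
    \<comment> \<open>At a generic direction the badness of the top vertex puts a copy of E, with
      its extreme point at this vertex, inside T.\<close>
    have gen: "\<exists>w\<in>U. \<exists>y\<in>Y. supp_fun T w = ip y w + supp_fun E w"
      if U: "open U" "U \<noteq> {}" "U \<subseteq> \<Omega>" for U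
    proof -
      obtain w z a b where w: "w \<in> U" "unique_max T w z" "unique_max A w a" "unique_max B w b"
        using generic_maxima [OF finT neT U(1,2)] by metis
      have "z \<notin> F" using top w U(3) by blast
      then have "z - a \<in> Y \<or> E \<noteq> A" "z - b \<in> Y \<or> E \<noteq> B"
        using bad [of z w a b] w by (auto simp: Y_def)
      moreover have "supp_fun T w = ip z w" "supp_fun A w = ip a w" "supp_fun B w = ip b w"
        using w finT fin by (simp_all add: unique_max_supp_fun)
      moreover have "ip z w = ip (z - a) w + ip a w" "ip z w = ip (z - b) w + ip b w"
        by (simp_all add: ip_diff)
      ultimately show ?thesis using w(1) E by metis
    qed
    have neY: "Y \<noteq> {}" using gen [OF \<open>open \<Omega>\<close> \<open>\<Omega> \<noteq> {}\<close>] by blast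
    have ge: "supp_fun Y w + supp_fun E w \<le> supp_fun T w" for w
    proof -
      obtain y where y: "y \<in> Y" "supp_fun Y w = ip y w" using finY neY by (rule supp_fun_attained)
      obtain e where e: "e \<in> E" "supp_fun E w = ip e w" using finE by (rule supp_fun_attained)
      have "e + y \<in> T" using y e by (auto simp: Y_def)
      then show ?thesis using supp_fun_ge [OF finT, of "e + y" w] y e by (simp add: ip_add)
    qed
    \<comment> \<open>Failure of the equality is an open condition, so it would contain a generic
      direction.\<close>
    have "supp_fun T w \<le> supp_fun Y w + supp_fun E w" if "w \<in> \<Omega>" for w
    proof (rule ccontr)
      let ?U = "\<Omega> \<inter> {w. supp_fun Y w + supp_fun E w < supp_fun T w}"
      assume "\<not> supp_fun T w \<le> supp_fun Y w + supp_fun E w"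
      then have "?U \<noteq> {}" using that by (auto simp: not_le)
      moreover have "open ?U"
        by (intro open_Int \<open>open \<Omega>\<close> open_Collect_less continuous_intros continuous_on_supp_fun
            finY neY finE finT neT)
      ultimately obtain w' y where "w' \<in> ?U" "y \<in> Y" "supp_fun T w' = ip y w' + supp_fun E w'"
        using gen [of ?U] by blast
      then show False using supp_fun_ge [OF finY, of y w'] by force
    qed
    then show ?thesis using finY neY ge by (intro exI [of _ Y]) (auto intro: antisym)
  qed
  define f where "f w = supp_fun T w - supp_fun A w - supp_fun B w" for w
  have "continuous_on UNIV f"
    unfolding f_def by (intro continuous_intros continuous_on_supp_fun finT neT fin ne)
  moreover have "\<exists>g. f w = g \<bullet> w \<and> (\<forall>\<^sub>F w' in nhds w. g \<bullet> w' \<le> f w')" if "w \<noteq> 0" for w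
  proof (cases "w \<in> \<Omega>")
    case True
    \<comment> \<open>E is split off from T, while G is locally represented by its unique extreme
      point b; the minorant is y - b with y maximal in Y.\<close>
    have *: ?thesis if EG: "(E = A \<and> G = B) \<or> (E = B \<and> G = A)" and b: "unique_max G w b" for E G b
    proof -
      have finG: "finite G" using EG fin by blast
      obtain Y where Y: "finite Y" "Y \<noteq> {}" "\<And>w. w \<in> \<Omega> \<Longrightarrow> supp_fun T w = supp_fun Y w + supp_fun E w"
        using decomp [of E] EG by blast
      obtain y where y: "y \<in> Y" "supp_fun Y w = ip y w" using Y(1,2) by (rule supp_fun_attained)
      have f: "f w' = supp_fun Y w' - ip b w'" if "w' \<in> \<Omega>" "unique_max G w' b" for w'
        using EG Y(3) [OF that(1)] unique_max_supp_fun [OF finG that(2)] by (auto simp: f_def)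
      have "\<forall>\<^sub>F w' in nhds w. w' \<in> \<Omega>" using \<open>open \<Omega>\<close> True by (auto simp: eventually_nhds)
      then have "\<forall>\<^sub>F w' in nhds w. real_vec (y - b) \<bullet> w' \<le> f w'"
        using unique_max_eventually [OF finG b]
      proof eventually_elim
        case (elim w')
        then show ?case
          using f [of w'] supp_fun_ge [OF Y(1) y(1), of w'] ip_diff [of y b w'] by (simp add: ip_def)
      qed
      moreover have "f w = real_vec (y - b) \<bullet> w"
        using f [OF True b] y(2) ip_diff [of y b w] by (simp add: ip_def)
      ultimately show ?thesis by blast
    qed
    show ?thesis using max_or [OF \<open>w \<noteq> 0\<close>] * by blast
  next
    case False
    \<comment> \<open>Here T and F have the same support value, so a minorant for F that touches at
      w also touches for T.\<close>
    then have neF: "F \<noteq> {}" and "supp_fun T w \<le> supp_fun F w" by (auto simp: \<Omega>_def)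
    then have eq: "supp_fun T w = supp_fun F w" and le: "\<And>w'. supp_fun F w' \<le> supp_fun T w'"
      using supp_fun_mono [OF F(2) neF finT] by (auto intro: antisym)
    obtain g where g: "supp_fun F w = supp_fun A w + supp_fun B w + g \<bullet> w"
      "\<And>w'. supp_fun A w' + supp_fun B w' + g \<bullet> w' \<le> supp_fun F w'"
      using F(4) neF unfolding supported_def by blast
    have "g \<bullet> w' \<le> f w'" for w' using g(2) [of w'] le [of w'] by (simp add: f_def)
    then show ?thesis using g(1) eq by (intro exI [of _ g]) (simp add: f_def)
  qed
  moreover obtain w z a b where w: "w \<in> \<Omega>" "w \<noteq> 0" "unique_max T w z" "unique_max A w a" "unique_max B w b"
    using generic_maxima [OF finT neT \<open>open \<Omega>\<close> \<open>\<Omega> \<noteq> {}\<close>] by metis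
  moreover have "\<forall>\<^sub>F w' in nhds w. real_vec (z - a - b) \<bullet> w' \<le> f w'"
    using unique_max_eventually [OF finT w(3)] unique_max_eventually [OF fin(1) w(4)]
      unique_max_eventually [OF fin(2) w(5)]
    by eventually_elim (use finT fin in
      \<open>simp add: f_def unique_max_supp_fun flip: ip_def, simp add: ip_diff\<close>)
  moreover have "f w = real_vec (z - a - b) \<bullet> w"
    using w finT fin by (simp add: f_def unique_max_supp_fun flip: ip_def) (simp add: ip_diff)
  ultimately have glob: "real_vec (z - a - b) \<bullet> w' \<le> f w'" for w'
    using local_support_global [of f w "real_vec (z - a - b)" w'] by blast
  \<comment> \<open>A point of the translate outside T would be separated from T in some direction,
    against the global minorant.\<close>
  have "shift (z - a - b) C \<subseteq> T"
  proof
    fix y assume "y \<in> shift (z - a - b) C"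
    then obtain c where c: "c \<in> C" "y = c + (z - a - b)" by blast
    show "y \<in> T"
    proof (rule ccontr)
      assume "y \<notin> T"
      then obtain v where "\<forall>x\<in>T. ip x v < ip y v" using T unfolding hull_closed_def by blast
      then have "supp_fun T v < ip y v" using finT neT by (simp add: supp_fun_less_iff)
      moreover have "ip c v \<le> supp_fun A v + supp_fun B v" using c(1) by (simp add: hull_sum_def)
      moreover have "ip y v = ip c v + ip (z - a - b) v" by (simp only: c(2) ip_add)
      ultimately show False using glob [of v] by (simp add: f_def ip_def)
    qed
  qed
  then show False using bad(3) [OF top [OF w(1,3)] w(3-5)] by blast
qed

end

section \<open>Growing convex regions\<close>

lemma finite_int_box:
  fixes K :: "'d::finite \<Rightarrow> int set"
  assumes "\<And>i. finite (K i)"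
  shows "finite {z :: int ^ 'd. \<forall>i. z $ i \<in> K i}"
proof (rule finite_imageD)
  have "finite (PiE UNIV K)" using assms by (intro finite_PiE) simp_all
  then show "finite (vec_nth ` {z :: int ^ 'd. \<forall>i. z $ i \<in> K i})"
    by (rule finite_subset [rotated]) auto
qed (simp add: inj_on_def vec_eq_iff)

lemma ip_axis: "ip z (axis i c) = c * of_int (z $ i)"
  by (simp add: ip_def real_vec_def inner_axis)

lemma supp_fun_plus_le:
  assumes "finite X" "X \<noteq> {}" "finite Y" "Y \<noteq> {}"
  obtains x y where "x \<in> X" "y \<in> Y" "supp_fun X w + supp_fun Y w = ip (x + y) w"
  using supp_fun_attained [OF assms(1,2), of w] supp_fun_attained [OF assms(3,4), of w]
  by (metis ip_add)

lemma plus_in_hull_sum: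
  "finite X \<Longrightarrow> finite Y \<Longrightarrow> x \<in> X \<Longrightarrow> y \<in> Y \<Longrightarrow> x + y \<in> hull_sum X Y"
  by (simp add: hull_sum_def ip_add add_mono supp_fun_ge)

lemma finite_hull_sum: "finite (hull_sum X Y)"
proof -
  let ?h = "\<lambda>w. supp_fun X w + supp_fun Y w"
  have "z $ i \<in> {\<lfloor>- ?h (axis i (-1))\<rfloor>..\<lceil>?h (axis i 1)\<rceil>}" if "z \<in> hull_sum X Y" for z i
  proof -
    have "ip z (axis i 1) \<le> ?h (axis i 1)" "ip z (axis i (-1)) \<le> ?h (axis i (-1))"
      using that unfolding hull_sum_def by blast+
    then have "of_int (z $ i) \<le> ?h (axis i 1)" "- of_int (z $ i) \<le> ?h (axis i (-1))"
      by (simp_all add: ip_axis)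
    then show ?thesis unfolding atLeastAtMost_iff by linarith
  qed
  then have "hull_sum X Y \<subseteq> {z. \<forall>i. z $ i \<in> {\<lfloor>- ?h (axis i (-1))\<rfloor>..\<lceil>?h (axis i 1)\<rceil>}}" by blast
  then show ?thesis by (rule finite_subset) (rule finite_int_box, rule finite_atLeastAtMost_int)
qed

lemma supp_fun_hull_sum:
  assumes "finite X" "X \<noteq> {}" "finite Y" "Y \<noteq> {}"
  shows "supp_fun (hull_sum X Y) w = supp_fun X w + supp_fun Y w"
proof -
  obtain x y where xy: "x \<in> X" "y \<in> Y" "supp_fun X w + supp_fun Y w = ip (x + y) w"
    using supp_fun_plus_le [OF assms] by metis
  have *: "x + y \<in> hull_sum X Y" using xy assms by (simp add: plus_in_hull_sum)
  then have "supp_fun (hull_sum X Y) w \<le> supp_fun X w + supp_fun Y w"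
    using supp_fun_le_iff [OF finite_hull_sum, of X Y w] by (auto simp: hull_sum_def)
  then show ?thesis using supp_fun_ge [OF finite_hull_sum *, of w] xy(3) by linarith
qed

lemma hull_closed_hull_sum: "hull_closed (hull_sum X Y)"
  using finite_hull_sum [of X Y]
  by (auto simp: hull_closed_def hull_sum_def not_le intro: le_less_trans)

text \<open>The hull of the pointwise sum is compact, so a point outside it is separated by some u;
  the support functions in direction - u then exclude the point from the half-plane description
  too.\<close>

lemma hull_sum_eq:
  assumes "finite X" "X \<noteq> {}" "finite Y" "Y \<noteq> {}"
  shows "{z. real_vec z \<in> convex hull (real_vec ` X) + convex hull (real_vec ` Y)} = hull_sum X Y"
proof -
  let ?K = "convex hull (real_vec ` X + real_vec ` Y)"
  have K: "convex hull (real_vec ` X) + convex hull (real_vec ` Y) = ?K"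
    by (rule convex_hull_set_plus [symmetric])
  have "compact ?K"
    by (intro finite_imp_compact_convex_hull finite_set_plus finite_imageI assms)
  then have clo: "closed ?K" by (rule compact_imp_closed)
  have "real_vec z \<in> ?K \<longleftrightarrow> z \<in> hull_sum X Y" for z
  proof
    assume z: "real_vec z \<in> ?K"
    have "ip z w \<le> supp_fun X w + supp_fun Y w" for w
    proof -
      have "?K \<subseteq> {v. w \<bullet> v \<le> supp_fun X w + supp_fun Y w}"
      proof (rule hull_minimal)
        show "real_vec ` X + real_vec ` Y \<subseteq> {v. w \<bullet> v \<le> supp_fun X w + supp_fun Y w}"
          using supp_fun_ge [OF assms(1)] supp_fun_ge [OF assms(3)]
          by (auto simp: set_plus_def ip_def inner_add_right inner_commute intro!: add_mono)
      qed (rule convex_halfspace_le)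
      then show ?thesis using z by (auto simp: ip_def inner_commute)
    qed
    then show "z \<in> hull_sum X Y" by (simp add: hull_sum_def)
  next
    assume z: "z \<in> hull_sum X Y"
    show "real_vec z \<in> ?K"
    proof (rule ccontr)
      assume "real_vec z \<notin> ?K"
      then obtain u c where u: "u \<bullet> real_vec z < c" "\<forall>x\<in>?K. u \<bullet> x > c"
        using separating_hyperplane_closed_point [OF convex_convex_hull clo] by blast
      obtain x y where xy: "x \<in> X" "y \<in> Y" "supp_fun X (- u) + supp_fun Y (- u) = ip (x + y) (- u)"
        using supp_fun_plus_le [OF assms] by metis
      have "real_vec (x + y) \<in> ?K"
        using xy by (intro hull_inc) (auto simp: real_vec_add)
      then have "c < u \<bullet> real_vec (x + y)" using u(2) by blast
      moreover have "ip z (- u) \<le> ip (x + y) (- u)"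
        using z unfolding xy(3) [symmetric] hull_sum_def by blast
      ultimately show False using u(1) by (simp add: ip_def inner_commute)
    qed
  qed
  then show ?thesis unfolding K by blast
qed

section \<open>Monotonicity and locality of percolation\<close>

lemma copies_pair_iff: "D \<in> copies {A, B} \<longleftrightarrow> (\<exists>t. D = shift t A \<or> D = shift t B)"
  by (auto simp: copies_def)

lemma occupied_subset: "occupied \<A> S T \<subseteq> S \<union> T"
proof
  fix a assume "a \<in> occupied \<A> S T"
  then show "a \<in> S \<union> T" by (induction rule: occupied.induct) auto
qed

lemma occupied_trans:
  assumes "T \<subseteq> T'" "S \<subseteq> occupied \<A> S' T'"
  shows "occupied \<A> S T \<subseteq> occupied \<A> S' T'"
proof
  fix a assume "a \<in> occupied \<A> S T"
  then show "a \<in> occupied \<A> S' T'"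
  proof (induction rule: occupied.induct)
    case (step D a)
    show ?case by (rule occupied.step [OF step(1) order_trans [OF step(2) assms(1)] step(3,5)])
  qed (use assms(2) in blast)
qed

lemma occupied_mono: "S \<subseteq> S' \<Longrightarrow> T \<subseteq> T' \<Longrightarrow> occupied \<A> S T \<subseteq> occupied \<A> S' T'"
  by (rule occupied_trans) (auto intro: occupied.seed)

lemma percolating_seedI: "S \<subseteq> T \<Longrightarrow> T \<subseteq> occupied \<A> S T \<Longrightarrow> percolating_seed \<A> S T"
  using occupied_subset [of \<A> S T] by (auto simp: percolating_seed_def)

text \<open>Patterns are finite, so a point becomes occupied by means of finitely many copies.
  Statements about the plane thereby reduce to finite convex regions.\<close>

lemma occupied_finite_region:
  assumes "\<forall>A\<in>\<A>. finite A" "a \<in> occupied \<A> S T"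
  shows "\<exists>T0. finite T0 \<and> T0 \<subseteq> T \<and> a \<in> occupied \<A> S T0"
  using assms(2)
proof (induction rule: occupied.induct)
  case (seed a)
  then show ?case by (intro exI [of _ "{}"]) (simp add: occupied.seed)
next
  case (step D a)
  then have "\<forall>b\<in>D - {a}. \<exists>T0. finite T0 \<and> T0 \<subseteq> T \<and> b \<in> occupied \<A> S T0" by blast
  then obtain R where R: "\<And>b. b \<in> D - {a} \<Longrightarrow> finite (R b) \<and> R b \<subseteq> T \<and> b \<in> occupied \<A> S (R b)"
    by metis
  have "finite D" using step.hyps(1) assms(1) by (auto simp: copies_def)
  define T0 where "T0 = D \<union> (\<Union>b\<in>D - {a}. R b)"
  have "b \<in> occupied \<A> S T0" if "b \<in> D - {a}" for b
    using R [OF that] occupied_mono [of S S "R b" T0 \<A>] that by (auto simp: T0_def)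
  moreover have "D \<subseteq> T0" by (auto simp: T0_def)
  ultimately have "a \<in> occupied \<A> S T0"
    by (rule occupied.step [OF step.hyps(1) _ step.hyps(3), rotated])
  moreover have "finite T0" "T0 \<subseteq> T" using \<open>finite D\<close> R step.hyps by (auto simp: T0_def)
  ultimately show ?case by blast
qed

section \<open>The region C and the growth relation\<close>

context pattern_pair
begin

lemma finite_C: "finite C" and C_ne: "C \<noteq> {}" and hull_closed_C: "hull_closed C"
  using ne plus_in_hull_sum [OF fin] by (auto simp: finite_hull_sum hull_closed_hull_sum)

lemma supp_fun_C: "supp_fun C w = supp_fun A w + supp_fun B w"
  by (rule supp_fun_hull_sum [OF fin(1) ne(1) fin(2) ne(2)])

lemma supported_C: "supported C"
  unfolding supported_def by (intro allI exI [of _ 0]) (simp add: supp_fun_C)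

lemma supported_hull_sum:
  assumes "finite L" "L \<noteq> {}"
  shows "supported (hull_sum C L)"
  unfolding supported_def
proof
  fix w
  obtain l where l: "l \<in> L" "supp_fun L w = ip l w" using assms by (rule supp_fun_attained)
  have "supp_fun (hull_sum C L) v = supp_fun A v + supp_fun B v + supp_fun L v" for v
    using assms finite_C C_ne by (simp add: supp_fun_hull_sum supp_fun_C)
  then show "\<exists>g. supp_fun (hull_sum C L) w = supp_fun A w + supp_fun B w + g \<bullet> w \<and>
      (\<forall>w'. supp_fun A w' + supp_fun B w' + g \<bullet> w' \<le> supp_fun (hull_sum C L) w')"
    using l supp_fun_ge [OF assms(1) l(1)] by (intro exI [of _ "real_vec l"]) (simp flip: ip_def)
qed

text \<open>Add to C a set L of translations: 0 keeps C itself, and s - c moves a fixed point c of C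
  to s. A Minkowski sum with C is supported because a point of L maximal in direction w gives the
  minorant touching at w.\<close>

lemma supported_superset:
  assumes "finite S"
  obtains F where "hull_closed F" "supported F" "S \<subseteq> F" "C \<subseteq> F"
proof -
  obtain c where c: "c \<in> C" using C_ne by blast
  define L where "L = insert 0 ((\<lambda>s. s - c) ` S)"
  have L: "finite L" "L \<noteq> {}" "0 \<in> L" using assms by (auto simp: L_def)
  have "s \<in> hull_sum C L" if "s \<in> S" for s
    using plus_in_hull_sum [OF finite_C L(1) c, of "s - c"] that by (simp add: L_def)
  moreover have "x \<in> hull_sum C L" if "x \<in> C" for x
    using plus_in_hull_sum [OF finite_C L(1) that L(3)] by simp
  ultimately show thesis
    using that [of "hull_sum C L"] hull_closed_hull_sum supported_hull_sum L by blast
qed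

definition exposed :: "int ^ 2 \<Rightarrow> int ^ 2 \<Rightarrow> bool" where
  "exposed a b \<longleftrightarrow> (\<exists>w. unique_max A w a \<and> unique_max B w b)"

text \<open>The weak inequality for c against a + b persists for all directions near w. Tilting w
  slightly towards c - (a + b) would violate it unless the inequality at w is strict.\<close>

lemma unique_max_C:
  assumes "unique_max A w a" "unique_max B w b"
  shows "unique_max C w (a + b)"
  unfolding unique_max_def
proof (intro conjI ballI impI)
  show "a + b \<in> C" using assms fin by (auto simp: unique_max_def intro: plus_in_hull_sum)
  fix c assume c: "c \<in> C" "c \<noteq> a + b"
  define d where "d = c - (a + b)"
  have le: "ip c w' \<le> ip (a + b) w'" if "unique_max A w' a" "unique_max B w' b" for w'
    using c(1) that fin by (simp add: hull_sum_def ip_add unique_max_supp_fun [symmetric])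
  have ev: "\<forall>\<^sub>F w' in nhds w. ip d w' \<le> 0"
    using unique_max_eventually [OF fin(1) assms(1)] unique_max_eventually [OF fin(2) assms(2)]
    by eventually_elim (use le in \<open>simp add: d_def ip_diff\<close>)
  have "((\<lambda>s. w + s *\<^sub>R real_vec d) \<longlongrightarrow> w + 0 *\<^sub>R real_vec d) (at_right 0)"
    by (intro tendsto_intros)
  then have "filterlim (\<lambda>s. w + s *\<^sub>R real_vec d) (nhds w) (at_right 0)" by simp
  then have "\<forall>\<^sub>F s in at_right 0. ip d (w + s *\<^sub>R real_vec d) \<le> 0"
    by (rule eventually_compose_filterlim [OF ev])
  then obtain e where e: "e > 0" "\<And>s. 0 < s \<Longrightarrow> s < e \<Longrightarrow> ip d (w + s *\<^sub>R real_vec d) \<le> 0"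
    unfolding eventually_at_right_field by auto
  have "d \<noteq> 0" using c(2) by (simp add: d_def)
  then have "real_vec d \<noteq> 0" using real_vec_eq_iff [of d 0] by simp
  then have "0 < (e / 2) * (real_vec d \<bullet> real_vec d)" using e(1) by simp
  moreover have "ip d w + (e / 2) * (real_vec d \<bullet> real_vec d) \<le> 0"
    using e(2) [of "e / 2"] e(1) by (simp add: ip_def inner_simps)
  ultimately show "ip c w < ip (a + b) w" by (simp add: d_def ip_diff)
qed

text \<open>The removal of a vertex z read backwards: T is the region without z. A copy through z
  has its exposed point a or b at z, and if both copies fit, so does the translate of C with a + b
  at z.\<close>

definition good_step :: "(int ^ 2) set \<Rightarrow> int ^ 2 \<Rightarrow> int ^ 2 \<Rightarrow> int ^ 2 \<Rightarrow> bool" where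
  "good_step T z a b \<longleftrightarrow> z \<notin> T \<and> exposed a b \<and>
     (\<forall>t. z \<in> shift t A \<and> shift t A \<subseteq> insert z T \<longrightarrow> t = z - a) \<and>
     (\<forall>t. z \<in> shift t B \<and> shift t B \<subseteq> insert z T \<longrightarrow> t = z - b) \<and>
     (shift (z - a) A \<subseteq> insert z T \<and> shift (z - b) B \<subseteq> insert z T \<longrightarrow>
        shift (z - a - b) C \<subseteq> insert z T)"

text \<open>The second component records the points that no copy determines at their arrival.
  Started from empty sets, it becomes a percolating seed of the region, and by
  \<open>card_le_percolating\<close> one of least size.\<close>

inductive grows :: "(int ^ 2) set \<Rightarrow> (int ^ 2) set \<Rightarrow> (int ^ 2) set \<Rightarrow> (int ^ 2) set \<Rightarrow> bool"
  for T S where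
  start: "grows T S T S"
| free: "grows T S T' S' \<Longrightarrow> good_step T' z a b \<Longrightarrow>
    \<not> (\<exists>D\<in>copies {A, B}. z \<in> D \<and> D \<subseteq> insert z T') \<Longrightarrow> grows T S (insert z T') (insert z S')"
| forced: "grows T S T' S' \<Longrightarrow> good_step T' z a b \<Longrightarrow>
    \<exists>D\<in>copies {A, B}. z \<in> D \<and> D \<subseteq> insert z T' \<Longrightarrow> grows T S (insert z T') S'"

text \<open>A copy inside T through the unique maximum z must have its own extreme point there,
  which fixes the translation.\<close>

lemma good_step_remove:
  assumes "unique_max T w z" "unique_max A w a" "unique_max B w b"
    and "shift (z - a) A \<subseteq> T \<and> shift (z - b) B \<subseteq> T \<longrightarrow> shift (z - a - b) C \<subseteq> T"
  shows "good_step (T - {z}) z a b"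
proof -
  have ins: "insert z (T - {z}) = T" using assms(1) by (auto simp: unique_max_def)
  have "t = z - e" if e: "unique_max E w e" and t: "z \<in> shift t E" "shift t E \<subseteq> T" for E e t
  proof -
    obtain x where x: "x \<in> E" "z = x + t" using t(1) by blast
    have "e + t \<in> T" using e t(2) by (auto simp: unique_max_def)
    then have "ip (e + t) w \<le> ip z w" using assms(1) unfolding unique_max_def by force
    then have "\<not> ip x w < ip e w" by (simp add: x(2) ip_add)
    then have "x = e" using e x(1) by (auto simp: unique_max_def)
    then show ?thesis using x(2) by simp
  qed
  then show ?thesis
    using assms unfolding good_step_def ins exposed_def by blast
qed

lemma grows_exists:
  assumes "hull_closed T" "hull_closed F" "F \<subseteq> T" "F = {} \<or> supported F"
  shows "\<exists>S'. grows F S T S'"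
  using assms(1,3)
proof (induction "card (T - F)" arbitrary: T)
  case 0
  then have "T = F" by (auto simp: hull_closed_def)
  then show ?case using grows.start by blast
next
  case (Suc n)
  then have "F \<noteq> T" by auto
  then obtain w z a b where z: "z \<in> T - F" and w: "unique_max T w z" "unique_max A w a" "unique_max B w b"
    and both: "shift (z - a) A \<subseteq> T \<and> shift (z - b) B \<subseteq> T \<longrightarrow> shift (z - a - b) C \<subseteq> T"
    using good_vertex [OF Suc.prems(1) assms(2) Suc.prems(2) _ assms(4)] by metis
  have "T - {z} - F = T - F - {z}" by blast
  then have "card (T - {z} - F) = n" using Suc.hyps(2) z by simp
  then obtain S' where S': "grows F S (T - {z}) S'"
    using Suc.hyps(1) [of "T - {z}"] hull_closed_remove [OF Suc.prems(1) w(1)] Suc.prems(2) z by blast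
  moreover have "insert z (T - {z}) = T" using z by blast
  ultimately show ?case
    using grows.free [OF S' good_step_remove [OF w both]]
      grows.forced [OF S' good_step_remove [OF w both]] by metis
qed

lemma grows_C_remove:
  assumes "exposed a b"
  obtains S where "grows {} {} (C - {a + b}) S"
proof -
  obtain w where w: "unique_max A w a" "unique_max B w b" using assms unfolding exposed_def by blast
  have "hull_closed {}" by (simp add: hull_closed_def)
  then show thesis
    using grows_exists [OF hull_closed_remove [OF hull_closed_C unique_max_C [OF w]]] that by blast
qed

text \<open>The vertex a + b lies in \<open>shift b A\<close>, which is contained in C, so its
  arrival is forced and the same seed serves C with and without this vertex. The clause of
  \<open>good_step\<close> about C is trivial, as the translation is 0.\<close>

lemma grows_C:
  assumes "exposed a b" "grows {} {} (C - {a + b}) S"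
  shows "grows {} {} C S"
proof -
  obtain w where w: "unique_max A w a" "unique_max B w b" using assms unfolding exposed_def by blast
  have ab: "a + b \<in> C" using unique_max_C [OF w] by (simp add: unique_max_def)
  have sub: "shift b A \<subseteq> C" "shift a B \<subseteq> C"
    using w fin by (auto simp: unique_max_def intro: plus_in_hull_sum) (metis add.commute plus_in_hull_sum)
  have "good_step (C - {a + b}) (a + b) a b"
    by (rule good_step_remove [OF unique_max_C [OF w] w]) simp
  moreover have "shift b A \<in> copies {A, B}" "a + b \<in> shift b A"
    using w by (auto simp: copies_pair_iff unique_max_def)
  moreover have ins: "insert (a + b) (C - {a + b}) = C" using ab by blast
  ultimately have "grows {} {} (insert (a + b) (C - {a + b})) S"
    using sub(1) by (intro grows.forced [OF assms(2)]) (simp, metis ins)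
  then show ?thesis by (simp only: ins)
qed

lemma exposed_exists: "\<exists>a b. exposed a b"
proof -
  obtain w a b where "unique_max A w a" "unique_max B w b"
    by (rule generic_maxima [OF fin(1) ne(1) open_UNIV UNIV_not_empty])
  then show ?thesis unfolding exposed_def by blast
qed

lemma grows_subset:
  assumes "grows T S T' S'"
  shows "T \<subseteq> T' \<and> S \<subseteq> S' \<and> S' - S \<subseteq> T' - T \<and> (finite S \<longrightarrow> finite S')"
  using assms by (induction rule: grows.induct) (auto simp: good_step_def)

lemma grows_percolating:
  assumes "grows T S T' S'" "percolating_seed {A, B} S T"
  shows "percolating_seed {A, B} S' T'"
  using assms(1)
proof (induction rule: grows.induct)
  case start
  then show ?case by (rule assms(2))
next
  case (free T' S' z a b)
  then have "S' \<subseteq> T'" "T' \<subseteq> occupied {A, B} S' T'" by (auto simp: percolating_seed_def)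
  then show ?case
    using occupied_mono [of S' "insert z S'" T' "insert z T'"]
    by (intro percolating_seedI) (auto intro: occupied.seed)
next
  case (forced T' S' z a b)
  then have *: "S' \<subseteq> T'" "T' \<subseteq> occupied {A, B} S' T'" by (auto simp: percolating_seed_def)
  then have **: "T' \<subseteq> occupied {A, B} S' (insert z T')"
    using occupied_mono [of S' S' T' "insert z T'"] by auto
  obtain D where D: "D \<in> copies {A, B}" "z \<in> D" "D \<subseteq> insert z T'" using forced.hyps(3) by blast
  have "z \<in> occupied {A, B} S' (insert z T')"
    by (rule occupied.step [OF D(1,3,2)]) (use ** D(3) in blast)
  then show ?case using * ** by (intro percolating_seedI) auto
qed

lemma percolating_seed_empty: "percolating_seed {A, B} {} {}"
  by (rule percolating_seedI) auto

text \<open>Solutions of the linear system over the field with two elements, as sets of points.\<close>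

definition even_on :: "(int ^ 2) set \<Rightarrow> (int ^ 2) set \<Rightarrow> bool" where
  "even_on T V \<longleftrightarrow> (\<forall>D\<in>copies {A, B}. D \<subseteq> T \<longrightarrow> even (card (V \<inter> D)))"

text \<open>Both sides count the pairs (x, y) in A and B with x + y + g in V. This commutation
  replaces a consistency hypothesis for the system over the field with two elements.\<close>

lemma double_count:
  "(\<Sum>y\<in>B. card (V \<inter> shift (g + y) A)) = (\<Sum>x\<in>A. card (V \<inter> shift (g + x) B))"
proof -
  have *: "card (V \<inter> shift t X) = (\<Sum>x\<in>X. of_bool (x + t \<in> V))" if "finite X" for X t
  proof -
    have "V \<inter> shift t X = (\<lambda>x. x + t) ` {x \<in> X. x + t \<in> V}" by auto
    then have "card (V \<inter> shift t X) = card {x \<in> X. x + t \<in> V}"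
      by (simp add: card_image inj_on_def)
    then show ?thesis using that by (simp add: sum.If_cases of_bool_def Int_def)
  qed
  show ?thesis
    unfolding * [OF fin(1)] * [OF fin(2)] by (subst sum.swap) (simp add: ac_simps)
qed

text \<open>Adding z or not fixes the parity of every copy through z at once, provided these copies
  agree. There is at most one of each pattern, and if both occur, double counting over the translate
  of C shows that their parities agree.\<close>

lemma even_on_extend:
  assumes "good_step T z a b" "even_on T V" "V \<subseteq> T"
  shows "\<exists>W\<in>{V, insert z V}. even_on (insert z T) W"
proof -
  let ?T = "insert z T"
  have z: "z \<notin> V" using assms(1,3) by (auto simp: good_step_def)
  have uA: "t = z - a" if "z \<in> shift t A" "shift t A \<subseteq> ?T" for t
    using assms(1) that unfolding good_step_def by blast
  have uB: "t = z - b" if "z \<in> shift t B" "shift t B \<subseteq> ?T" for t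
    using assms(1) that unfolding good_step_def by blast
  have ab: "a \<in> A" "b \<in> B" using assms(1) by (auto simp: good_step_def exposed_def unique_max_def)
  have old: "even (card (V \<inter> D))" if "D \<in> copies {A, B}" "D \<subseteq> ?T" "z \<notin> D" for D
    using assms(2) that unfolding even_on_def by blast
  have both: "even (card (V \<inter> shift (z - a) A)) \<longleftrightarrow> even (card (V \<inter> shift (z - b) B))"
    if "shift (z - a) A \<subseteq> ?T" "shift (z - b) B \<subseteq> ?T"
  proof -
    let ?g = "z - a - b"
    have C: "shift ?g C \<subseteq> ?T" using assms(1) that unfolding good_step_def by blast
    have sub: "shift (?g + y) A \<subseteq> ?T" if "y \<in> B" for y
    proof -
      have "shift (?g + y) A \<subseteq> shift ?g C"
        using plus_in_hull_sum [OF fin _ that] by (force simp: image_iff algebra_simps)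
      then show ?thesis using C by blast
    qed
    have sub': "shift (?g + x) B \<subseteq> ?T" if "x \<in> A" for x
    proof -
      have "shift (?g + x) B \<subseteq> shift ?g C"
        using plus_in_hull_sum [OF fin that] by (force simp: image_iff algebra_simps)
      then show ?thesis using C by blast
    qed
    \<comment> \<open>In the double count all copies but two avoid z, by uniqueness of the
      translation, and are already even in the old region.\<close>
    have "even (\<Sum>y\<in>B - {b}. card (V \<inter> shift (?g + y) A))"
    proof (rule dvd_sum)
      fix y assume y: "y \<in> B - {b}"
      then have "z \<notin> shift (?g + y) A" using uA [of "?g + y"] sub [of y] by auto
      then show "even (card (V \<inter> shift (?g + y) A))"
        using sub [of y] y by (intro old) (auto simp: copies_pair_iff)
    qed
    moreover have "even (\<Sum>x\<in>A - {a}. card (V \<inter> shift (?g + x) B))"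
    proof (rule dvd_sum)
      fix x assume x: "x \<in> A - {a}"
      then have "z \<notin> shift (?g + x) B" using uB [of "?g + x"] sub' [of x] by auto
      then show "even (card (V \<inter> shift (?g + x) B))"
        using sub' [of x] x by (intro old) (auto simp: copies_pair_iff)
    qed
    moreover have "(\<Sum>y\<in>B. card (V \<inter> shift (?g + y) A)) =
        card (V \<inter> shift (z - a) A) + (\<Sum>y\<in>B - {b}. card (V \<inter> shift (?g + y) A))"
      using ab fin by (simp add: sum.remove)
    moreover have "(\<Sum>x\<in>A. card (V \<inter> shift (?g + x) B)) =
        card (V \<inter> shift (z - b) B) + (\<Sum>x\<in>A - {a}. card (V \<inter> shift (?g + x) B))"
      using ab fin by (simp add: sum.remove)
    ultimately show ?thesis using double_count [of V ?g] by (metis even_add)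
  qed
  have finD: "finite D" if "D \<in> copies {A, B}" for D
    using that fin by (auto simp: copies_pair_iff)
  have flip: "even (card (insert z V \<inter> D)) \<longleftrightarrow> odd (card (V \<inter> D))"
    if "D \<in> copies {A, B}" "z \<in> D" for D
    using that z finD by simp
  have keep: "insert z V \<inter> D = V \<inter> D" if "z \<notin> D" for D using that by blast
  have new: "D = shift (z - a) A \<or> D = shift (z - b) B"
    if "D \<in> copies {A, B}" "D \<subseteq> ?T" "z \<in> D" for D
    using that uA uB unfolding copies_pair_iff by metis
  show ?thesis
  proof (cases "\<exists>D. D \<in> copies {A, B} \<and> z \<in> D \<and> D \<subseteq> ?T \<and> odd (card (V \<inter> D))")
    case True
    then obtain D0 where D0: "D0 \<in> copies {A, B}" "z \<in> D0" "D0 \<subseteq> ?T" "odd (card (V \<inter> D0))"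
      by (elim exE conjE)
    have odd: "odd (card (V \<inter> D))" if "D \<in> copies {A, B}" "D \<subseteq> ?T" "z \<in> D" for D
      using new [OF that] new [OF D0(1,3,2)] both that(2) D0(3,4) by (elim disjE) simp_all
    have "even_on ?T (insert z V)"
      unfolding even_on_def
    proof (intro ballI impI)
      fix D assume D: "D \<in> copies {A, B}" "D \<subseteq> ?T"
      show "even (card (insert z V \<inter> D))"
      proof (cases "z \<in> D")
        case True
        then show ?thesis using flip [OF D(1)] odd [OF D] by simp
      next
        case False
        then show ?thesis using old [OF D] by (simp add: keep)
      qed
    qed
    then show ?thesis by blast
  next
    case False
    then have "even_on ?T V" unfolding even_on_def using old by blast
    then show ?thesis by blast
  qed
qed

text \<open>W prescribes the values at the newly free points, where no equation restricts them; at
  forced points the solution is extended by \<open>even_on_extend\<close>.\<close>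

lemma even_on_grows:
  assumes "grows T S T' S'" "even_on T V" "V \<subseteq> T"
  shows "\<exists>V'. even_on T' V' \<and> V' \<subseteq> T' \<and> V' \<inter> T = V \<and> V' \<inter> (S' - S) = W \<inter> (S' - S)"
  using assms(1)
proof (induction rule: grows.induct)
  case start
  then show ?case using assms(2,3) by blast
next
  case (free T' S' z a b)
  then obtain V' where V': "even_on T' V'" "V' \<subseteq> T'" "V' \<inter> T = V" "V' \<inter> (S' - S) = W \<inter> (S' - S)"
    by blast
  have zT: "z \<notin> T'" using free.hyps(2) by (simp add: good_step_def)
  have sub: "T \<subseteq> T'" "S' - S \<subseteq> T'" using grows_subset [OF free.hyps(1)] by auto
  define V'' where "V'' = (if z \<in> W then insert z V' else V')"
  have "V'' \<inter> D = V' \<inter> D" if "D \<in> copies {A, B}" "D \<subseteq> insert z T'" for D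
    using free.hyps(3) that by (auto simp: V''_def)
  then have "even_on (insert z T') V''"
    using V'(1) free.hyps(3) unfolding even_on_def by (metis subset_insert)
  moreover have "V'' \<inter> (insert z S' - S) = W \<inter> (insert z S' - S)"
    using V'(2,4) zT sub by (auto simp: V''_def)
  moreover have "V'' \<subseteq> insert z T'" "V'' \<inter> T = V" using V' zT sub by (auto simp: V''_def)
  ultimately show ?case by blast
next
  case (forced T' S' z a b)
  then obtain V' where V': "even_on T' V'" "V' \<subseteq> T'" "V' \<inter> T = V" "V' \<inter> (S' - S) = W \<inter> (S' - S)"
    by blast
  have zT: "z \<notin> T'" using forced.hyps(2) by (simp add: good_step_def)
  have sub: "T \<subseteq> T'" "S' - S \<subseteq> T'" using grows_subset [OF forced.hyps(1)] by auto
  obtain V'' where V'': "V'' \<in> {V', insert z V'}" "even_on (insert z T') V''"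
    using even_on_extend [OF forced.hyps(2) V'(1,2)] by blast
  moreover have "V'' \<inter> (S' - S) = W \<inter> (S' - S)" "V'' \<subseteq> insert z T'" "V'' \<inter> T = V"
    using V' zT sub V''(1) by auto
  ultimately show ?case by blast
qed

text \<open>Following the percolation, the parity of a copy fixes membership of its last vacant
  point.\<close>

lemma even_on_determined:
  assumes "even_on T V" "even_on T W" "V \<inter> R = W \<inter> R" "a \<in> occupied {A, B} R T"
  shows "a \<in> V \<longleftrightarrow> a \<in> W"
  using assms(4)
proof (induction rule: occupied.induct)
  case (seed a)
  then show ?case using assms(3) by blast
next
  case (step D a)
  have finD: "finite D" using step.hyps(1) fin by (auto simp: copies_pair_iff)
  have par: "even (card (V \<inter> D))" "even (card (W \<inter> D))"
    using assms(1,2) step.hyps(1,2) by (auto simp: even_on_def)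
  have eq: "V \<inter> (D - {a}) = W \<inter> (D - {a})" using step.IH by blast
  have *: "card (X \<inter> D) = of_bool (a \<in> X) + card (X \<inter> (D - {a}))" for X
  proof (cases "a \<in> X")
    case True
    then have "X \<inter> D = insert a (X \<inter> (D - {a}))" using step.hyps(3) by blast
    then have "card (X \<inter> D) = Suc (card (X \<inter> (D - {a})))"
      using finD by (metis Diff_iff IntE card_insert_disjoint finite_Diff finite_Int insertI1)
    then show ?thesis using True by simp
  next
    case False
    then have "X \<inter> D = X \<inter> (D - {a})" by blast
    then show ?thesis using False by simp
  qed
  show ?case using par * [of V] * [of W] unfolding eq by (cases "a \<in> V"; cases "a \<in> W") auto
qed

text \<open>Each assignment of values in the field with two elements to \<open>S\<close> extends to a solution, which is
  determined on \<open>F\<close>, hence on \<open>S\<close>, by its values on \<open>R\<close>.\<close>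

lemma card_le_percolating:
  assumes "grows {} {} F S" "grows F S F' S'" "F \<subseteq> occupied {A, B} R F'" "finite R"
  shows "card S \<le> card R"
proof -
  have S: "finite S" "S \<subseteq> F" using grows_subset [OF assms(1)] by auto
  have "\<exists>V. even_on F' V \<and> V \<inter> S = W" if W: "W \<in> Pow S" for W
  proof -
    have "even_on {} {}" by (simp add: even_on_def)
    then obtain V where V: "even_on F V" "V \<subseteq> F" "V \<inter> S = W \<inter> S"
      using even_on_grows [OF assms(1), of "{}" W] by auto
    obtain V' where "even_on F' V'" "V' \<inter> F = V" using even_on_grows [OF assms(2) V(1,2)] by blast
    then show ?thesis using V W S by (intro exI [of _ V']) auto
  qed
  then obtain E where E: "\<And>W. W \<in> Pow S \<Longrightarrow> even_on F' (E W) \<and> E W \<inter> S = W" by metis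
  have "inj_on (\<lambda>W. E W \<inter> R) (Pow S)"
  proof (rule inj_onI)
    fix W W' assume W: "W \<in> Pow S" "W' \<in> Pow S" "E W \<inter> R = E W' \<inter> R"
    then have "a \<in> E W \<longleftrightarrow> a \<in> E W'" if "a \<in> F" for a
      using even_on_determined [OF _ _ W(3)] E assms(3) that by blast
    then have "E W \<inter> S = E W' \<inter> S" using S by blast
    then show "W = W'" using E W by metis
  qed
  then have "card (Pow S) \<le> card (Pow R)"
    by (rule card_inj_on_le) (use assms(4) in auto)
  then show ?thesis using S assms(4) by (simp add: card_Pow)
qed

end

text \<open>If neither pattern had a unique extreme point in direction \<open>w\<close>, no point could be the first one
  occupied outside a half-plane that contains the seed.\<close>

lemma percolating_imp_unique_max:
  fixes A B :: "(int ^ 'd) set"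
  assumes "finite S" "percolating_seed {A, B} S UNIV" "w \<noteq> 0"
  shows "(\<exists>a. unique_max A w a) \<or> (\<exists>b. unique_max B w b)"
proof (rule ccontr)
  assume no: "\<not> ?thesis"
  \<comment> \<open>The 0 covers an empty seed.\<close>
  define M where "M = Max (insert 0 ((\<lambda>z. ip z w) ` S))"
  have "ip z w \<le> M" if "z \<in> occupied {A, B} S UNIV" for z
    using that
  proof (induction rule: occupied.induct)
    case (seed a)
    then show ?case using assms(1) by (auto simp: M_def)
  next
    case (step D a)
    show ?case
    proof (rule ccontr)
      assume less: "\<not> ip a w \<le> M"
      obtain t E where D: "D = shift t E" "E = A \<or> E = B"
        using step.hyps(1) by (auto simp: copies_pair_iff)
      have "unique_max E w (a - t)"
        unfolding unique_max_def
      proof (intro conjI ballI impI)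
        show "a - t \<in> E" using step.hyps(3) D(1) by auto
        fix x assume x: "x \<in> E" "x \<noteq> a - t"
        then have "x + t \<in> D - {a}" using D(1) by auto
        then have "ip (x + t) w \<le> M" using step.IH by blast
        then show "ip x w < ip (a - t) w" using less by (simp add: ip_add ip_diff)
      qed
      then show False using no D(2) by blast
    qed
  qed
  then have bound: "ip z w \<le> M" for z using assms(2) by (simp add: percolating_seed_def)
  obtain i where i: "w $ i \<noteq> 0" using assms(3) by (auto simp: vec_eq_iff)
  \<comment> \<open>A multiple of the i-th unit vector, with the sign of \<open>w $ i\<close>,
    beyond the half-plane; the added 1 makes the excess strict.\<close>
  define k where "k = (\<lceil>M / \<bar>w $ i\<bar>\<rceil> + 1) * (if w $ i > 0 then 1 else -1)"
  have "ip (axis i k) w = of_int k * w $ i"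
    by (simp add: ip_def real_vec_def inner_vec_def axis_def if_distrib if_distribR cong: if_cong)
  also have "\<dots> = (of_int \<lceil>M / \<bar>w $ i\<bar>\<rceil> + 1) * \<bar>w $ i\<bar>" using i by (simp add: k_def)
  also have "\<dots> > M"
  proof -
    have "M / \<bar>w $ i\<bar> < of_int \<lceil>M / \<bar>w $ i\<bar>\<rceil> + 1" by linarith
    then show ?thesis using i by (simp add: pos_divide_less_eq)
  qed
  finally show False using bound [of "axis i k"] by simp
qed

text \<open>With one pattern empty, the support function of the other one is locally, hence globally, linear.\<close>

lemma singleton_if_other_empty:
  fixes B :: "(int ^ 2) set"
  assumes "finite B" and max: "\<And>w. w \<noteq> 0 \<Longrightarrow> \<exists>b. unique_max B w b"
  shows "\<exists>b. B = {b}"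
proof -
  let ?w = "axis 1 1 :: real ^ 2"
  have w: "?w \<noteq> 0" by (simp add: axis_eq_0_iff)
  obtain b where b: "unique_max B ?w b" using max w by blast
  then have ne: "B \<noteq> {}" by (auto simp: unique_max_def)
  have loc: "- supp_fun B w = real_vec (- b) \<bullet> w \<and>
      (\<forall>\<^sub>F w' in nhds w. real_vec (- b) \<bullet> w' \<le> - supp_fun B w')" if "unique_max B w b" for w b
  proof -
    have *: "- supp_fun B w' = real_vec (- b) \<bullet> w'" if "unique_max B w' b" for w'
      using unique_max_supp_fun [OF assms(1) that] ip_diff [of 0 b w'] by (simp add: ip_def)
    show ?thesis
      using * [OF that] unique_max_eventually [OF assms(1) that]
      by (auto elim!: eventually_mono simp: *)
  qed
  have le: "real_vec (- b) \<bullet> w \<le> - supp_fun B w" for w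
  proof (rule local_support_global [of "\<lambda>w. - supp_fun B w" ?w])
    show "continuous_on UNIV (\<lambda>w. - supp_fun B w)"
      by (intro continuous_on_minus continuous_on_supp_fun assms(1) ne)
    show "\<exists>g. - supp_fun B v = g \<bullet> v \<and> (\<forall>\<^sub>F w' in nhds v. g \<bullet> w' \<le> - supp_fun B w')"
      if "v \<noteq> 0" for v
      using max [OF that] loc by blast
  qed (use w loc [OF b] in simp_all)
  have "x = b" if "x \<in> B" for x
  proof (rule ccontr)
    assume "x \<noteq> b"
    then obtain w where w: "ip x w \<noteq> ip b w" by (auto dest: ip_separates)
    have "ip x w' \<le> ip b w'" for w'
      using le [of w'] supp_fun_ge [OF assms(1) that, of w'] ip_diff [of 0 b w'] by (simp add: ip_def)
    moreover have "ip z (- w) = - ip z w" for z by (simp add: ip_def)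
    ultimately show False using w by (metis neg_le_iff_le order_antisym)
  qed
  moreover have "b \<in> B" using b by (simp add: unique_max_def)
  ultimately have "B = {b}" by blast
  then show ?thesis by blast
qed

section \<open>Evaluation and specialisation\<close>

definition mon :: "('v \<Rightarrow> 'b::comm_semiring_1) \<Rightarrow> ('v \<Rightarrow>\<^sub>0 nat) \<Rightarrow> 'b" where
  "mon v m = (\<Prod>a\<in>Poly_Mapping.keys m. v a ^ Poly_Mapping.lookup m a)"

lemma mon_superset:
  "finite K \<Longrightarrow> Poly_Mapping.keys m \<subseteq> K \<Longrightarrow> mon v m = (\<Prod>a\<in>K. v a ^ Poly_Mapping.lookup m a)"
  unfolding mon_def by (rule prod.mono_neutral_left) (auto simp: in_keys_iff)

lemma mon_add: "mon v (m + n) = mon v m * mon v n"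
proof -
  let ?K = "Poly_Mapping.keys m \<union> Poly_Mapping.keys n"
  have "mon v (m + n) = (\<Prod>a\<in>?K. v a ^ Poly_Mapping.lookup (m + n) a)"
    by (rule mon_superset) (auto simp: in_keys_iff lookup_add)
  also have "\<dots> = (\<Prod>a\<in>?K. v a ^ Poly_Mapping.lookup m a) * (\<Prod>a\<in>?K. v a ^ Poly_Mapping.lookup n a)"
    by (simp add: lookup_add power_add prod.distrib)
  also have "\<dots> = mon v m * mon v n"
    by (simp add: mon_superset [of ?K, symmetric])
  finally show ?thesis .
qed

lemma mon_0 [simp]: "mon v 0 = 1"
  by (simp add: mon_def)

lemma mon_single: "mon v (Poly_Mapping.single a k) = v a ^ k"
  by (subst mon_superset [of "{a}"]) auto

text \<open>Serves two coefficient embeddings: \<open>const\<close>, for which evaluation is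
  substitution of polynomials and covers \<open>translate\<close>, and \<open>rat_const\<close>, for
  values in the field of rational functions.\<close>

locale coeff_hom =
  fixes c :: "'a::comm_ring_1 \<Rightarrow> 'b::comm_ring_1"
  assumes c_0: "c 0 = 0" and c_1: "c 1 = 1"
    and c_add: "c (x + y) = c x + c y" and c_mult: "c (x * y) = c x * c y"
begin

lemma eval_superset:
  assumes "finite K" "Poly_Mapping.keys P \<subseteq> K"
  shows "mpoly_eval c v P = (\<Sum>m\<in>K. c (Poly_Mapping.lookup P m) * mon v m)"
  unfolding mpoly_eval_def mon_def [symmetric]
  by (rule sum.mono_neutral_left) (use assms in \<open>auto simp: in_keys_iff c_0\<close>)

lemma eval_0 [simp]: "mpoly_eval c v 0 = 0"
  by (simp add: mpoly_eval_def)

lemma eval_add: "mpoly_eval c v (P + Q) = mpoly_eval c v P + mpoly_eval c v Q"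
proof -
  let ?K = "Poly_Mapping.keys P \<union> Poly_Mapping.keys Q"
  have "Poly_Mapping.keys (P + Q) \<subseteq> ?K" by (rule Poly_Mapping.keys_add)
  then show ?thesis
    by (simp add: eval_superset [of ?K] lookup_add c_add distrib_right sum.distrib)
qed

lemma eval_sum: "mpoly_eval c v (\<Sum>i\<in>I. f i) = (\<Sum>i\<in>I. mpoly_eval c v (f i))"
  by (induction I rule: infinite_finite_induct) (simp_all add: eval_add)

lemma eval_uminus: "mpoly_eval c v (- P) = - mpoly_eval c v P"
  using eval_add [of v P "- P"] by (simp add: add_eq_0_iff)

lemma eval_single: "mpoly_eval c v (Poly_Mapping.single m x) = c x * mon v m"
  by (subst eval_superset [of "{m}"]) auto

lemma eval_mult: "mpoly_eval c v (P * Q) = mpoly_eval c v P * mpoly_eval c v Q"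
proof -
  have "P * Q = (\<Sum>m\<in>Poly_Mapping.keys P. \<Sum>n\<in>Poly_Mapping.keys Q.
      Poly_Mapping.single (m + n) (Poly_Mapping.lookup P m * Poly_Mapping.lookup Q n))"
    by (subst mpoly_as_sum [of P], subst mpoly_as_sum [of Q])
       (simp add: sum_product mult_single)
  then have "mpoly_eval c v (P * Q) = (\<Sum>m\<in>Poly_Mapping.keys P. \<Sum>n\<in>Poly_Mapping.keys Q.
      (c (Poly_Mapping.lookup P m) * mon v m) * (c (Poly_Mapping.lookup Q n) * mon v n))"
    by (simp add: eval_sum eval_single mon_add c_mult ac_simps)
  then show ?thesis by (simp add: mpoly_eval_def mon_def sum_product)
qed

lemma eval_const: "mpoly_eval c v (const x) = c x"
  by (simp add: const_def eval_single)

lemma eval_indet: "mpoly_eval c v (indet a) = v a"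
  by (simp add: indet_def eval_single mon_single c_1)

lemma eval_1 [simp]: "mpoly_eval c v 1 = 1"
  using eval_const [of v 1] by (simp add: const_def c_1 single_one)

lemma eval_power: "mpoly_eval c v (P ^ n) = mpoly_eval c v P ^ n"
  by (induction n) (simp_all add: eval_mult)

lemma eval_prod: "mpoly_eval c v (\<Prod>i\<in>I. f i) = (\<Prod>i\<in>I. mpoly_eval c v (f i))"
  by (induction I rule: infinite_finite_induct) (simp_all add: eval_mult)

lemma eval_cong:
  assumes "\<And>a. a \<in> pattern P \<Longrightarrow> v a = w a"
  shows "mpoly_eval c v P = mpoly_eval c w P"
proof -
  have "v a = w a" if "m \<in> Poly_Mapping.keys P" "a \<in> Poly_Mapping.keys m" for m a
    using assms that by (auto simp: pattern_def)
  then show ?thesis unfolding mpoly_eval_def by (simp cong: sum.cong prod.cong)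
qed

end

interpretation const: coeff_hom "const :: 'a::comm_ring_1 \<Rightarrow> ('v, 'a) mpoly"
  by unfold_locales (auto simp: const_def single_add mult_single single_one)

interpretation rat: coeff_hom "rat_const :: 'a::field \<Rightarrow> 'a ratfun"
  by unfold_locales
    (auto simp: rat_const_def const.c_0 const.c_1 const.c_add const.c_mult Zero_fract_def One_fract_def)

lemma (in coeff_hom) eval_translate:
  "mpoly_eval c u (translate t P) = mpoly_eval c (\<lambda>b. u (b + t)) P"
  unfolding translate_def
  by (simp add: mpoly_eval_def [of const] eval_sum eval_mult eval_prod eval_power eval_const eval_indet)
     (simp add: mpoly_eval_def)

lemma translate_add: "translate t (P + Q) = translate t P + translate t Q"
  and translate_mult: "translate t (P * Q) = translate t P * translate t Q"
  and translate_indet: "translate t (indet a) = indet (a + t)"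
  by (simp_all add: translate_def const.eval_add const.eval_mult const.eval_indet)

section \<open>Numerators and denominators, their patterns and translates\<close>

lemma num_denom_lookup:
  fixes P :: "('v, 'a::comm_ring_1) mpoly"
  assumes "a \<notin> pattern N" "a \<notin> pattern D" "P = N + indet a * D"
  shows "Poly_Mapping.lookup N m = (if Poly_Mapping.lookup m a = 0 then Poly_Mapping.lookup P m else 0)"
    and "Poly_Mapping.lookup D m =
      (if Poly_Mapping.lookup m a = 0 then Poly_Mapping.lookup P (Poly_Mapping.single a 1 + m) else 0)"
proof -
  have N0: "Poly_Mapping.lookup N m = 0" if "Poly_Mapping.lookup m a \<noteq> 0" for m
    using assms(1) that unfolding pattern_iff by blast
  have D0: "Poly_Mapping.lookup D m = 0" if "Poly_Mapping.lookup m a \<noteq> 0" for m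
    using assms(2) that unfolding pattern_iff by blast
  have P: "Poly_Mapping.lookup P m = Poly_Mapping.lookup N m +
      (if Poly_Mapping.lookup m a = 0 then 0 else Poly_Mapping.lookup D (m - Poly_Mapping.single a 1))" for m
    unfolding assms(3) lookup_add lookup_indet_times by (rule refl)
  show "Poly_Mapping.lookup N m = (if Poly_Mapping.lookup m a = 0 then Poly_Mapping.lookup P m else 0)"
    by (simp add: P N0)
  show "Poly_Mapping.lookup D m =
      (if Poly_Mapping.lookup m a = 0 then Poly_Mapping.lookup P (Poly_Mapping.single a 1 + m) else 0)"
    by (simp add: P N0 D0 lookup_add)
qed

lemma num_denom_eqI:
  fixes P :: "('v, 'a::comm_ring_1) mpoly"
  assumes "a \<notin> pattern N" "a \<notin> pattern D" "P = N + indet a * D"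
  shows "numerator P a = N" "denominator P a = D"
proof -
  have "num_denom P a = (N, D)"
    unfolding num_denom_def
  proof (rule the_equality)
    show "case (N, D) of (N, D) \<Rightarrow> a \<notin> pattern N \<and> a \<notin> pattern D \<and> P = N + indet a * D"
      using assms by simp
    fix ND assume "case ND of (N, D) \<Rightarrow> a \<notin> pattern N \<and> a \<notin> pattern D \<and> P = N + indet a * D"
    then obtain N' D' where ND: "ND = (N', D')" "a \<notin> pattern N'" "a \<notin> pattern D'" "P = N' + indet a * D'"
      by (cases ND) auto
    then have "N' = N" "D' = D"
      by (auto intro!: poly_mapping_eqI simp: num_denom_lookup [OF ND(2-4)] num_denom_lookup [OF assms])
    then show "ND = (N, D)" using ND(1) by simp
  qed
  then show "numerator P a = N" "denominator P a = D"
    by (simp_all add: numerator_def denominator_def)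
qed

lemma num_denom_props:
  fixes P :: "('v, 'a::comm_ring_1) mpoly"
  assumes "a \<in> pattern P" "degree_in P a = 1"
  shows "a \<notin> pattern (numerator P a)" "a \<notin> pattern (denominator P a)"
    and "P = numerator P a + indet a * denominator P a"
    and "pattern (numerator P a) \<subseteq> pattern P" "pattern (denominator P a) \<subseteq> pattern P"
proof -
  obtain N D where ND: "a \<notin> pattern N" "a \<notin> pattern D" "P = N + indet a * D"
    using num_denom_ex1 [OF assms] by auto
  have eq: "numerator P a = N" "denominator P a = D" using num_denom_eqI [OF ND] by auto
  show "a \<notin> pattern (numerator P a)" "a \<notin> pattern (denominator P a)"
    "P = numerator P a + indet a * denominator P a"
    unfolding eq by (rule ND)+
  show "pattern (numerator P a) \<subseteq> pattern P"
    unfolding eq by (auto simp: pattern_iff num_denom_lookup(1) [OF ND] split: if_splits)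
  show "pattern (denominator P a) \<subseteq> pattern P"
  proof
    fix b assume "b \<in> pattern (denominator P a)"
    then obtain m where "Poly_Mapping.lookup D m \<noteq> 0" "Poly_Mapping.lookup m b \<noteq> 0"
      by (auto simp: pattern_iff eq)
    then have "Poly_Mapping.lookup P (Poly_Mapping.single a 1 + m) \<noteq> 0"
      "Poly_Mapping.lookup (Poly_Mapping.single a 1 + m) b \<noteq> 0"
      by (auto simp: num_denom_lookup(2) [OF ND] lookup_add split: if_splits)
    then show "b \<in> pattern P" by (auto simp: pattern_iff)
  qed
qed

lemma num_denom_translate:
  fixes P :: "(int ^ 'd, 'a::comm_ring_1) mpoly"
  assumes "a \<in> pattern P" "degree_in P a = 1"
  shows "numerator (translate t P) (a + t) = translate t (numerator P a)"
    and "denominator (translate t P) (a + t) = translate t (denominator P a)"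
proof -
  note * = num_denom_props [OF assms]
  have 1: "a + t \<notin> pattern (translate t (numerator P a))" and 2: "a + t \<notin> pattern (translate t (denominator P a))"
    using *(1,2) by (auto simp: pattern_translate)
  have 3: "translate t P = translate t (numerator P a) + indet (a + t) * translate t (denominator P a)"
    by (subst *(3)) (simp add: translate_add translate_mult translate_indet)
  show "numerator (translate t P) (a + t) = translate t (numerator P a)"
    "denominator (translate t P) (a + t) = translate t (denominator P a)"
    by (rule num_denom_eqI [OF 1 2 3])+
qed

lemma pattern_add: "pattern (p + q) \<subseteq> pattern p \<union> pattern q"
  using Poly_Mapping.keys_add [of p q] by (auto simp: pattern_def)

lemma pattern_mult:
  fixes p q :: "('v, 'a::comm_ring_1) mpoly"
  shows "pattern (p * q) \<subseteq> pattern p \<union> pattern q"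
proof
  fix a assume "a \<in> pattern (p * q)"
  then obtain m where m: "m \<in> Poly_Mapping.keys (p * q)" "a \<in> Poly_Mapping.keys m"
    by (auto simp: pattern_def)
  then obtain k l where kl: "k \<in> Poly_Mapping.keys p" "l \<in> Poly_Mapping.keys q" "m = k + l"
    using Poly_Mapping.keys_mult [of p q] by blast
  then have "a \<in> Poly_Mapping.keys k \<or> a \<in> Poly_Mapping.keys l"
    using m(2) by (auto simp: in_keys_iff lookup_add)
  then show "a \<in> pattern p \<union> pattern q" using kl by (auto simp: pattern_def)
qed

lemma pattern_uminus: "pattern (- p :: ('v, 'a::comm_ring_1) mpoly) = pattern p"
  by (simp add: pattern_def)

lemma pattern_const: "pattern (const c :: ('v, 'a::comm_ring_1) mpoly) = {}"
  by (auto simp: pattern_def const_def)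

lemma pattern_indet: "pattern (indet a :: ('v, 'a::comm_ring_1) mpoly) \<subseteq> {a}"
  by (auto simp: pattern_def indet_def split: if_splits)

lemma pattern_one: "pattern (1 :: ('v, 'a::comm_ring_1) mpoly) = {}"
  using pattern_const [of 1] by (simp add: const_def single_one)

text \<open>Evaluating at the indeterminates themselves is the embedding into the fraction field. A
  relation between the \<open>rat_indet i\<close> is therefore the zero polynomial.\<close>

lemma eval_rat_indet: "mpoly_eval rat_const rat_indet P = Fract P 1"
proof -
  have sum: "(\<Sum>i\<in>I. Fract (f i) 1) = Fract (\<Sum>i\<in>I. f i) 1" for I and f :: "'i \<Rightarrow> (nat, 'a) mpoly"
    by (induction I rule: infinite_finite_induct) (simp_all add: Zero_fract_def)
  have pow: "Fract p 1 ^ n = Fract (p ^ n) 1" for p :: "(nat, 'a) mpoly" and n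
    by (induction n) (simp_all add: One_fract_def)
  have prod: "(\<Prod>i\<in>I. Fract (f i) 1) = Fract (\<Prod>i\<in>I. f i) 1" for I and f :: "'i \<Rightarrow> (nat, 'a) mpoly"
    by (induction I rule: infinite_finite_induct) (simp_all add: One_fract_def)
  have "mon rat_indet m = Fract (Poly_Mapping.single m 1 :: (nat, 'a) mpoly) 1" for m
  proof -
    have "m = (\<Sum>a\<in>Poly_Mapping.keys m. Poly_Mapping.single a (Poly_Mapping.lookup m a))"
      by (rule mpoly_as_sum)
    then have "(Poly_Mapping.single m 1 :: (nat, 'a) mpoly) = (\<Prod>a\<in>Poly_Mapping.keys m. indet a ^ Poly_Mapping.lookup m a)"
      by (simp add: indet_power prod_single)
    then show ?thesis by (simp add: mon_def rat_indet_def pow prod)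
  qed
  then have "mpoly_eval rat_const rat_indet P =
      (\<Sum>m\<in>Poly_Mapping.keys P. Fract (Poly_Mapping.single m (Poly_Mapping.lookup P m)) 1)"
    by (simp add: mpoly_eval_def rat_const_def const_def mult_single flip: mon_def)
  then show ?thesis by (simp add: sum flip: mpoly_as_sum)
qed

text \<open>\<open>x\<close> is defined at the point \<open>\<sigma>\<close> with value \<open>y\<close>, witnessed by a quotient of polynomials in the
  indeterminates from \<open>V\<close>.\<close>

definition specialises :: "nat set \<Rightarrow> (nat \<Rightarrow> 'a ratfun) \<Rightarrow> 'a::field ratfun \<Rightarrow> 'a ratfun \<Rightarrow> bool" where
  "specialises V \<sigma> x y \<longleftrightarrow> (\<exists>p q. pattern p \<subseteq> V \<and> pattern q \<subseteq> V \<and> mpoly_eval rat_const \<sigma> q \<noteq> 0 \<and>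
     x = Fract p q \<and> y = mpoly_eval rat_const \<sigma> p / mpoly_eval rat_const \<sigma> q)"

lemma specialisesE:
  assumes "specialises V \<sigma> x y"
  obtains p q where "pattern p \<subseteq> V" "pattern q \<subseteq> V" "q \<noteq> 0" "mpoly_eval rat_const \<sigma> q \<noteq> 0"
    "x = Fract p q" "y = mpoly_eval rat_const \<sigma> p / mpoly_eval rat_const \<sigma> q"
  using assms unfolding specialises_def by (metis rat.eval_0)

text \<open>Equality of two fractions is an identity between polynomials, which may be evaluated at
  \<sigma>; neither denominator vanishes there. The witnesses may use different sets of
  indeterminates.\<close>

lemma specialises_unique:
  assumes "specialises V \<sigma> x y" "specialises W \<sigma> x y'"
  shows "y = y'"
proof -
  obtain p q where 1: "q \<noteq> 0" "mpoly_eval rat_const \<sigma> q \<noteq> 0" "x = Fract p q"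
    "y = mpoly_eval rat_const \<sigma> p / mpoly_eval rat_const \<sigma> q" using specialisesE [OF assms(1)] by metis
  obtain p' q' where 2: "q' \<noteq> 0" "mpoly_eval rat_const \<sigma> q' \<noteq> 0" "x = Fract p' q'"
    "y' = mpoly_eval rat_const \<sigma> p' / mpoly_eval rat_const \<sigma> q'" using specialisesE [OF assms(2)] by metis
  have "p * q' = p' * q" using 1 2 by (simp add: eq_fract)
  then have "mpoly_eval rat_const \<sigma> p * mpoly_eval rat_const \<sigma> q' =
      mpoly_eval rat_const \<sigma> p' * mpoly_eval rat_const \<sigma> q"
    by (simp flip: rat.eval_mult)
  then show ?thesis using 1 2 by (simp add: frac_eq_eq)
qed

lemma specialises_const: "specialises V \<sigma> (rat_const c) (rat_const c)"
  unfolding specialises_def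
  by (intro exI [of _ "const c"] exI [of _ 1]) (simp add: pattern_const pattern_one rat_const_def rat.eval_const)

lemma specialises_indet: "k \<in> V \<Longrightarrow> specialises V \<sigma> (rat_indet k) (\<sigma> k)"
  unfolding specialises_def
  by (intro exI [of _ "indet k"] exI [of _ 1])
     (use pattern_indet [of k] in \<open>auto simp: pattern_one rat_indet_def rat.eval_indet\<close>)

lemma specialises_add:
  assumes "specialises V \<sigma> x y" "specialises V \<sigma> x' y'"
  shows "specialises V \<sigma> (x + x') (y + y')"
proof -
  obtain p q where 1: "pattern p \<subseteq> V" "pattern q \<subseteq> V" "q \<noteq> 0" "mpoly_eval rat_const \<sigma> q \<noteq> 0" "x = Fract p q"
    "y = mpoly_eval rat_const \<sigma> p / mpoly_eval rat_const \<sigma> q" using specialisesE [OF assms(1)] .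
  obtain p' q' where 2: "pattern p' \<subseteq> V" "pattern q' \<subseteq> V" "q' \<noteq> 0" "mpoly_eval rat_const \<sigma> q' \<noteq> 0" "x' = Fract p' q'"
    "y' = mpoly_eval rat_const \<sigma> p' / mpoly_eval rat_const \<sigma> q'" using specialisesE [OF assms(2)] .
  have "pattern (p * q' + p' * q) \<subseteq> V" "pattern (q * q') \<subseteq> V"
    using 1(1,2) 2(1,2) pattern_add [of "p * q'" "p' * q"] pattern_mult [of p q'] pattern_mult [of p' q]
      pattern_mult [of q q'] by blast+
  then show ?thesis
    unfolding specialises_def using 1 2
    by (intro exI [of _ "p * q' + p' * q"] exI [of _ "q * q'"])
       (simp add: rat.eval_add rat.eval_mult add_frac_eq)
qed

lemma specialises_mult:
  assumes "specialises V \<sigma> x y" "specialises V \<sigma> x' y'"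
  shows "specialises V \<sigma> (x * x') (y * y')"
proof -
  obtain p q where 1: "pattern p \<subseteq> V" "pattern q \<subseteq> V" "q \<noteq> 0" "mpoly_eval rat_const \<sigma> q \<noteq> 0" "x = Fract p q"
    "y = mpoly_eval rat_const \<sigma> p / mpoly_eval rat_const \<sigma> q" using specialisesE [OF assms(1)] .
  obtain p' q' where 2: "pattern p' \<subseteq> V" "pattern q' \<subseteq> V" "q' \<noteq> 0" "mpoly_eval rat_const \<sigma> q' \<noteq> 0" "x' = Fract p' q'"
    "y' = mpoly_eval rat_const \<sigma> p' / mpoly_eval rat_const \<sigma> q'" using specialisesE [OF assms(2)] .
  have "pattern (p * p') \<subseteq> V" "pattern (q * q') \<subseteq> V"
    using 1(1,2) 2(1,2) pattern_mult [of p p'] pattern_mult [of q q'] by blast+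
  then show ?thesis
    unfolding specialises_def using 1 2
    by (intro exI [of _ "p * p'"] exI [of _ "q * q'"]) (simp add: rat.eval_mult)
qed

lemma specialises_uminus:
  assumes "specialises V \<sigma> x y"
  shows "specialises V \<sigma> (- x) (- y)"
proof -
  obtain p q where "pattern p \<subseteq> V" "pattern q \<subseteq> V" "q \<noteq> 0" "mpoly_eval rat_const \<sigma> q \<noteq> 0" "x = Fract p q"
    "y = mpoly_eval rat_const \<sigma> p / mpoly_eval rat_const \<sigma> q" using specialisesE [OF assms] .
  then show ?thesis
    unfolding specialises_def
    by (intro exI [of _ "- p"] exI [of _ q]) (simp add: pattern_uminus rat.eval_uminus)
qed

lemma specialises_inverse:
  assumes "specialises V \<sigma> x y" "y \<noteq> 0"
  shows "specialises V \<sigma> (inverse x) (inverse y)"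
proof -
  obtain p q where "pattern p \<subseteq> V" "pattern q \<subseteq> V" "q \<noteq> 0" "mpoly_eval rat_const \<sigma> q \<noteq> 0" "x = Fract p q"
    "y = mpoly_eval rat_const \<sigma> p / mpoly_eval rat_const \<sigma> q" using specialisesE [OF assms(1)] .
  then show ?thesis
    unfolding specialises_def using assms(2)
    by (intro exI [of _ q] exI [of _ p]) (auto simp: divide_inverse)
qed

lemma specialises_divide:
  "specialises V \<sigma> x y \<Longrightarrow> specialises V \<sigma> x' y' \<Longrightarrow> y' \<noteq> 0 \<Longrightarrow> specialises V \<sigma> (x / x') (y / y')"
  unfolding divide_inverse by (intro specialises_mult specialises_inverse)

lemma specialises_eval:
  assumes "\<And>a. a \<in> pattern N \<Longrightarrow> specialises V \<sigma> (u a) (u' a)"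
  shows "specialises V \<sigma> (mpoly_eval rat_const u N) (mpoly_eval rat_const u' N)"
proof -
  have 1: "specialises V \<sigma> 1 1" using specialises_const [of V \<sigma> 1] by (simp add: rat.c_1)
  have pow: "specialises V \<sigma> (x ^ n) (y ^ n)" if "specialises V \<sigma> x y" for x y n
    by (induction n) (simp_all add: 1 that specialises_mult)
  have prod: "specialises V \<sigma> (\<Prod>i\<in>I. f i) (\<Prod>i\<in>I. g i)"
    if "\<And>i. i \<in> I \<Longrightarrow> specialises V \<sigma> (f i) (g i)" for I and f g :: "'c \<Rightarrow> 'b ratfun"
    using that by (induction I rule: infinite_finite_induct) (simp_all add: 1 specialises_mult)
  have sum: "specialises V \<sigma> (\<Sum>i\<in>I. f i) (\<Sum>i\<in>I. g i)"
    if "\<And>i. i \<in> I \<Longrightarrow> specialises V \<sigma> (f i) (g i)" for I and f g :: "('c \<Rightarrow>\<^sub>0 nat) \<Rightarrow> 'b ratfun"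
    using that specialises_const [of V \<sigma> 0]
    by (induction I rule: infinite_finite_induct) (simp_all add: rat.c_0 specialises_add)
  show ?thesis
    unfolding mpoly_eval_def
    by (intro sum specialises_mult specialises_const prod pow assms) (auto simp: pattern_def)
qed

section \<open>Algebraic independence\<close>

text \<open>Gaussian elimination on the coordinates: more vectors than coordinates are linearly
  dependent. A vector j with nonzero entry at e clears this coordinate from the others.\<close>

lemma nontrivial_relation:
  fixes f :: "'i \<Rightarrow> 'e \<Rightarrow> 'a::field"
  assumes "finite E" "finite I" "card E < card I"
  shows "\<exists>c. (\<exists>i\<in>I. c i \<noteq> 0) \<and> (\<forall>e\<in>E. (\<Sum>i\<in>I. c i * f i e) = 0)"
  using assms
proof (induction E arbitrary: I f rule: finite_induct)
  case empty
  then obtain i where "i \<in> I" by (metis card.empty less_irrefl ex_in_conv)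
  then show ?case by (intro exI [of _ "\<lambda>_. 1"]) auto
next
  case (insert e E)
  show ?case
  proof (cases "\<exists>j\<in>I. f j e \<noteq> 0")
    case False
    obtain c where "\<exists>i\<in>I. c i \<noteq> 0" "\<forall>e\<in>E. (\<Sum>i\<in>I. c i * f i e) = 0"
      using insert.IH [of I f] insert.hyps insert.prems by auto
    then show ?thesis using False by (intro exI [of _ c]) (auto intro!: sum.neutral)
  next
    case True
    then obtain j where j: "j \<in> I" "f j e \<noteq> 0" by blast
    let ?I = "I - {j}"
    define g where "g i e' = f i e' - f i e / f j e * f j e'" for i e'
    have "card E < card ?I" using insert.prems insert.hyps j by (simp add: card_Diff_singleton)
    then obtain c where c: "\<exists>i\<in>?I. c i \<noteq> 0" "\<forall>e\<in>E. (\<Sum>i\<in>?I. c i * g i e) = 0"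
      using insert.IH [of ?I g] insert.prems by auto
    \<comment> \<open>The coefficient of the pivot vector j collects the multiples of it that were
      subtracted in g.\<close>
    define k where "k = (\<Sum>i\<in>?I. c i * (f i e / f j e))"
    define d where "d = c(j := - k)"
    have sum: "(\<Sum>i\<in>I. d i * f i e') = (\<Sum>i\<in>?I. c i * g i e')" for e'
    proof -
      have "(\<Sum>i\<in>I. d i * f i e') = d j * f j e' + (\<Sum>i\<in>?I. d i * f i e')"
        using insert.prems j by (simp add: sum.remove)
      also have "(\<Sum>i\<in>?I. d i * f i e') = (\<Sum>i\<in>?I. c i * f i e')"
        by (intro sum.cong) (auto simp: d_def)
      also have "d j * f j e' = - (\<Sum>i\<in>?I. c i * (f i e / f j e * f j e'))"
        by (simp add: d_def k_def sum_distrib_right mult.assoc)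
      finally show ?thesis by (simp add: g_def right_diff_distrib sum_subtractf)
    qed
    have "(\<Sum>i\<in>I. d i * f i e') = 0" if "e' \<in> insert e E" for e'
    proof (cases "e' = e")
      case True
      then show ?thesis using j(2) by (simp add: sum g_def)
    next
      case False
      then show ?thesis using c(2) that by (simp add: sum)
    qed
    moreover have "\<exists>i\<in>I. d i \<noteq> 0" using c(1) by (auto simp: d_def)
    ultimately show ?thesis by blast
  qed
qed

definition exponent_box :: "'v set \<Rightarrow> nat \<Rightarrow> ('v \<Rightarrow>\<^sub>0 nat) set" where
  "exponent_box J M = {m. Poly_Mapping.keys m \<subseteq> J \<and> (\<forall>a. a \<in> J \<longrightarrow> Poly_Mapping.lookup m a < M)}"

lemma card_exponent_box:
  assumes "finite J"
  shows "finite (exponent_box J M)" "card (exponent_box J M) = M ^ card J"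
proof -
  let ?g = "\<lambda>f. Abs_poly_mapping (\<lambda>a. if a \<in> J then f a else 0 :: nat)"
  have look: "Poly_Mapping.lookup (?g f) = (\<lambda>a. if a \<in> J then f a else 0)" for f
    by (rule Abs_poly_mapping_inverse) (use assms in \<open>simp add: finite_subset [OF _ assms]\<close>)
  have bij: "bij_betw ?g (PiE J (\<lambda>_. {..<M})) (exponent_box J M)"
  proof (rule bij_betw_byWitness [where f' = "\<lambda>m. restrict (Poly_Mapping.lookup m) J"])
    show "\<forall>f\<in>PiE J (\<lambda>_. {..<M}). restrict (Poly_Mapping.lookup (?g f)) J = f"
      unfolding look by (auto simp: restrict_def PiE_def extensional_def fun_eq_iff)
    show "\<forall>m\<in>exponent_box J M. ?g (restrict (Poly_Mapping.lookup m) J) = m"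
      by (auto intro!: poly_mapping_eqI simp: look exponent_box_def in_keys_iff)
    show "?g ` PiE J (\<lambda>_. {..<M}) \<subseteq> exponent_box J M"
      by (auto simp: exponent_box_def look in_keys_iff split: if_splits)
    show "(\<lambda>m. restrict (Poly_Mapping.lookup m) J) ` exponent_box J M \<subseteq> PiE J (\<lambda>_. {..<M})"
      by (auto simp: exponent_box_def)
  qed
  have "finite (PiE J (\<lambda>_. {..<M}))" using assms by (intro finite_PiE) auto
  moreover have "card (PiE J (\<lambda>_. {..<M})) = M ^ card J" using assms by (simp add: card_PiE)
  ultimately show "finite (exponent_box J M)" "card (exponent_box J M) = M ^ card J"
    using bij_betw_finite [OF bij] bij_betw_same_card [OF bij] by simp_all
qed

text \<open>The bound holds in each indeterminate separately, to match \<open>exponent_box\<close>,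
  whose size is a plain power.\<close>

definition degrees_le :: "('v, 'a::comm_ring_1) mpoly \<Rightarrow> nat \<Rightarrow> bool" where
  "degrees_le p d \<longleftrightarrow> (\<forall>m\<in>Poly_Mapping.keys p. \<forall>a. Poly_Mapping.lookup m a \<le> d)"

lemma degrees_le_mono: "degrees_le p d \<Longrightarrow> d \<le> e \<Longrightarrow> degrees_le p e"
  unfolding degrees_le_def by (meson le_trans)

lemma degrees_le_exists: "\<exists>d. degrees_le p d"
proof -
  let ?S = "\<Union>m\<in>Poly_Mapping.keys p. Poly_Mapping.lookup m ` Poly_Mapping.keys m"
  have "finite ?S" by simp
  then obtain d where d: "\<forall>x\<in>?S. x \<le> d"
    unfolding finite_nat_set_iff_bounded_le by (elim exE) (rule that)
  have "Poly_Mapping.lookup m a \<le> d" if "m \<in> Poly_Mapping.keys p" for m a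
    by (cases "a \<in> Poly_Mapping.keys m") (use d that in \<open>auto simp: in_keys_iff\<close>)
  then show ?thesis unfolding degrees_le_def by blast
qed

lemma degrees_le_mult:
  assumes "degrees_le p d" "degrees_le q e"
  shows "degrees_le (p * q) (d + e)"
  unfolding degrees_le_def
proof (intro ballI allI)
  fix m a assume "m \<in> Poly_Mapping.keys (p * q)"
  then obtain k l where "k \<in> Poly_Mapping.keys p" "l \<in> Poly_Mapping.keys q" "m = k + l"
    using Poly_Mapping.keys_mult [of p q] by blast
  then show "Poly_Mapping.lookup m a \<le> d + e"
    using assms by (simp add: degrees_le_def lookup_add add_mono)
qed

lemma degrees_le_1: "degrees_le 1 0"
  by (simp add: degrees_le_def)

lemma degrees_le_power: "degrees_le p d \<Longrightarrow> degrees_le (p ^ n) (n * d)"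
  by (induction n) (simp_all add: degrees_le_1 degrees_le_mult)

lemma degrees_le_prod:
  "(\<And>i. i \<in> I \<Longrightarrow> degrees_le (f i) d) \<Longrightarrow> degrees_le (\<Prod>i\<in>I. f i) (card I * d)"
  by (induction I rule: infinite_finite_induct) (simp_all add: degrees_le_1 degrees_le_mult)

lemma pattern_power: "pattern (p ^ n :: ('v, 'a::comm_ring_1) mpoly) \<subseteq> pattern p"
proof (induction n)
  case (Suc n)
  then show ?case using pattern_mult [of p "p ^ n"] by auto
qed (simp add: pattern_one)

lemma pattern_prod:
  "(\<And>i. i \<in> I \<Longrightarrow> pattern (f i :: ('v, 'a::comm_ring_1) mpoly) \<subseteq> V) \<Longrightarrow> pattern (\<Prod>i\<in>I. f i) \<subseteq> V"
proof (induction I rule: infinite_finite_induct)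
  case (insert i I)
  then show ?case using pattern_mult [of "f i" "prod f I"] by auto
qed (simp_all add: pattern_one)

text \<open>With x = M it bounds what remains of the M ^ m monomials after those used to multiply a
  relation P of degree at most d: the remainder has only order M ^ (m - 1).\<close>

lemma power_diff_bound:
  fixes x d :: nat
  assumes "d \<le> x"
  shows "x ^ m \<le> (x - d) ^ m + m * d * x ^ (m - 1)"
proof (induction m)
  case (Suc m)
  have "x ^ Suc m \<le> x * (x - d) ^ m + x * (m * d * x ^ (m - 1))"
    using mult_le_mono2 [OF Suc, of x] by (simp add: distrib_left)
  also have "x * (x - d) ^ m = (x - d) ^ Suc m + d * (x - d) ^ m"
    using assms by (simp flip: distrib_right)
  also have "d * (x - d) ^ m \<le> d * x ^ m" by (simp add: power_mono)
  also have "x * (m * d * x ^ (m - 1)) = m * d * x ^ m" by (cases m) simp_all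
  finally show ?case by (simp add: algebra_simps)
qed simp

text \<open>Counting dimensions: were the \<open>\<sigma> k\<close> (\<open>k \<in> J\<close>) related by \<open>P\<close>, the polynomials in them of degree less than
  \<open>M\<close> in each of them would span a space of dimension \<open>O(M ^ (card J - 1))\<close>, which cannot contain,
  up to a common denominator, the \<open>N ^ n\<close> monomials of degrees less than \<open>N\<close> in \<open>n\<close> indeterminates.\<close>

lemma algebraically_independent:
  fixes \<sigma> :: "nat \<Rightarrow> 'a::field ratfun"
  assumes J: "finite J" "card J \<le> n"
    and gen: "\<And>i. i \<in> {1..n} \<Longrightarrow> specialises J \<sigma> (r i) (rat_indet i)"
    and P: "pattern P \<subseteq> J" "mpoly_eval rat_const \<sigma> P = 0"
  shows "P = 0"
proof (rule ccontr)
  assume "P \<noteq> 0"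
  let ?ev = "mpoly_eval rat_const \<sigma>"
  have "\<exists>p q. pattern p \<subseteq> J \<and> pattern q \<subseteq> J \<and> ?ev q \<noteq> 0 \<and> ?ev p = rat_indet i * ?ev q" if "i \<in> {1..n}" for i
    using specialisesE [OF gen [OF that]] by (metis nonzero_eq_divide_eq)
  then obtain p q where pq: "\<And>i. i \<in> {1..n} \<Longrightarrow> pattern (p i) \<subseteq> J \<and> pattern (q i) \<subseteq> J \<and>
      ?ev (q i) \<noteq> 0 \<and> ?ev (p i) = rat_indet i * ?ev (q i)"
    by metis
  obtain d0 where d0: "degrees_le P d0" using degrees_le_exists by blast
  have "\<exists>d. degrees_le (p i) d \<and> degrees_le (q i) d" for i
    using degrees_le_exists [of "p i"] degrees_le_exists [of "q i"] degrees_le_mono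
    by (metis le_add1 le_add2)
  then obtain di where di: "\<And>i. degrees_le (p i) (di i) \<and> degrees_le (q i) (di i)" by metis
  define d where "d = (\<Sum>i\<in>{1..n}. di i)"
  have "di i \<le> d" if "i \<in> {1..n}" for i unfolding d_def by (rule member_le_sum) (use that in auto)
  then have d: "degrees_le (p i) d" "degrees_le (q i) d" if "i \<in> {1..n}" for i
    using di degrees_le_mono that by blast+
  define m where "m = card J"
  \<comment> \<open>K makes M = N * K exceed the degrees n * N * d of the products
    \<open>Q e\<close> and also d0. N is chosen so that m * d0 * M ^ (m - 1) < N * N ^ (m - 1),
    which is at most N ^ n when m is positive.\<close>
  define K where "K = n * d + d0 + 1"
  define N where "N = m * d0 * K ^ (m - 1) + 1"
  define M where "M = N * K"
  \<comment> \<open>Powers of q i pad each monomial to the common denominator W, so that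
    \<open>Q e\<close> evaluates to W times the monomial e.\<close>
  define Q where "Q e = (\<Prod>i\<in>{1..n}. p i ^ Poly_Mapping.lookup e i * q i ^ (N - Poly_Mapping.lookup e i))"
    for e :: "nat \<Rightarrow>\<^sub>0 nat"
  define W where "W = (\<Prod>i\<in>{1..n}. ?ev (q i) ^ N)"
  \<comment> \<open>The padded monomials together with the monomial multiples of P. All their
    exponents are below M, and they outnumber the exponents available, so they are linearly
    dependent.\<close>
  define G where "G = (\<lambda>x. case x of Inl e \<Rightarrow> Q e | Inr f \<Rightarrow> P * Poly_Mapping.single f 1)"
  let ?E = "exponent_box {1..n} N" and ?F = "exponent_box J (M - d0)"
  have M: "d0 \<le> M" "N * (n * d) < M" by (simp_all add: M_def K_def N_def algebra_simps)
  have W: "W \<noteq> 0" using pq by (simp add: W_def)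
  have evQ: "?ev (Q e) = W * mon rat_indet e" if "e \<in> ?E" for e
  proof -
    have *: "?ev (p i ^ Poly_Mapping.lookup e i * q i ^ (N - Poly_Mapping.lookup e i)) =
        ?ev (q i) ^ N * rat_indet i ^ Poly_Mapping.lookup e i" if i: "i \<in> {1..n}" for i
    proof -
      have "Poly_Mapping.lookup e i \<le> N" using \<open>e \<in> ?E\<close> i by (simp add: exponent_box_def less_imp_le)
      then have "?ev (q i) ^ N = ?ev (q i) ^ Poly_Mapping.lookup e i * ?ev (q i) ^ (N - Poly_Mapping.lookup e i)"
        by (simp flip: power_add)
      then show ?thesis using pq [OF i] by (simp add: rat.eval_mult rat.eval_power power_mult_distrib)
    qed
    have "mon rat_indet e = (\<Prod>i\<in>{1..n}. rat_indet i ^ Poly_Mapping.lookup e i :: 'a ratfun)"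
      using that by (intro mon_superset) (auto simp: exponent_box_def)
    moreover have "?ev (Q e) = (\<Prod>i\<in>{1..n}. ?ev (q i) ^ N * rat_indet i ^ Poly_Mapping.lookup e i)"
      unfolding Q_def rat.eval_prod by (rule prod.cong [OF refl *])
    ultimately show ?thesis by (simp add: W_def prod.distrib)
  qed
  have boxI: "k \<in> exponent_box J M" if "k \<in> Poly_Mapping.keys x" "pattern x \<subseteq> J" "degrees_le x D" "D < M"
    for k D and x :: "(nat, 'a) mpoly"
  proof -
    have "Poly_Mapping.lookup k a < M" for a
      using that(1,3,4) unfolding degrees_le_def by (meson le_less_trans)
    then show ?thesis using that(1,2) by (auto simp: exponent_box_def pattern_def)
  qed
  have keysQ: "Poly_Mapping.keys (Q e) \<subseteq> exponent_box J M" if "e \<in> ?E" for e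
  proof -
    have "pattern (Q e) \<subseteq> J"
      unfolding Q_def
    proof (rule pattern_prod)
      fix i assume "i \<in> {1..n}"
      then show "pattern (p i ^ Poly_Mapping.lookup e i * q i ^ (N - Poly_Mapping.lookup e i)) \<subseteq> J"
        using pq [of i] pattern_power [of "p i" "Poly_Mapping.lookup e i"]
          pattern_power [of "q i" "N - Poly_Mapping.lookup e i"]
          pattern_mult [of "p i ^ Poly_Mapping.lookup e i" "q i ^ (N - Poly_Mapping.lookup e i)"]
        by blast
    qed
    moreover have "degrees_le (Q e) (card {1..n} * (N * d))"
      unfolding Q_def
    proof (rule degrees_le_prod)
      fix i assume i: "i \<in> {1..n}"
      let ?k = "Poly_Mapping.lookup e i"
      have "?k \<le> N" using that i by (simp add: exponent_box_def less_imp_le)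
      then have "?k * d + (N - ?k) * d = N * d" by (simp flip: distrib_right)
      then show "degrees_le (p i ^ ?k * q i ^ (N - ?k)) (N * d)"
        using degrees_le_mult [OF degrees_le_power [OF d(1) [OF i], of ?k]
          degrees_le_power [OF d(2) [OF i], of "N - ?k"]] by simp
    qed
    ultimately show ?thesis using boxI M(2) by (auto simp: mult.left_commute)
  qed
  have keysP: "Poly_Mapping.keys (P * Poly_Mapping.single f 1) \<subseteq> exponent_box J M" if f: "f \<in> ?F" for f
  proof
    fix k assume "k \<in> Poly_Mapping.keys (P * Poly_Mapping.single f 1)"
    then obtain l where l: "l \<in> Poly_Mapping.keys P" "k = l + f"
      using Poly_Mapping.keys_mult [of P "Poly_Mapping.single f 1"] by (auto split: if_splits)
    have "Poly_Mapping.keys k \<subseteq> J"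
      using l P(1) f Poly_Mapping.keys_add [of l f] unfolding pattern_def exponent_box_def by blast
    moreover have "Poly_Mapping.lookup k a < M" if "a \<in> J" for a
    proof -
      have "Poly_Mapping.lookup l a \<le> d0" using d0 l(1) by (simp add: degrees_le_def)
      moreover have "Poly_Mapping.lookup f a < M - d0" using f that by (simp add: exponent_box_def)
      ultimately show ?thesis by (simp add: l(2) lookup_add)
    qed
    ultimately show "k \<in> exponent_box J M" by (simp add: exponent_box_def)
  qed
  have fin: "finite ?E" "finite ?F" "finite (exponent_box J M)" using J(1) by (simp_all add: card_exponent_box)
  have "card (exponent_box J M) < card (?E <+> ?F)"
  proof -
    have "m * d0 * M ^ (m - 1) < N ^ n"
    proof (cases "m = 0")
      case False
      have "m * d0 * M ^ (m - 1) = (m * d0 * K ^ (m - 1)) * N ^ (m - 1)"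
        by (simp add: M_def power_mult_distrib)
      also have "\<dots> < N * N ^ (m - 1)" by (rule mult_strict_right_mono) (simp_all add: N_def)
      also have "\<dots> = N ^ m" using False by (simp flip: power_Suc)
      also have "\<dots> \<le> N ^ n" using J(2) by (intro power_increasing) (simp_all add: m_def N_def)
      finally show ?thesis .
    qed (simp add: N_def)
    then have "M ^ m < N ^ n + (M - d0) ^ m" using power_diff_bound [OF M(1), of m] by linarith
    then show ?thesis using J(1) fin by (simp add: card_Plus card_exponent_box m_def)
  qed
  then obtain c where c: "\<exists>i\<in>?E <+> ?F. c i \<noteq> 0"
    "\<And>k. k \<in> exponent_box J M \<Longrightarrow> (\<Sum>i\<in>?E <+> ?F. c i * Poly_Mapping.lookup (G i) k) = 0"
    using nontrivial_relation [of "exponent_box J M" "?E <+> ?F" "\<lambda>i. Poly_Mapping.lookup (G i)"] fin by auto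
  have lconst: "Poly_Mapping.lookup (const a * x) k = a * Poly_Mapping.lookup x k"
    for a :: 'a and x :: "(nat, 'a) mpoly" and k
  proof -
    have "const a * x = (\<Sum>m\<in>Poly_Mapping.keys x. Poly_Mapping.single m (a * Poly_Mapping.lookup x m))"
      by (subst mpoly_as_sum [of x]) (simp add: const_def sum_distrib_left mult_single)
    then show ?thesis by (auto simp: lookup_sum lookup_single when_def in_keys_iff)
  qed
  have zero: "(\<Sum>i\<in>?E <+> ?F. const (c i) * G i) = 0"
  proof (rule poly_mapping_eqI)
    fix k
    have "Poly_Mapping.keys (G i) \<subseteq> exponent_box J M" if "i \<in> ?E <+> ?F" for i
      using that by (rule PlusE) (simp_all only: G_def sum.case keysQ keysP)
    then have "Poly_Mapping.lookup (G i) k = 0" if "k \<notin> exponent_box J M" "i \<in> ?E <+> ?F" for i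
      using that by (meson in_keys_iff subsetD)
    then have "(\<Sum>i\<in>?E <+> ?F. c i * Poly_Mapping.lookup (G i) k) = 0"
      using c(2) [of k] by (cases "k \<in> exponent_box J M") simp_all
    then show "Poly_Mapping.lookup (\<Sum>i\<in>?E <+> ?F. const (c i) * G i) k = Poly_Mapping.lookup 0 k"
      by (simp add: lookup_sum lconst)
  qed
  then have split: "(\<Sum>e\<in>?E. const (c (Inl e)) * Q e) + (\<Sum>f\<in>?F. const (c (Inr f)) * (P * Poly_Mapping.single f 1)) = 0"
    using fin by (simp add: sum.Plus G_def)
  \<comment> \<open>Evaluation kills the multiples of P and leaves a relation between distinct
    monomials in the indeterminates, so its coefficients vanish. The rest of the relation is a
    multiple of P, where P cancels.\<close>
  have "?ev (\<Sum>f\<in>?F. const (c (Inr f)) * (P * Poly_Mapping.single f 1)) = 0"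
    by (simp add: rat.eval_sum rat.eval_mult P(2))
  then have "?ev (\<Sum>e\<in>?E. const (c (Inl e)) * Q e) = 0"
    using rat.eval_add [of \<sigma> "\<Sum>e\<in>?E. const (c (Inl e)) * Q e"
      "\<Sum>f\<in>?F. const (c (Inr f)) * (P * Poly_Mapping.single f 1)"]
    unfolding split by simp
  then have "W * (\<Sum>e\<in>?E. rat_const (c (Inl e)) * mon rat_indet e) = 0"
    by (simp add: rat.eval_sum rat.eval_mult rat.eval_const evQ sum_distrib_left mult.left_commute)
  then have "mpoly_eval rat_const rat_indet (\<Sum>e\<in>?E. Poly_Mapping.single e (c (Inl e))) = 0"
    using W by (simp add: rat.eval_sum rat.eval_single)
  then have "(\<Sum>e\<in>?E. Poly_Mapping.single e (c (Inl e))) = 0"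
    by (simp add: eval_rat_indet Zero_fract_def eq_fract)
  moreover have lsum: "Poly_Mapping.lookup (\<Sum>e\<in>X. Poly_Mapping.single e (g e)) x = g x"
    if "finite X" "x \<in> X" for X x and g :: "(nat \<Rightarrow>\<^sub>0 nat) \<Rightarrow> 'a"
    using that by (simp add: lookup_sum lookup_single when_def)
  ultimately have cE: "c (Inl e) = 0" if "e \<in> ?E" for e
    using that fin(1) lsum [of ?E e "\<lambda>e. c (Inl e)"] by simp
  then have "(\<Sum>f\<in>?F. const (c (Inr f)) * (P * Poly_Mapping.single f 1)) = 0"
    using split by (simp add: const.c_0)
  then have "P * (\<Sum>f\<in>?F. Poly_Mapping.single f (c (Inr f))) = 0"
    by (simp add: sum_distrib_left mult.left_commute const_def mult_single)
  then have "(\<Sum>f\<in>?F. Poly_Mapping.single f (c (Inr f))) = 0" using \<open>P \<noteq> 0\<close> by simp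
  then have "c (Inr f) = 0" if "f \<in> ?F" for f
    using that fin(2) lsum [of ?F f "\<lambda>f. c (Inr f)"] by simp
  then show False using c(1) cE by auto
qed

section \<open>Runs and derivations\<close>

definition num_at :: "('v, 'a::field) mpoly \<Rightarrow> 'v \<Rightarrow> ('v \<Rightarrow> 'a ratfun) \<Rightarrow> 'a ratfun" where
  "num_at P a u = mpoly_eval rat_const u (numerator P a)"

definition den_at :: "('v, 'a::field) mpoly \<Rightarrow> 'v \<Rightarrow> ('v \<Rightarrow> 'a ratfun) \<Rightarrow> 'a ratfun" where
  "den_at P a u = mpoly_eval rat_const u (denominator P a)"

text \<open>The values a point can receive in free computations that use equations inside T, without
  reference to sequences. Several values per point are possible until consistency is known. The
  assignment u is indexed by the untranslated pattern.\<close>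

inductive derivable ::
    "(int ^ 'd, 'a::field) mpoly set \<Rightarrow> (int ^ 'd) set \<Rightarrow> (int ^ 'd \<Rightarrow> nat) \<Rightarrow> (int ^ 'd) set \<Rightarrow>
     int ^ 'd \<Rightarrow> 'a ratfun \<Rightarrow> bool" for \<Gamma> S \<eta> T where
  seed: "a \<in> S \<Longrightarrow> derivable \<Gamma> S \<eta> T a (rat_indet (\<eta> a))"
| step: "P \<in> \<Gamma> \<Longrightarrow> shift t (pattern P) \<subseteq> T \<Longrightarrow> a \<in> pattern P \<Longrightarrow>
    (\<And>b. b \<in> pattern P - {a} \<Longrightarrow> derivable \<Gamma> S \<eta> T (b + t) (u b)) \<Longrightarrow> den_at P a u \<noteq> 0 \<Longrightarrow>
    derivable \<Gamma> S \<eta> T (a + t) (- num_at P a u / den_at P a u)"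

text \<open>The values of u may come from unrelated derivations. This is still a consequence of
  properness, because one run can realise all of them by repeating points.\<close>

definition derivation_proper ::
    "(int ^ 'd, 'a::field) mpoly set \<Rightarrow> (int ^ 'd) set \<Rightarrow> (int ^ 'd \<Rightarrow> nat) \<Rightarrow> (int ^ 'd) set \<Rightarrow> bool" where
  "derivation_proper \<Gamma> S \<eta> T \<longleftrightarrow> (\<forall>P\<in>\<Gamma>. \<forall>t a u. shift t (pattern P) \<subseteq> T \<longrightarrow> a \<in> pattern P \<longrightarrow>
     (\<forall>b\<in>pattern P - {a}. derivable \<Gamma> S \<eta> T (b + t) (u b)) \<longrightarrow> den_at P a u \<noteq> 0)"

definition derivation_consistent ::
    "(int ^ 'd, 'a::field) mpoly set \<Rightarrow> (int ^ 'd) set \<Rightarrow> (int ^ 'd \<Rightarrow> nat) \<Rightarrow> (int ^ 'd) set \<Rightarrow> bool" where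
  "derivation_consistent \<Gamma> S \<eta> T \<longleftrightarrow>
     (\<forall>a x y. derivable \<Gamma> S \<eta> T a x \<longrightarrow> derivable \<Gamma> S \<eta> T a y \<longrightarrow> x = y)"

text \<open>A run that has to stay in T but need not cover it, so that finite initial segments from
  the seed on qualify.\<close>

definition prerun ::
    "(int ^ 'd) set set \<Rightarrow> (int ^ 'd) set \<Rightarrow> (int ^ 'd) set \<Rightarrow>
     enat \<Rightarrow> (nat \<Rightarrow> int ^ 'd) \<Rightarrow> (nat \<Rightarrow> nat set) \<Rightarrow> bool" where
  "prerun \<A> S T n \<alpha> \<Psi> \<longleftrightarrow>
     enat (card S) \<le> n \<and> bij_betw \<alpha> {1..card S} S \<and> \<alpha> ` indices n \<subseteq> T \<and>
     (\<forall>i\<in>indices n. card S < i \<longrightarrow>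
        \<Psi> i \<subseteq> {1..i} \<and> i \<in> \<Psi> i \<and> inj_on \<alpha> (\<Psi> i) \<and> \<alpha> ` \<Psi> i \<in> copies \<A>)"

lemma indices_enat: "indices (enat m) = {1..m}"
  by (auto simp: indices_def)

lemma indices_mono: "m \<le> n \<Longrightarrow> indices m \<subseteq> indices n"
  by (auto simp: indices_def intro: order_trans)

lemma indices_down: "i \<in> indices n \<Longrightarrow> j \<in> {1..i} \<Longrightarrow> j \<in> indices n"
  by (auto simp: indices_def) (metis enat_ord_simps(1) order_trans)

lemma run_iff_prerun: "run \<A> S T n \<alpha> \<Psi> \<longleftrightarrow> prerun \<A> S T n \<alpha> \<Psi> \<and> T \<subseteq> \<alpha> ` indices n"
  unfolding run_def prerun_def by (auto 0 3)

definition step_ok ::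
    "(int ^ 'd, 'a::field) mpoly set \<Rightarrow> nat \<Rightarrow> (int ^ 'd \<Rightarrow> nat) \<Rightarrow>
     (nat \<Rightarrow> int ^ 'd) \<Rightarrow> (nat \<Rightarrow> nat set) \<Rightarrow> (nat \<Rightarrow> 'a ratfun) \<Rightarrow> nat \<Rightarrow> bool" where
  "step_ok \<Gamma> s \<eta> \<alpha> \<Psi> \<xi> i \<longleftrightarrow>
     (if i \<le> s then \<xi> i = rat_indet (\<eta> (\<alpha> i))
      else let P = copy_with_pattern \<Gamma> (\<alpha> ` \<Psi> i);
               v = step_assignment \<alpha> \<Psi> \<xi> i;
               num = mpoly_eval rat_const v (numerator P (\<alpha> i));
               den = mpoly_eval rat_const v (denominator P (\<alpha> i))
           in den \<noteq> 0 \<and> \<xi> i = - num / den)"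

lemma free_computation_iff:
  "free_computation \<Gamma> s \<eta> n \<alpha> \<Psi> \<xi> \<longleftrightarrow> (\<forall>i\<in>indices n. step_ok \<Gamma> s \<eta> \<alpha> \<Psi> \<xi> i)"
  by (simp add: free_computation_def step_ok_def)

lemma derivable_mono:
  assumes "derivable \<Gamma> S \<eta> T a x" "S \<subseteq> S'" "\<And>s. s \<in> S \<Longrightarrow> \<eta>' s = \<eta> s" "T \<subseteq> T'"
  shows "derivable \<Gamma> S' \<eta>' T' a x"
  using assms(1)
proof (induction rule: derivable.induct)
  case (seed a)
  then show ?case using derivable.seed [of a S' \<Gamma> \<eta>' T'] assms(2,3) by auto
next
  case (step P t a u)
  show ?case
    by (rule derivable.step [OF step(1) order_trans [OF step(2) assms(4)] step(3) step(6) step(5)])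
qed

lemma derivation_proper_mono:
  assumes "derivation_proper \<Gamma> S' \<eta>' T'" "S \<subseteq> S'" "\<And>s. s \<in> S \<Longrightarrow> \<eta>' s = \<eta> s" "T \<subseteq> T'"
  shows "derivation_proper \<Gamma> S \<eta> T"
  unfolding derivation_proper_def
proof (intro ballI allI impI)
  fix P t a u
  assume *: "P \<in> \<Gamma>" "shift t (pattern P) \<subseteq> T" "a \<in> pattern P"
    "\<forall>b\<in>pattern P - {a}. derivable \<Gamma> S \<eta> T (b + t) (u b)"
  have "\<forall>b\<in>pattern P - {a}. derivable \<Gamma> S' \<eta>' T' (b + t) (u b)"
    by (intro ballI derivable_mono [OF _ assms(2-4)]) (use *(4) in blast)
  then show "den_at P a u \<noteq> 0"
    using assms(1) *(1,3) order_trans [OF *(2) assms(4)] unfolding derivation_proper_def by simp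
qed

lemma derivable_finite_region:
  assumes "derivable \<Gamma> S \<eta> T a x"
  shows "\<exists>T0. finite T0 \<and> T0 \<subseteq> T \<and> derivable \<Gamma> S \<eta> T0 a x"
  using assms
proof (induction rule: derivable.induct)
  case (seed a)
  then show ?case by (intro exI [of _ "{}"]) (simp add: derivable.seed)
next
  case (step P t a u)
  then have "\<forall>b\<in>pattern P - {a}. \<exists>T0. finite T0 \<and> T0 \<subseteq> T \<and> derivable \<Gamma> S \<eta> T0 (b + t) (u b)" by blast
  then obtain R where R: "\<And>b. b \<in> pattern P - {a} \<Longrightarrow>
      finite (R b) \<and> R b \<subseteq> T \<and> derivable \<Gamma> S \<eta> (R b) (b + t) (u b)"
    by metis
  define T0 where "T0 = shift t (pattern P) \<union> (\<Union>b\<in>pattern P - {a}. R b)"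
  have fin: "finite T0" using R finite_pattern [of P] by (auto simp: T0_def)
  have sub: "T0 \<subseteq> T" using R step.hyps(2) by (auto simp: T0_def)
  have "derivable \<Gamma> S \<eta> T0 (b + t) (u b)" if b: "b \<in> pattern P - {a}" for b
  proof (rule derivable_mono)
    show "derivable \<Gamma> S \<eta> (R b) (b + t) (u b)" using R [OF b] by blast
    show "R b \<subseteq> T0" using b by (auto simp: T0_def)
  qed auto
  then have "derivable \<Gamma> S \<eta> T0 (a + t) (- num_at P a u / den_at P a u)"
    by (intro derivable.step step.hyps) (auto simp: T0_def)
  then show ?case using fin sub by blast
qed

text \<open>When a seed is enlarged, its old points keep their indeterminates and the new points get
  the next numbers.\<close>

lemma extend_bijection:
  fixes \<eta> :: "'b \<Rightarrow> nat"
  assumes "finite S'" "S \<subseteq> S'" "bij_betw \<eta> S {1..card S}"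
  obtains \<eta>' where "bij_betw \<eta>' S' {1..card S'}" "\<And>s. s \<in> S \<Longrightarrow> \<eta>' s = \<eta> s"
proof -
  have le: "card S \<le> card S'" using assms(1,2) by (rule card_mono)
  have "card (S' - S) = card {card S<..card S'}"
    using assms(1,2) by (simp add: card_Diff_subset finite_subset)
  then obtain g where g: "bij_betw g (S' - S) {card S<..card S'}"
    using finite_same_card_bij assms(1) by (metis finite_Diff finite_greaterThanAtMost)
  define \<eta>' where "\<eta>' s = (if s \<in> S then \<eta> s else g s)" for s
  have "bij_betw \<eta>' S {1..card S}"
    using assms(3) by (simp add: \<eta>'_def cong: bij_betw_cong)
  moreover have "bij_betw \<eta>' (S' - S) {card S<..card S'}"
    using g by (subst bij_betw_cong [of _ _ g]) (auto simp: \<eta>'_def)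
  ultimately have "bij_betw \<eta>' (S \<union> (S' - S)) ({1..card S} \<union> {card S<..card S'})"
    by (rule bij_betw_combine) auto
  moreover have "S \<union> (S' - S) = S'" "{1..card S} \<union> {card S<..card S'} = {1..card S'}"
    using assms(2) le by auto
  ultimately show thesis using that [of \<eta>'] by (simp add: \<eta>'_def)
qed

section \<open>From sequences to derivations and back\<close>

locale difference_system =
  fixes \<Gamma> :: "(int ^ 'd, 'a::field) mpoly set"
  assumes pd: "pd_system \<Gamma>" and ml: "multilinear \<Gamma>"
begin

lemma deg: "P \<in> \<Gamma> \<Longrightarrow> a \<in> pattern P \<Longrightarrow> degree_in P a = 1"
  using ml by (simp add: multilinear_def)

lemma eval_num_den:
  assumes "P \<in> \<Gamma>" "a \<in> pattern P"
  shows "mpoly_eval rat_const u P = num_at P a u + u a * den_at P a u"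
  unfolding num_at_def den_at_def
  by (subst num_denom_props(3) [OF assms(2) deg [OF assms]])
     (simp add: rat.eval_add rat.eval_mult rat.eval_indet)

lemma num_den_cong:
  assumes "P \<in> \<Gamma>" "a \<in> pattern P" "\<And>b. b \<in> pattern P - {a} \<Longrightarrow> u b = v b"
  shows "num_at P a u = num_at P a v" "den_at P a u = den_at P a v"
  using num_denom_props [OF assms(2) deg [OF assms(1,2)]] assms(3) unfolding num_at_def den_at_def
  by (intro rat.eval_cong; blast)+

text \<open>The polynomial copy with a given pattern is unique and numerators and denominators
  commute with translation, so a step of a run can be read at the untranslated polynomial P.\<close>

lemma step_ok_iff:
  assumes i: "s < i" "i \<in> \<Psi> i" "inj_on \<alpha> (\<Psi> i)"
    and P: "P \<in> \<Gamma>" "a \<in> pattern P" "\<alpha> i = a + t" "\<alpha> ` \<Psi> i = shift t (pattern P)"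
    and u: "\<And>j. j \<in> \<Psi> i - {i} \<Longrightarrow> u (\<alpha> j - t) = \<xi> j"
  shows "step_ok \<Gamma> s \<eta> \<alpha> \<Psi> \<xi> i \<longleftrightarrow> den_at P a u \<noteq> 0 \<and> \<xi> i = - num_at P a u / den_at P a u"
proof -
  have copy: "copy_with_pattern \<Gamma> (\<alpha> ` \<Psi> i) = translate t P"
    unfolding copy_with_pattern_def
  proof (rule the1_equality)
    show "\<exists>!Q. (\<exists>P\<in>\<Gamma>. \<exists>t. Q = translate t P) \<and> pattern Q = \<alpha> ` \<Psi> i"
      by (rule copy_with_pattern_ex1 [OF pd]) (use P(1,2,4) in \<open>auto simp: copies_def\<close>)
    show "(\<exists>P'\<in>\<Gamma>. \<exists>t'. translate t P = translate t' P') \<and> pattern (translate t P) = \<alpha> ` \<Psi> i"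
      using P(1,4) by (auto simp: pattern_translate)
  qed
  let ?v = "step_assignment \<alpha> \<Psi> \<xi> i"
  have v: "?v (b + t) = u b" if b: "b \<in> pattern P - {a}" for b
  proof -
    have "b + t \<in> \<alpha> ` \<Psi> i" "b + t \<noteq> \<alpha> i" using b P(3,4) by auto
    then obtain j where j: "j \<in> \<Psi> i - {i}" "\<alpha> j = b + t" by force
    have "inj_on \<alpha> (\<Psi> i - {i})" using i(3) by (rule inj_on_subset) auto
    then have "inv_into (\<Psi> i - {i}) \<alpha> (b + t) = j" using inv_into_f_f [of \<alpha> "\<Psi> i - {i}" j] j by simp
    then show ?thesis using u [OF j(1)] by (simp add: step_assignment_def j(2))
  qed
  have "mpoly_eval rat_const ?v (numerator (translate t P) (\<alpha> i)) = num_at P a u"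
    "mpoly_eval rat_const ?v (denominator (translate t P) (\<alpha> i)) = den_at P a u"
    using num_den_cong [OF P(1,2), of "\<lambda>b. ?v (b + t)" u] v
    unfolding P(3) num_denom_translate [OF P(2) deg [OF P(1,2)]] rat.eval_translate num_at_def den_at_def
    by auto
  then show ?thesis using i(1) by (simp add: step_ok_def copy Let_def)
qed

lemma step_data:
  assumes "prerun (pattern ` \<Gamma>) S T n \<alpha> \<Psi>" "i \<in> indices n" "card S < i"
  obtains P t a where "P \<in> \<Gamma>" "a \<in> pattern P" "\<alpha> i = a + t" "\<alpha> ` \<Psi> i = shift t (pattern P)"
    "shift t (pattern P) \<subseteq> T" "\<Psi> i \<subseteq> {1..i}" "i \<in> \<Psi> i" "inj_on \<alpha> (\<Psi> i)"
    "\<And>b. b \<in> pattern P - {a} \<Longrightarrow> \<exists>j\<in>\<Psi> i - {i}. \<alpha> j = b + t"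
proof -
  have i: "\<Psi> i \<subseteq> {1..i}" "i \<in> \<Psi> i" "inj_on \<alpha> (\<Psi> i)" "\<alpha> ` \<Psi> i \<in> copies (pattern ` \<Gamma>)"
    using assms unfolding prerun_def by auto
  then obtain P t where P: "P \<in> \<Gamma>" "\<alpha> ` \<Psi> i = shift t (pattern P)" by (auto simp: copies_def)
  then obtain a where a: "a \<in> pattern P" "\<alpha> i = a + t" using i(2) by blast
  have "\<alpha> ` \<Psi> i \<subseteq> \<alpha> ` indices n" using i(1) indices_down [OF assms(2)] by blast
  then have sub: "shift t (pattern P) \<subseteq> T" using assms(1) P(2) unfolding prerun_def by auto
  have "\<exists>j\<in>\<Psi> i - {i}. \<alpha> j = b + t" if b: "b \<in> pattern P - {a}" for b
  proof -
    have "b + t \<in> \<alpha> ` \<Psi> i" "b + t \<noteq> \<alpha> i" using b P(2) a(2) by auto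
    then show ?thesis by force
  qed
  then show thesis using that P a i sub by blast
qed

text \<open>A step looks only at positions up to i and at values before i; these determine the value
  at i.\<close>

lemma step_ok_cong:
  assumes run: "prerun (pattern ` \<Gamma>) S T n \<alpha> \<Psi>" "prerun (pattern ` \<Gamma>) S T n' \<alpha>' \<Psi>'"
    and i: "i \<in> indices n" "i \<in> indices n'"
    and eq: "\<And>j. j \<in> {1..i} \<Longrightarrow> \<alpha>' j = \<alpha> j" "card S < i \<Longrightarrow> \<Psi>' i = \<Psi> i" "\<And>j. j \<in> {1..<i} \<Longrightarrow> \<xi>' j = \<xi> j"
    and ok: "step_ok \<Gamma> (card S) \<eta> \<alpha> \<Psi> \<xi> i"
  shows "step_ok \<Gamma> (card S) \<eta> \<alpha>' \<Psi>' \<xi>' i \<longleftrightarrow> \<xi>' i = \<xi> i"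
proof (cases "i \<le> card S")
  case True
  have "i \<in> {1..i}" using i(1) by (simp add: indices_def)
  then show ?thesis using True ok eq(1) [of i] by (simp add: step_ok_def)
next
  case False
  then have less: "card S < i" by simp
  obtain P t a where P: "P \<in> \<Gamma>" "a \<in> pattern P" "\<alpha> i = a + t" "\<alpha> ` \<Psi> i = shift t (pattern P)"
      "\<Psi> i \<subseteq> {1..i}" "i \<in> \<Psi> i" "inj_on \<alpha> (\<Psi> i)"
    using step_data [OF run(1) i(1) less] by metis
  have \<Psi>: "\<Psi>' i = \<Psi> i" by (rule eq(2) [OF less])
  have \<alpha>: "\<alpha>' j = \<alpha> j" if "j \<in> \<Psi> i" for j using that P(5) eq(1) by blast
  have "\<alpha>' ` \<Psi> i = \<alpha> ` \<Psi> i" "inj_on \<alpha>' (\<Psi> i) \<longleftrightarrow> inj_on \<alpha> (\<Psi> i)"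
    by (rule image_cong [OF refl \<alpha>], assumption) (rule inj_on_cong [OF \<alpha>])
  then have im: "\<alpha>' ` \<Psi>' i = shift t (pattern P)" "inj_on \<alpha>' (\<Psi>' i)" "\<alpha>' i = a + t"
    using P(3,4,6,7) \<alpha> by (simp_all add: \<Psi>)
  define u where "u b = \<xi> (inv_into (\<Psi> i) \<alpha> (b + t))" for b
  have u: "u (\<alpha> j - t) = \<xi> j" if "j \<in> \<Psi> i - {i}" for j
    using that P(7) by (simp add: u_def)
  have u': "u (\<alpha>' j - t) = \<xi>' j" if "j \<in> \<Psi>' i - {i}" for j
  proof -
    have "j \<in> {1..<i}" using that P(5) by (force simp: \<Psi>)
    then show ?thesis using u [of j] that \<alpha> [of j] eq(3) by (simp add: \<Psi>)
  qed
  have "step_ok \<Gamma> (card S) \<eta> \<alpha>' \<Psi>' \<xi>' i \<longleftrightarrow>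
      den_at P a u \<noteq> 0 \<and> \<xi>' i = - num_at P a u / den_at P a u"
    by (rule step_ok_iff [of "card S" i \<Psi>' \<alpha>' P a t u \<xi>' \<eta>, OF less P(6) [folded \<Psi>] im(2) P(1,2) im(3,1) u'])
  moreover have "den_at P a u \<noteq> 0 \<and> \<xi> i = - num_at P a u / den_at P a u"
    using ok step_ok_iff [of "card S" i \<Psi> \<alpha> P a t u \<xi> \<eta>, OF less P(6,7,1-4) u] by blast
  ultimately show ?thesis by auto
qed

lemma free_computation_unique:
  assumes run: "prerun (pattern ` \<Gamma>) S T n \<alpha> \<Psi>" "prerun (pattern ` \<Gamma>) S T n' \<alpha>' \<Psi>'" "n \<le> n'"
    and eq: "\<And>i. i \<in> indices n \<Longrightarrow> \<alpha>' i = \<alpha> i" "\<And>i. i \<in> indices n \<Longrightarrow> card S < i \<Longrightarrow> \<Psi>' i = \<Psi> i"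
    and fc: "free_computation \<Gamma> (card S) \<eta> n \<alpha> \<Psi> \<xi>" "free_computation \<Gamma> (card S) \<eta> n' \<alpha>' \<Psi>' \<xi>'"
    and i: "i \<in> indices n"
  shows "\<xi>' i = \<xi> i"
  using i
proof (induction i rule: less_induct)
  case (less i)
  have i: "i \<in> indices n'" using less.prems indices_mono [OF run(3)] by blast
  have down: "j \<in> indices n" if "j \<in> {1..i}" for j using indices_down [OF less.prems that] .
  have "step_ok \<Gamma> (card S) \<eta> \<alpha> \<Psi> \<xi> i" "step_ok \<Gamma> (card S) \<eta> \<alpha>' \<Psi>' \<xi>' i"
    using fc less.prems i unfolding free_computation_iff by blast+
  moreover have "\<xi>' j = \<xi> j" if "j \<in> {1..<i}" for j
    using less.IH [of j] down [of j] that by simp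
  ultimately show ?case
    using step_ok_cong [OF run(1,2) less.prems i eq(1) [OF down] eq(2) [OF less.prems]] by blast
qed

text \<open>The function j selects for each point of the copy an earlier index. The choice matters,
  since a point may occur repeatedly with different values.\<close>

lemma prerun_step:
  assumes run: "prerun (pattern ` \<Gamma>) S T (enat m) \<alpha> \<Psi>"
    and P: "P \<in> \<Gamma>" "shift t (pattern P) \<subseteq> T" "a \<in> pattern P"
    and j: "\<And>b. b \<in> pattern P - {a} \<Longrightarrow> j b \<in> {1..m} \<and> \<alpha> (j b) = b + t"
    and \<alpha>': "\<alpha>' = \<alpha>(Suc m := a + t)"
    and \<Psi>': "\<Psi>' = \<Psi>(Suc m := insert (Suc m) (j ` (pattern P - {a})))"
  shows "prerun (pattern ` \<Gamma>) S T (enat (Suc m)) \<alpha>' \<Psi>'"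
    and "\<alpha>' ` \<Psi>' (Suc m) = shift t (pattern P)"
proof -
  have m: "card S \<le> m" "bij_betw \<alpha> {1..card S} S" "\<alpha> ` {1..m} \<subseteq> T"
    "\<And>i. i \<in> {1..m} \<Longrightarrow> card S < i \<Longrightarrow> \<Psi> i \<subseteq> {1..i} \<and> i \<in> \<Psi> i \<and> inj_on \<alpha> (\<Psi> i) \<and> \<alpha> ` \<Psi> i \<in> copies (pattern ` \<Gamma>)"
    using run unfolding prerun_def indices_enat by auto
  have old: "\<alpha>' i = \<alpha> i" "\<Psi>' i = \<Psi> i" if "i \<in> {1..m}" for i using that by (auto simp: \<alpha>' \<Psi>')
  have aj: "\<alpha>' (j b) = b + t" "j b \<in> {1..m}" if "b \<in> pattern P - {a}" for b
    using j [OF that] old by auto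
  have new: "\<alpha>' (Suc m) = a + t" "\<Psi>' (Suc m) = insert (Suc m) (j ` (pattern P - {a}))"
    by (simp_all add: \<alpha>' \<Psi>')
  have "\<alpha>' ` j ` (pattern P - {a}) = (\<lambda>b. b + t) ` (pattern P - {a})"
    unfolding image_image by (rule image_cong) (use aj in auto)
  then show im: "\<alpha>' ` \<Psi>' (Suc m) = shift t (pattern P)" using P(3) by (auto simp: new)
  have inj: "inj_on \<alpha>' (\<Psi>' (Suc m))"
    unfolding new(2) inj_on_insert
  proof
    show "inj_on \<alpha>' (j ` (pattern P - {a}))"
    proof (rule inj_onI)
      fix x y assume "x \<in> j ` (pattern P - {a})" "y \<in> j ` (pattern P - {a})" and eq: "\<alpha>' x = \<alpha>' y"
      then obtain b c where bc: "b \<in> pattern P - {a}" "x = j b" "c \<in> pattern P - {a}" "y = j c" by blast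
      then have "b + t = c + t" using eq aj(1) by simp
      then show "x = y" using bc by simp
    qed
    show "\<alpha>' (Suc m) \<notin> \<alpha>' ` (j ` (pattern P - {a}) - {Suc m})"
    proof
      assume "\<alpha>' (Suc m) \<in> \<alpha>' ` (j ` (pattern P - {a}) - {Suc m})"
      then obtain b where "b \<in> pattern P - {a}" "\<alpha>' (Suc m) = \<alpha>' (j b)" by blast
      then show False using aj(1) [of b] by (simp add: new(1))
    qed
  qed
  have "bij_betw \<alpha>' {1..card S} S"
    using m(1,2) old by (subst bij_betw_cong [of _ _ \<alpha>]) auto
  moreover have "\<alpha>' ` {1..Suc m} \<subseteq> T"
    using m(3) old P(2,3) new(1) by (auto simp: atLeastAtMostSuc_conv)
  moreover have "\<Psi>' i \<subseteq> {1..i} \<and> i \<in> \<Psi>' i \<and> inj_on \<alpha>' (\<Psi>' i) \<and> \<alpha>' ` \<Psi>' i \<in> copies (pattern ` \<Gamma>)"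
    if i: "i \<in> {1..Suc m}" "card S < i" for i
  proof (cases "i = Suc m")
    case True
    have "\<Psi>' (Suc m) \<subseteq> {1..Suc m}" using aj(2) by (fastforce simp: new)
    moreover have "\<alpha>' ` \<Psi>' (Suc m) \<in> copies (pattern ` \<Gamma>)" unfolding im copies_def using P(1) by blast
    ultimately show ?thesis using True inj by (simp add: new)
  next
    case False
    then have i': "i \<in> {1..m}" using i(1) by auto
    have sub: "\<Psi> i \<subseteq> {1..m}" using m(4) [OF i' i(2)] i' by auto
    have "\<alpha>' ` \<Psi> i = \<alpha> ` \<Psi> i" by (rule image_cong [OF refl]) (use sub old in blast)
    moreover have "inj_on \<alpha>' (\<Psi> i) \<longleftrightarrow> inj_on \<alpha> (\<Psi> i)" by (rule inj_on_cong) (use sub old in blast)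
    ultimately show ?thesis using m(4) [OF i' i(2)] old(2) [OF i'] by simp
  qed
  ultimately show "prerun (pattern ` \<Gamma>) S T (enat (Suc m)) \<alpha>' \<Psi>'"
    using m(1) unfolding prerun_def indices_enat by simp
qed

section \<open>Extending finite preruns and completing them to runs\<close>

definition extends ::
    "(int ^ 'd) set \<Rightarrow> nat \<Rightarrow> (nat \<Rightarrow> int ^ 'd) \<Rightarrow> (nat \<Rightarrow> nat set) \<Rightarrow>
     nat \<Rightarrow> (nat \<Rightarrow> int ^ 'd) \<Rightarrow> (nat \<Rightarrow> nat set) \<Rightarrow> bool" where
  "extends S m \<alpha> \<Psi> m' \<alpha>' \<Psi>' \<longleftrightarrow> m \<le> m' \<and> (\<forall>i\<in>{1..m}. \<alpha>' i = \<alpha> i \<and> (card S < i \<longrightarrow> \<Psi>' i = \<Psi> i))"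

lemma extends_refl: "extends S m \<alpha> \<Psi> m \<alpha> \<Psi>"
  by (simp add: extends_def)

lemma extends_trans:
  "extends S m \<alpha> \<Psi> m' \<alpha>' \<Psi>' \<Longrightarrow> extends S m' \<alpha>' \<Psi>' m'' \<alpha>'' \<Psi>'' \<Longrightarrow> extends S m \<alpha> \<Psi> m'' \<alpha>'' \<Psi>''"
  by (auto simp: extends_def)

lemma extends_step: "extends S m \<alpha> \<Psi> (Suc m) (\<alpha>(Suc m := x)) (\<Psi>(Suc m := y))"
  by (auto simp: extends_def)

text \<open>By induction on percolation: the finitely many other points of the copy are reached one
  after the other, each time extending the sequence obtained so far, and then the point itself is
  appended.\<close>

lemma prerun_reach:
  assumes "a \<in> occupied (pattern ` \<Gamma>) S T" "prerun (pattern ` \<Gamma>) S T (enat m) \<alpha> \<Psi>"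
  shows "\<exists>m' \<alpha>' \<Psi>'. prerun (pattern ` \<Gamma>) S T (enat m') \<alpha>' \<Psi>' \<and> extends S m \<alpha> \<Psi> m' \<alpha>' \<Psi>' \<and> a \<in> \<alpha>' ` {1..m'}"
  using assms
proof (induction arbitrary: m \<alpha> \<Psi> rule: occupied.induct)
  case (seed a)
  then have "a \<in> \<alpha> ` {1..card S}" "card S \<le> m" by (auto simp: prerun_def bij_betw_def)
  then have "a \<in> \<alpha> ` {1..m}" by auto
  then show ?case using seed.prems extends_refl by blast
next
  case (step D a)
  obtain P t where P: "P \<in> \<Gamma>" "D = shift t (pattern P)" using step.hyps(1) by (auto simp: copies_def)
  have "finite (D - {a})" by (simp add: P(2) finite_pattern)
  have reach: "finite B \<Longrightarrow> B \<subseteq> D - {a} \<Longrightarrow> \<exists>m' \<alpha>' \<Psi>'. prerun (pattern ` \<Gamma>) S T (enat m') \<alpha>' \<Psi>' \<and>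
      extends S m \<alpha> \<Psi> m' \<alpha>' \<Psi>' \<and> B \<subseteq> \<alpha>' ` {1..m'}" for B
  proof (induction B rule: finite_induct)
    case empty
    then show ?case using step.prems extends_refl by blast
  next
    case (insert b B)
    then obtain m1 \<alpha>1 \<Psi>1 where 1: "prerun (pattern ` \<Gamma>) S T (enat m1) \<alpha>1 \<Psi>1"
      "extends S m \<alpha> \<Psi> m1 \<alpha>1 \<Psi>1" "B \<subseteq> \<alpha>1 ` {1..m1}" by blast
    obtain m2 \<alpha>2 \<Psi>2 where 2: "prerun (pattern ` \<Gamma>) S T (enat m2) \<alpha>2 \<Psi>2"
      "extends S m1 \<alpha>1 \<Psi>1 m2 \<alpha>2 \<Psi>2" "b \<in> \<alpha>2 ` {1..m2}"
      using step.IH [OF _ 1(1), of b] insert.prems by blast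
    have "\<alpha>1 ` {1..m1} \<subseteq> \<alpha>2 ` {1..m2}"
    proof
      fix x assume "x \<in> \<alpha>1 ` {1..m1}"
      then obtain i where "i \<in> {1..m1}" "x = \<alpha>1 i" by blast
      then show "x \<in> \<alpha>2 ` {1..m2}" using 2(2) by (intro image_eqI [of _ _ i]) (auto simp: extends_def)
    qed
    then have "insert b B \<subseteq> \<alpha>2 ` {1..m2}" using 1(3) 2(3) by simp
    then show ?case
      by (intro exI [of _ m2] exI [of _ \<alpha>2] exI [of _ \<Psi>2] conjI 2(1) extends_trans [OF 1(2) 2(2)])
  qed
  then obtain m1 \<alpha>1 \<Psi>1 where 1: "prerun (pattern ` \<Gamma>) S T (enat m1) \<alpha>1 \<Psi>1"
    "extends S m \<alpha> \<Psi> m1 \<alpha>1 \<Psi>1" "D - {a} \<subseteq> \<alpha>1 ` {1..m1}"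
    using reach [OF \<open>finite (D - {a})\<close> subset_refl] by blast
  have a: "a - t \<in> pattern P" using step.hyps(3) P(2) by auto
  have "\<exists>i. i \<in> {1..m1} \<and> \<alpha>1 i = b + t" if "b \<in> pattern P - {a - t}" for b
  proof -
    have "b + t \<in> D - {a}" using that P(2) by auto
    then have "b + t \<in> \<alpha>1 ` {1..m1}" using 1(3) by blast
    then show ?thesis by (elim imageE) auto
  qed
  then obtain j where j: "\<And>b. b \<in> pattern P - {a - t} \<Longrightarrow> j b \<in> {1..m1} \<and> \<alpha>1 (j b) = b + t" by metis
  let ?\<alpha> = "\<alpha>1(Suc m1 := a)" and ?\<Psi> = "\<Psi>1(Suc m1 := insert (Suc m1) (j ` (pattern P - {a - t})))"
  have "prerun (pattern ` \<Gamma>) S T (enat (Suc m1)) ?\<alpha> ?\<Psi>"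
    using step.hyps(2) P(2) by (intro prerun_step(1) [OF 1(1) P(1) _ a j]) auto
  moreover have "extends S m \<alpha> \<Psi> (Suc m1) ?\<alpha> ?\<Psi>"
    by (rule extends_trans [OF 1(2) extends_step])
  moreover have "a \<in> ?\<alpha> ` {1..Suc m1}" by (rule image_eqI [of _ _ "Suc m1"]) auto
  ultimately show ?case by blast
qed


lemma prerun_restrict:
  "prerun \<A> S T n \<alpha> \<Psi> \<Longrightarrow> card S \<le> m \<Longrightarrow> enat m \<le> n \<Longrightarrow> prerun \<A> S T (enat m) \<alpha> \<Psi>"
  using indices_mono [of "enat m" n] unfolding prerun_def by (auto 0 3)

lemma step_ok_new:
  assumes run: "prerun (pattern ` \<Gamma>) S T (enat m) \<alpha> \<Psi>"
    and P: "P \<in> \<Gamma>" "shift t (pattern P) \<subseteq> T" "a \<in> pattern P"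
    and j: "\<And>b. b \<in> pattern P - {a} \<Longrightarrow> j b \<in> {1..m} \<and> \<alpha> (j b) = b + t"
    and \<alpha>': "\<alpha>' = \<alpha>(Suc m := a + t)"
    and \<Psi>': "\<Psi>' = \<Psi>(Suc m := insert (Suc m) (j ` (pattern P - {a})))"
    and u: "\<And>b. b \<in> pattern P - {a} \<Longrightarrow> u b = \<xi> (j b)"
  shows "step_ok \<Gamma> (card S) \<eta> \<alpha>' \<Psi>' \<xi> (Suc m) \<longleftrightarrow>
    den_at P a u \<noteq> 0 \<and> \<xi> (Suc m) = - num_at P a u / den_at P a u"
proof -
  note new = prerun_step [OF run P j \<alpha>' \<Psi>']
  have less: "card S < Suc m" using run by (simp add: prerun_def)
  have "Suc m \<in> indices (enat (Suc m))" by (simp add: indices_enat)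
  then have inj: "inj_on \<alpha>' (\<Psi>' (Suc m))" using new(1) less unfolding prerun_def by blast
  have "u (\<alpha>' i - t) = \<xi> i" if i: "i \<in> \<Psi>' (Suc m) - {Suc m}" for i
  proof -
    obtain b where b: "b \<in> pattern P - {a}" "i = j b" using i by (auto simp: \<Psi>')
    then have "\<alpha>' i = b + t" using j [OF b(1)] by (auto simp: \<alpha>')
    then show ?thesis using u [OF b(1)] b(2) by simp
  qed
  moreover have "Suc m \<in> \<Psi>' (Suc m)" "\<alpha>' (Suc m) = a + t" by (simp_all add: \<alpha>' \<Psi>')
  ultimately show ?thesis
    using step_ok_iff [of "card S" "Suc m" \<Psi>' \<alpha>' P a t u \<xi> \<eta>] less inj P(1,3) new(2) by blast
qed

lemma free_computation_step:
  assumes run: "prerun (pattern ` \<Gamma>) S T (enat m) \<alpha> \<Psi>"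
    and fc: "free_computation \<Gamma> (card S) \<eta> (enat m) \<alpha> \<Psi> \<xi>"
    and P: "P \<in> \<Gamma>" "shift t (pattern P) \<subseteq> T" "a \<in> pattern P"
    and j: "\<And>b. b \<in> pattern P - {a} \<Longrightarrow> j b \<in> {1..m} \<and> \<alpha> (j b) = b + t"
    and \<alpha>': "\<alpha>' = \<alpha>(Suc m := a + t)"
    and \<Psi>': "\<Psi>' = \<Psi>(Suc m := insert (Suc m) (j ` (pattern P - {a})))"
    and u: "\<And>b. b \<in> pattern P - {a} \<Longrightarrow> u b = \<xi> (j b)" and den: "den_at P a u \<noteq> 0"
    and \<xi>': "\<xi>' = \<xi>(Suc m := - num_at P a u / den_at P a u)"
  shows "free_computation \<Gamma> (card S) \<eta> (enat (Suc m)) \<alpha>' \<Psi>' \<xi>'"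
  unfolding free_computation_iff indices_enat
proof
  note new = prerun_step [OF run P j \<alpha>' \<Psi>']
  fix i assume i: "i \<in> {1..Suc m}"
  show "step_ok \<Gamma> (card S) \<eta> \<alpha>' \<Psi>' \<xi>' i"
  proof (cases "i = Suc m")
    case True
    have "u b = \<xi>' (j b)" if "b \<in> pattern P - {a}" for b
      using u [OF that] j [OF that] by (auto simp: \<xi>')
    then show ?thesis
      using step_ok_new [OF run P j \<alpha>' \<Psi>', of u \<xi>' \<eta>] den True by (simp add: \<xi>')
  next
    case False
    then have i': "i \<in> {1..m}" using i by auto
    then have "step_ok \<Gamma> (card S) \<eta> \<alpha> \<Psi> \<xi> i" using fc by (auto simp: free_computation_iff indices_enat)
    then have "step_ok \<Gamma> (card S) \<eta> \<alpha>' \<Psi>' \<xi>' i \<longleftrightarrow> \<xi>' i = \<xi> i"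
      by (intro step_ok_cong [OF run new(1)]) (use i i' in \<open>auto simp: indices_enat \<alpha>' \<Psi>' \<xi>'\<close>)
    then show ?thesis using i' by (auto simp: \<xi>')
  qed
qed

text \<open>Any derivation can be replayed behind a given finite computation, whatever values that
  already contains. Hence several derivations fit into one computation.\<close>

lemma prerun_reach_value:
  assumes "derivable \<Gamma> S \<eta> T a x"
    and "prerun (pattern ` \<Gamma>) S T (enat m) \<alpha> \<Psi>" "free_computation \<Gamma> (card S) \<eta> (enat m) \<alpha> \<Psi> \<xi>"
  shows "\<exists>m' \<alpha>' \<Psi>' \<xi>'. prerun (pattern ` \<Gamma>) S T (enat m') \<alpha>' \<Psi>' \<and>
    free_computation \<Gamma> (card S) \<eta> (enat m') \<alpha>' \<Psi>' \<xi>' \<and>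
    extends S m \<alpha> \<Psi> m' \<alpha>' \<Psi>' \<and> (\<forall>i\<in>{1..m}. \<xi>' i = \<xi> i) \<and> (\<exists>i\<in>{1..m'}. \<alpha>' i = a \<and> \<xi>' i = x)"
  using assms
proof (induction arbitrary: m \<alpha> \<Psi> \<xi> rule: derivable.induct)
  case (seed a)
  then have "a \<in> \<alpha> ` {1..card S}" and le: "card S \<le> m" by (auto simp: prerun_def bij_betw_def)
  then obtain i where i: "i \<in> {1..card S}" "\<alpha> i = a" by blast
  then have "step_ok \<Gamma> (card S) \<eta> \<alpha> \<Psi> \<xi> i"
    using seed.prems(2) le by (auto simp: free_computation_iff indices_enat)
  then have "\<xi> i = rat_indet (\<eta> a)" using i by (simp add: step_ok_def)
  then have "\<exists>i\<in>{1..m}. \<alpha> i = a \<and> \<xi> i = rat_indet (\<eta> a)" using i le by (intro bexI [of _ i]) auto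
  then show ?case using seed.prems extends_refl by blast
next
  case (step P t a u)
  have reach: "finite B \<Longrightarrow> B \<subseteq> pattern P - {a} \<Longrightarrow> \<exists>m' \<alpha>' \<Psi>' \<xi>'.
      prerun (pattern ` \<Gamma>) S T (enat m') \<alpha>' \<Psi>' \<and>
      free_computation \<Gamma> (card S) \<eta> (enat m') \<alpha>' \<Psi>' \<xi>' \<and>
      extends S m \<alpha> \<Psi> m' \<alpha>' \<Psi>' \<and> (\<forall>i\<in>{1..m}. \<xi>' i = \<xi> i) \<and>
      (\<forall>b\<in>B. \<exists>i\<in>{1..m'}. \<alpha>' i = b + t \<and> \<xi>' i = u b)" for B
  proof (induction B rule: finite_induct)
    case empty
    then show ?case using step.prems extends_refl by blast
  next
    case (insert b B)
    then have "B \<subseteq> pattern P - {a}" by simp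
    from insert.IH [OF this] obtain m1 \<alpha>1 \<Psi>1 \<xi>1 where 1: "prerun (pattern ` \<Gamma>) S T (enat m1) \<alpha>1 \<Psi>1"
      "free_computation \<Gamma> (card S) \<eta> (enat m1) \<alpha>1 \<Psi>1 \<xi>1"
      "extends S m \<alpha> \<Psi> m1 \<alpha>1 \<Psi>1" "\<forall>i\<in>{1..m}. \<xi>1 i = \<xi> i"
      "\<forall>b\<in>B. \<exists>i\<in>{1..m1}. \<alpha>1 i = b + t \<and> \<xi>1 i = u b"
        by (elim exE conjE) (rule that)
    have "b \<in> pattern P - {a}" using insert.prems by blast
    from step.IH [OF this 1(1,2)] obtain m2 \<alpha>2 \<Psi>2 \<xi>2 where 2: "prerun (pattern ` \<Gamma>) S T (enat m2) \<alpha>2 \<Psi>2"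
      "free_computation \<Gamma> (card S) \<eta> (enat m2) \<alpha>2 \<Psi>2 \<xi>2"
      "extends S m1 \<alpha>1 \<Psi>1 m2 \<alpha>2 \<Psi>2" "\<forall>i\<in>{1..m1}. \<xi>2 i = \<xi>1 i"
      "\<exists>i\<in>{1..m2}. \<alpha>2 i = b + t \<and> \<xi>2 i = u b"
        by (elim exE conjE) (rule that)
    have "\<exists>i\<in>{1..m2}. \<alpha>2 i = c + t \<and> \<xi>2 i = u c" if "c \<in> B" for c
    proof -
      from bspec [OF 1(5) that] obtain i where "i \<in> {1..m1}" "\<alpha>1 i = c + t" "\<xi>1 i = u c"
        by (elim bexE conjE)
      then show ?thesis using 2(3,4) by (intro bexI [of _ i]) (auto simp: extends_def)
    qed
    moreover have "\<forall>i\<in>{1..m}. \<xi>2 i = \<xi> i" using 1(3,4) 2(4) by (auto simp: extends_def)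
    moreover have "\<forall>c\<in>insert b B. \<exists>i\<in>{1..m2}. \<alpha>2 i = c + t \<and> \<xi>2 i = u c"
      using 2(5) calculation(1) by (intro ballI) (elim insertE, simp_all)
    ultimately show ?case
      by (intro exI [of _ m2] exI [of _ \<alpha>2] exI [of _ \<Psi>2] exI [of _ \<xi>2] conjI 2(1,2) extends_trans [OF 1(3) 2(3)])
  qed
  have "finite (pattern P - {a})" by (simp add: finite_pattern)
  from reach [OF this subset_refl] obtain m1 \<alpha>1 \<Psi>1 \<xi>1 where 1: "prerun (pattern ` \<Gamma>) S T (enat m1) \<alpha>1 \<Psi>1"
    "free_computation \<Gamma> (card S) \<eta> (enat m1) \<alpha>1 \<Psi>1 \<xi>1"
    "extends S m \<alpha> \<Psi> m1 \<alpha>1 \<Psi>1" "\<forall>i\<in>{1..m}. \<xi>1 i = \<xi> i"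
    "\<forall>b\<in>pattern P - {a}. \<exists>i\<in>{1..m1}. \<alpha>1 i = b + t \<and> \<xi>1 i = u b"
        by (elim exE conjE) (rule that)
  from 1(5) obtain j where
    j: "\<And>b. b \<in> pattern P - {a} \<Longrightarrow> j b \<in> {1..m1} \<and> \<alpha>1 (j b) = b + t \<and> \<xi>1 (j b) = u b" by metis
  define \<alpha>2 where "\<alpha>2 = \<alpha>1(Suc m1 := a + t)"
  define \<Psi>2 where "\<Psi>2 = \<Psi>1(Suc m1 := insert (Suc m1) (j ` (pattern P - {a})))"
  define \<xi>2 where "\<xi>2 = \<xi>1(Suc m1 := - num_at P a u / den_at P a u)"
  have "prerun (pattern ` \<Gamma>) S T (enat (Suc m1)) \<alpha>2 \<Psi>2"
    by (rule prerun_step(1) [OF 1(1) step.hyps(1-3) _ \<alpha>2_def \<Psi>2_def]) (use j in blast)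
  moreover have "free_computation \<Gamma> (card S) \<eta> (enat (Suc m1)) \<alpha>2 \<Psi>2 \<xi>2"
    by (rule free_computation_step [OF 1(1,2) step.hyps(1-3) _ \<alpha>2_def \<Psi>2_def _ step.hyps(5) \<xi>2_def])
       (use j in auto)
  moreover have "extends S m \<alpha> \<Psi> (Suc m1) \<alpha>2 \<Psi>2"
    unfolding \<alpha>2_def \<Psi>2_def by (rule extends_trans [OF 1(3) extends_step])
  moreover have "\<forall>i\<in>{1..m}. \<xi>2 i = \<xi> i" using 1(3,4) by (auto simp: \<xi>2_def extends_def)
  moreover have "\<exists>i\<in>{1..Suc m1}. \<alpha>2 i = a + t \<and> \<xi>2 i = - num_at P a u / den_at P a u"
    by (intro bexI [of _ "Suc m1"]) (simp_all add: \<alpha>2_def \<xi>2_def)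
  ultimately show ?case
    by (intro exI [of _ "Suc m1"] exI [of _ \<alpha>2] exI [of _ \<Psi>2] exI [of _ \<xi>2] conjI)
qed

lemma initial_prerun:
  assumes "finite S" "S \<subseteq> T"
  obtains \<alpha> \<Psi> \<xi> where "prerun \<A> S T (enat (card S)) \<alpha> \<Psi>"
    "free_computation \<Gamma> (card S) \<eta> (enat (card S)) \<alpha> \<Psi> \<xi>"
proof -
  obtain \<alpha> where \<alpha>: "bij_betw \<alpha> {1..card S} S" using ex_bij_betw_nat_finite_1 [OF assms(1)] by blast
  then have "\<alpha> ` {1..card S} \<subseteq> T" using assms(2) by (simp add: bij_betw_def)
  then have "prerun \<A> S T (enat (card S)) \<alpha> (\<lambda>_. {})"
    using \<alpha> by (auto simp: prerun_def indices_enat)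
  moreover have "free_computation \<Gamma> (card S) \<eta> (enat (card S)) \<alpha> (\<lambda>_. {}) (\<lambda>i. rat_indet (\<eta> (\<alpha> i)))"
    by (auto simp: free_computation_iff indices_enat step_ok_def)
  ultimately show thesis by (rule that)
qed

lemma countable_points: "countable (X :: (int ^ 'd) set)"
proof -
  have "countable (vec_nth ` X)" by (rule countableI_type)
  moreover have "inj_on vec_nth X" by (simp add: inj_on_def vec_eq_iff)
  ultimately show ?thesis by (rule countable_image_inj_on)
qed

text \<open>T is countable. Dependent choice builds extensions whose stage k + 1 has reached the
  k-th point of T, and their limit is a run.\<close>

lemma complete_prerun:
  assumes "T \<subseteq> occupied (pattern ` \<Gamma>) S T" "prerun (pattern ` \<Gamma>) S T (enat m) \<alpha> \<Psi>"
  shows "\<exists>n \<alpha>' \<Psi>'. run (pattern ` \<Gamma>) S T n \<alpha>' \<Psi>' \<and> enat m \<le> n \<and>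
    (\<forall>i\<in>{1..m}. \<alpha>' i = \<alpha> i \<and> (card S < i \<longrightarrow> \<Psi>' i = \<Psi> i))"
proof (cases "T = {}")
  case True
  then show ?thesis
    using assms(2) unfolding run_iff_prerun by (intro exI [of _ "enat m"] exI [of _ \<alpha>] exI [of _ \<Psi>]) simp
next
  case False
  let ?pt = "from_nat_into T"
  let ?R = "\<lambda>(m, \<alpha>, \<Psi>). prerun (pattern ` \<Gamma>) S T (enat m) \<alpha> \<Psi>"
  let ?E = "\<lambda>(m, \<alpha>, \<Psi>) (m', \<alpha>', \<Psi>'). extends S m \<alpha> \<Psi> m' \<alpha>' \<Psi>'"
  let ?H = "\<lambda>x (m, \<alpha>, \<Psi>). x \<in> \<alpha> ` {1..m}"
  let ?P = "\<lambda>k s. ?R s \<and> (k = 0 \<longrightarrow> s = (m, \<alpha>, \<Psi>)) \<and> (\<forall>l. k = Suc l \<longrightarrow> ?H (?pt l) s)"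
  have "\<exists>\<sigma>. \<forall>k. ?P k (\<sigma> k) \<and> ?E (\<sigma> k) (\<sigma> (Suc k))"
  proof (rule dependent_nat_choice)
    show "\<exists>s. ?P 0 s" using assms(2) by auto
    fix s k assume s: "?P k s"
    obtain m1 \<alpha>1 \<Psi>1 where s1: "s = (m1, \<alpha>1, \<Psi>1)" by (cases s)
    have "?pt k \<in> occupied (pattern ` \<Gamma>) S T" using assms(1) from_nat_into [OF False, of k] by blast
    moreover have "prerun (pattern ` \<Gamma>) S T (enat m1) \<alpha>1 \<Psi>1" using s by (simp add: s1)
    ultimately obtain m2 \<alpha>2 \<Psi>2 where "prerun (pattern ` \<Gamma>) S T (enat m2) \<alpha>2 \<Psi>2"
      "extends S m1 \<alpha>1 \<Psi>1 m2 \<alpha>2 \<Psi>2" "?pt k \<in> \<alpha>2 ` {1..m2}"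
      using prerun_reach by blast
    then show "\<exists>s'. ?P (Suc k) s' \<and> ?E s s'" unfolding s1 by (intro exI [of _ "(m2, \<alpha>2, \<Psi>2)"]) simp
  qed
  then obtain \<sigma> where all: "\<And>k. ?P k (\<sigma> k) \<and> ?E (\<sigma> k) (\<sigma> (Suc k))" by (elim exE) blast
  note all1 = all [THEN conjunct1, THEN conjunct2]
  have \<sigma>: "\<sigma> 0 = (m, \<alpha>, \<Psi>)" "\<And>k. ?R (\<sigma> k)" "\<And>k. ?H (?pt k) (\<sigma> (Suc k))" "\<And>k. ?E (\<sigma> k) (\<sigma> (Suc k))"
    by (rule all1 [THEN conjunct1, rule_format, OF refl] all [THEN conjunct1, THEN conjunct1]
      all1 [THEN conjunct2, rule_format, OF refl] all [THEN conjunct2])+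
  define M where "M k = fst (\<sigma> k)" for k
  define A where "A k = fst (snd (\<sigma> k))" for k
  define B where "B k = snd (snd (\<sigma> k))" for k
  have s: "\<sigma> k = (M k, A k, B k)" for k by (simp add: M_def A_def B_def)
  have R: "prerun (pattern ` \<Gamma>) S T (enat (M k)) (A k) (B k)" for k using \<sigma>(2) [of k] by (simp add: s)
  have H: "?pt k \<in> A (Suc k) ` {1..M (Suc k)}" for k using \<sigma>(3) [of k] by (simp add: s)
  have E: "extends S (M k) (A k) (B k) (M l) (A l) (B l)" if "k \<le> l" for k l
    using that
  proof (induction l rule: dec_induct)
    case (step l)
    have "extends S (M l) (A l) (B l) (M (Suc l)) (A (Suc l)) (B (Suc l))" using \<sigma>(4) [of l] by (simp add: s)
    then show ?case by (rule extends_trans [OF step.IH])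
  qed (rule extends_refl)
  \<comment> \<open>The first stage at which index i is defined; later stages agree there. The
    supremum n of the lengths may be finite or infinite.\<close>
  define K where "K i = (LEAST k. i \<le> M k)" for i
  define \<alpha>' where "\<alpha>' i = A (K i) i" for i
  define \<Psi>' where "\<Psi>' i = B (K i) i" for i
  define n where "n = (SUP k. enat (M k))"
  have agree: "\<alpha>' i = A k i \<and> (card S < i \<longrightarrow> \<Psi>' i = B k i)" if "i \<in> {1..M k}" for i k
  proof -
    have "i \<le> M (K i)" "K i \<le> k" using that unfolding K_def by (auto intro: LeastI Least_le)
    then show ?thesis using E [of "K i" k] that by (auto simp: extends_def \<alpha>'_def \<Psi>'_def)
  qed
  have idx: "i \<in> indices n \<longleftrightarrow> (\<exists>k. i \<in> {1..M k})" for i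
  proof
    assume i: "i \<in> indices n"
    show "\<exists>k. i \<in> {1..M k}"
    proof (rule ccontr)
      assume "\<nexists>k. i \<in> {1..M k}"
      then have none: "i \<notin> {1..M k}" for k by blast
      have i1: "1 \<le> i" "enat i \<le> n" using i by (simp_all add: indices_def)
      have "M k \<le> i - 1" for k using none [of k] i1(1) by auto
      then have "n \<le> enat (i - 1)" unfolding n_def by (intro SUP_least) simp
      then have "enat i \<le> enat (i - 1)" using i1(2) by (rule order_trans [rotated])
      then show False using i1(1) by simp
    qed
  next
    assume "\<exists>k. i \<in> {1..M k}"
    then obtain k where "i \<in> {1..M k}" by blast
    moreover have "enat (M k) \<le> n" unfolding n_def by (rule SUP_upper) simp
    ultimately show "i \<in> indices n" by (auto simp: indices_def intro: order_trans [of _ "enat (M k)"])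
  qed
  have "run (pattern ` \<Gamma>) S T n \<alpha>' \<Psi>'"
    unfolding run_def
  proof (intro conjI ballI impI)
    have "enat (M 0) \<le> n" unfolding n_def by (rule SUP_upper) simp
    moreover have "enat (card S) \<le> enat (M 0)" using R [of 0] unfolding prerun_def by blast
    ultimately show "enat (card S) \<le> n" by (rule order_trans [rotated])
    have le: "card S \<le> M 0" "bij_betw (A 0) {1..card S} S" using R [of 0] by (auto simp: prerun_def)
    then show "bij_betw \<alpha>' {1..card S} S"
      using agree [of _ 0] by (subst bij_betw_cong [of _ _ "A 0"]) auto
    show "\<alpha>' ` indices n = T"
    proof
      show "\<alpha>' ` indices n \<subseteq> T"
      proof
        fix x assume "x \<in> \<alpha>' ` indices n"
        then obtain i k where "i \<in> {1..M k}" "x = \<alpha>' i" using idx by blast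
        then show "x \<in> T" using agree [of i k] R [of k] by (auto simp: prerun_def indices_enat)
      qed
      show "T \<subseteq> \<alpha>' ` indices n"
      proof
        fix x assume "x \<in> T"
        then obtain k where "x = ?pt k" using from_nat_into_surj [OF countable_points] by metis
        then obtain i where "i \<in> {1..M (Suc k)}" "x = A (Suc k) i" using H [of k] by blast
        then show "x \<in> \<alpha>' ` indices n" using agree [of i "Suc k"] idx by (intro image_eqI [of _ _ i]) auto
      qed
    qed
    fix i assume i: "i \<in> indices n" "card S < i"
    then obtain k where k: "i \<in> {1..M k}" using idx by blast
    have old: "B k i \<subseteq> {1..i}" "i \<in> B k i" "inj_on (A k) (B k i)" "A k ` B k i \<in> copies (pattern ` \<Gamma>)"
      using R [of k] k i(2) unfolding prerun_def indices_enat by auto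
    have \<Psi>: "\<Psi>' i = B k i" using agree [OF k] i(2) by blast
    have \<alpha>: "\<alpha>' j = A k j" if "j \<in> B k i" for j
      using agree [of j k] that old(1) k by auto
    show "\<Psi>' i \<subseteq> {1..i}" "i \<in> \<Psi>' i" using old by (simp_all add: \<Psi>)
    have "inj_on \<alpha>' (B k i) \<longleftrightarrow> inj_on (A k) (B k i)" by (rule inj_on_cong [OF \<alpha>])
    then show "inj_on \<alpha>' (\<Psi>' i)" using old(3) by (simp add: \<Psi>)
    have "\<alpha>' ` B k i = A k ` B k i" by (rule image_cong [OF refl \<alpha>])
    then show "\<alpha>' ` \<Psi>' i \<in> copies (pattern ` \<Gamma>)" using old(4) by (simp add: \<Psi>)
  qed
  moreover have "enat m \<le> n" using SUP_upper [of 0 UNIV "\<lambda>k. enat (M k)"] \<sigma>(1) s [of 0] by (simp add: n_def)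
  moreover have "\<forall>i\<in>{1..m}. \<alpha>' i = \<alpha> i \<and> (card S < i \<longrightarrow> \<Psi>' i = \<Psi> i)"
    using agree [of _ 0] \<sigma>(1) s [of 0] by simp
  ultimately show ?thesis by blast
qed

text \<open>All values u b are realised in one finite computation, the questionable step is
  appended, and the sequence is completed to a run. Properness gives this run a computation, which
  by uniqueness has the values u b at the chosen indices.\<close>

lemma proper_over_imp_derivation_proper:
  assumes "proper_over \<Gamma> T" "finite S" "percolating_seed (pattern ` \<Gamma>) S T" "bij_betw \<eta> S {1..card S}"
  shows "derivation_proper \<Gamma> S \<eta> T"
  unfolding derivation_proper_def
proof (intro ballI allI impI)
  fix P t a u
  assume P: "P \<in> \<Gamma>" "shift t (pattern P) \<subseteq> T" "a \<in> pattern P"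
    and u: "\<forall>b\<in>pattern P - {a}. derivable \<Gamma> S \<eta> T (b + t) (u b)"
  have S: "S \<subseteq> T" "T \<subseteq> occupied (pattern ` \<Gamma>) S T" using assms(3) by (auto simp: percolating_seed_def)
  have reach: "finite B \<Longrightarrow> B \<subseteq> pattern P - {a} \<Longrightarrow> \<exists>m \<alpha> \<Psi> \<xi>. prerun (pattern ` \<Gamma>) S T (enat m) \<alpha> \<Psi> \<and>
      free_computation \<Gamma> (card S) \<eta> (enat m) \<alpha> \<Psi> \<xi> \<and> (\<forall>b\<in>B. \<exists>i\<in>{1..m}. \<alpha> i = b + t \<and> \<xi> i = u b)" for B
  proof (induction B rule: finite_induct)
    case empty
    obtain \<alpha> \<Psi> \<xi> where "prerun (pattern ` \<Gamma>) S T (enat (card S)) \<alpha> \<Psi>"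
      "free_computation \<Gamma> (card S) \<eta> (enat (card S)) \<alpha> \<Psi> \<xi>"
      by (rule initial_prerun [OF assms(2) S(1)])
    then show ?case by blast
  next
    case (insert b B)
    then have "B \<subseteq> pattern P - {a}" by simp
    from insert.IH [OF this] obtain m1 \<alpha>1 \<Psi>1 \<xi>1 where 1: "prerun (pattern ` \<Gamma>) S T (enat m1) \<alpha>1 \<Psi>1"
      "free_computation \<Gamma> (card S) \<eta> (enat m1) \<alpha>1 \<Psi>1 \<xi>1"
      "\<forall>b\<in>B. \<exists>i\<in>{1..m1}. \<alpha>1 i = b + t \<and> \<xi>1 i = u b"
        by (elim exE conjE) (rule that)
    have "derivable \<Gamma> S \<eta> T (b + t) (u b)" using u insert.prems by blast
    from prerun_reach_value [OF this 1(1,2)] obtain m2 \<alpha>2 \<Psi>2 \<xi>2 where 2: "prerun (pattern ` \<Gamma>) S T (enat m2) \<alpha>2 \<Psi>2"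
      "free_computation \<Gamma> (card S) \<eta> (enat m2) \<alpha>2 \<Psi>2 \<xi>2"
      "extends S m1 \<alpha>1 \<Psi>1 m2 \<alpha>2 \<Psi>2" "\<forall>i\<in>{1..m1}. \<xi>2 i = \<xi>1 i"
      "\<exists>i\<in>{1..m2}. \<alpha>2 i = b + t \<and> \<xi>2 i = u b"
        by (elim exE conjE) (rule that)
    have "\<exists>i\<in>{1..m2}. \<alpha>2 i = c + t \<and> \<xi>2 i = u c" if "c \<in> B" for c
    proof -
      from bspec [OF 1(3) that] obtain i where "i \<in> {1..m1}" "\<alpha>1 i = c + t" "\<xi>1 i = u c"
        by (elim bexE conjE)
      then show ?thesis using 2(3,4) by (intro bexI [of _ i]) (auto simp: extends_def)
    qed
    then have "\<forall>c\<in>insert b B. \<exists>i\<in>{1..m2}. \<alpha>2 i = c + t \<and> \<xi>2 i = u c"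
      using 2(5) by (intro ballI) (elim insertE, simp_all)
    then show ?case
      by (intro exI [of _ m2] exI [of _ \<alpha>2] exI [of _ \<Psi>2] exI [of _ \<xi>2] conjI 2(1,2))
  qed
  have "finite (pattern P - {a})" by (simp add: finite_pattern)
  from reach [OF this subset_refl] obtain m \<alpha> \<Psi> \<xi> where 1: "prerun (pattern ` \<Gamma>) S T (enat m) \<alpha> \<Psi>"
    "free_computation \<Gamma> (card S) \<eta> (enat m) \<alpha> \<Psi> \<xi>"
    "\<forall>b\<in>pattern P - {a}. \<exists>i\<in>{1..m}. \<alpha> i = b + t \<and> \<xi> i = u b"
        by (elim exE conjE) (rule that)
  from 1(3) obtain j where
    j: "\<And>b. b \<in> pattern P - {a} \<Longrightarrow> j b \<in> {1..m} \<and> \<alpha> (j b) = b + t \<and> \<xi> (j b) = u b" by metis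
  then have j': "j b \<in> {1..m} \<and> \<alpha> (j b) = b + t" if "b \<in> pattern P - {a}" for b using that by blast
  define \<alpha>2 where "\<alpha>2 = \<alpha>(Suc m := a + t)"
  define \<Psi>2 where "\<Psi>2 = \<Psi>(Suc m := insert (Suc m) (j ` (pattern P - {a})))"
  \<comment> \<open>Only the sequence is extended here: a value for the new point would presuppose
    the nonzero denominator.\<close>
  have run2: "prerun (pattern ` \<Gamma>) S T (enat (Suc m)) \<alpha>2 \<Psi>2"
    by (rule prerun_step(1) [OF 1(1) P j' \<alpha>2_def \<Psi>2_def])
  obtain n \<alpha>3 \<Psi>3 where 3: "run (pattern ` \<Gamma>) S T n \<alpha>3 \<Psi>3" "enat (Suc m) \<le> n"
    "\<forall>i\<in>{1..Suc m}. \<alpha>3 i = \<alpha>2 i \<and> (card S < i \<longrightarrow> \<Psi>3 i = \<Psi>2 i)"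
    using complete_prerun [OF S(2) run2] by blast
  then obtain \<xi>3 where \<xi>3: "free_computation \<Gamma> (card S) \<eta> n \<alpha>3 \<Psi>3 \<xi>3"
    using assms unfolding proper_over_def by blast
  have run3: "prerun (pattern ` \<Gamma>) S T n \<alpha>3 \<Psi>3" using 3(1) by (simp add: run_iff_prerun)
  have m: "card S \<le> m" using 1(1) by (simp add: prerun_def)
  have eq: "\<xi>3 i = \<xi> i" if "i \<in> {1..m}" for i
  proof (rule free_computation_unique [OF 1(1) run3 _ _ _ 1(2) \<xi>3])
    show "enat m \<le> n" using 3(2) by (rule order_trans [rotated]) simp
  qed (use that 3(3) in \<open>auto simp: indices_enat \<alpha>2_def \<Psi>2_def\<close>)
  have idx: "Suc m \<in> indices n" using 3(2) by (simp add: indices_def)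
  have "step_ok \<Gamma> (card S) \<eta> \<alpha>3 \<Psi>3 \<xi>3 (Suc m)"
    using \<xi>3 idx by (simp add: free_computation_iff)
  then have "step_ok \<Gamma> (card S) \<eta> \<alpha>2 \<Psi>2 \<xi>3 (Suc m) \<longleftrightarrow> \<xi>3 (Suc m) = \<xi>3 (Suc m)"
    by (intro step_ok_cong [OF run3 run2 idx]) (use 3(3) m in \<open>auto simp: indices_enat\<close>)
  then have "step_ok \<Gamma> (card S) \<eta> \<alpha>2 \<Psi>2 \<xi>3 (Suc m)" by simp
  moreover have "u b = \<xi>3 (j b)" if "b \<in> pattern P - {a}" for b using j [OF that] eq by auto
  ultimately show "den_at P a u \<noteq> 0"
    using step_ok_new [OF 1(1) P j' \<alpha>2_def \<Psi>2_def, of u \<xi>3 \<eta>] by blast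
qed

text \<open>Both derivations are replayed in a single run, where the two values become values of a
  repeated point.\<close>

lemma consistent_from_imp_derivation_consistent:
  assumes "consistent_from \<Gamma> S T" "bij_betw \<eta> S {1..card S}"
  shows "derivation_consistent \<Gamma> S \<eta> T"
  unfolding derivation_consistent_def
proof (intro allI impI)
  fix a x y assume xy: "derivable \<Gamma> S \<eta> T a x" "derivable \<Gamma> S \<eta> T a y"
  have S: "finite S" "S \<subseteq> T" "T \<subseteq> occupied (pattern ` \<Gamma>) S T"
    using assms(1) by (auto simp: consistent_from_def percolating_seed_def)
  obtain \<alpha> \<Psi> \<xi> where 0: "prerun (pattern ` \<Gamma>) S T (enat (card S)) \<alpha> \<Psi>"
    "free_computation \<Gamma> (card S) \<eta> (enat (card S)) \<alpha> \<Psi> \<xi>"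
    by (rule initial_prerun [OF S(1,2)])
  from prerun_reach_value [OF xy(1) 0] obtain m1 \<alpha>1 \<Psi>1 \<xi>1 i where 1:
    "prerun (pattern ` \<Gamma>) S T (enat m1) \<alpha>1 \<Psi>1" "free_computation \<Gamma> (card S) \<eta> (enat m1) \<alpha>1 \<Psi>1 \<xi>1"
    "i \<in> {1..m1}" "\<alpha>1 i = a" "\<xi>1 i = x" by blast
  from prerun_reach_value [OF xy(2) 1(1,2)] obtain m2 \<alpha>2 \<Psi>2 \<xi>2 j where 2:
    "prerun (pattern ` \<Gamma>) S T (enat m2) \<alpha>2 \<Psi>2" "free_computation \<Gamma> (card S) \<eta> (enat m2) \<alpha>2 \<Psi>2 \<xi>2"
    "extends S m1 \<alpha>1 \<Psi>1 m2 \<alpha>2 \<Psi>2" "\<forall>i\<in>{1..m1}. \<xi>2 i = \<xi>1 i"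
    "j \<in> {1..m2}" "\<alpha>2 j = a" "\<xi>2 j = y" by blast
  have i2: "i \<in> {1..m2}" "\<alpha>2 i = a" "\<xi>2 i = x" using 1(3-5) 2(3,4) by (auto simp: extends_def)
  obtain n \<alpha>3 \<Psi>3 where 3: "run (pattern ` \<Gamma>) S T n \<alpha>3 \<Psi>3" "enat m2 \<le> n"
    "\<forall>i\<in>{1..m2}. \<alpha>3 i = \<alpha>2 i \<and> (card S < i \<longrightarrow> \<Psi>3 i = \<Psi>2 i)"
    using complete_prerun [OF S(3) 2(1)] by blast
  then obtain \<xi>3 where \<xi>3: "free_computation \<Gamma> (card S) \<eta> n \<alpha>3 \<Psi>3 \<xi>3"
    using assms unfolding consistent_from_def proper_over_def by blast
  have "prerun (pattern ` \<Gamma>) S T n \<alpha>3 \<Psi>3" using 3(1) by (simp add: run_iff_prerun)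
  then have "\<xi>3 k = \<xi>2 k" if "k \<in> {1..m2}" for k
    using free_computation_unique [OF 2(1) _ 3(2) _ _ 2(2) \<xi>3, of k] 3(3) that by (simp add: indices_enat)
  moreover have "i \<in> indices n" "j \<in> indices n"
    using i2(1) 2(5) indices_mono [OF 3(2)] by (auto simp: indices_enat)
  then have "\<xi>3 i = \<xi>3 j"
    using assms 3 \<xi>3 i2 2(5,6) unfolding consistent_from_def by metis
  ultimately show "x = y" using i2 2(5,7) by metis
qed

lemma free_computation_derivable:
  assumes run: "prerun (pattern ` \<Gamma>) S T n \<alpha> \<Psi>"
    and fc: "free_computation \<Gamma> (card S) \<eta> n \<alpha> \<Psi> \<xi>" and i: "i \<in> indices n"
  shows "derivable \<Gamma> S \<eta> T (\<alpha> i) (\<xi> i)"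
  using i
proof (induction i rule: less_induct)
  case (less i)
  have ok: "step_ok \<Gamma> (card S) \<eta> \<alpha> \<Psi> \<xi> i" using fc less.prems by (simp add: free_computation_iff)
  show ?case
  proof (cases "i \<le> card S")
    case True
    then have "i \<in> {1..card S}" using less.prems by (simp add: indices_def)
    then have "\<alpha> i \<in> S" using run by (auto simp: prerun_def bij_betw_def)
    moreover have "\<xi> i = rat_indet (\<eta> (\<alpha> i))" using ok True by (simp add: step_ok_def)
    ultimately show ?thesis by (simp add: derivable.seed)
  next
    case False
    then have less': "card S < i" by simp
    obtain P t a where P: "P \<in> \<Gamma>" "a \<in> pattern P" "\<alpha> i = a + t" "\<alpha> ` \<Psi> i = shift t (pattern P)"
      "shift t (pattern P) \<subseteq> T" "\<Psi> i \<subseteq> {1..i}" "i \<in> \<Psi> i" "inj_on \<alpha> (\<Psi> i)"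
      and ex: "\<And>b. b \<in> pattern P - {a} \<Longrightarrow> \<exists>j\<in>\<Psi> i - {i}. \<alpha> j = b + t"
      using step_data [OF run less.prems less'] by metis
    define u where "u b = \<xi> (inv_into (\<Psi> i) \<alpha> (b + t))" for b
    have u: "u (\<alpha> j - t) = \<xi> j" if "j \<in> \<Psi> i - {i}" for j
      using that P(8) by (simp add: u_def)
    have val: "den_at P a u \<noteq> 0 \<and> \<xi> i = - num_at P a u / den_at P a u"
      using step_ok_iff [of "card S" i \<Psi> \<alpha> P a t u \<xi> \<eta>, OF less' P(7,8,1-4) u] ok by blast
    have "derivable \<Gamma> S \<eta> T (b + t) (u b)" if b: "b \<in> pattern P - {a}" for b
    proof -
      obtain j where j: "j \<in> \<Psi> i - {i}" "\<alpha> j = b + t" using ex [OF b] by blast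
      then have "j < i" "j \<in> indices n"
        using P(6) indices_down [OF less.prems, of j] by force+
      then show ?thesis using less.IH [of j] u [OF j(1)] j(2) by simp
    qed
    then show ?thesis
      unfolding P(3) using val derivable.step [OF P(1,5,2)] by metis
  qed
qed

text \<open>Finite computations are built step by step, each denominator being nonzero because the
  values used so far are derivable. Uniqueness makes them fit together for infinite runs.\<close>

lemma free_computation_exists:
  assumes run: "prerun (pattern ` \<Gamma>) S T n \<alpha> \<Psi>" and proper: "derivation_proper \<Gamma> S \<eta> T"
  shows "\<exists>\<xi>. free_computation \<Gamma> (card S) \<eta> n \<alpha> \<Psi> \<xi>"
proof -
  have "\<exists>\<xi>. free_computation \<Gamma> (card S) \<eta> (enat m) \<alpha> \<Psi> \<xi>" if "card S \<le> m" "enat m \<le> n" for m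
    using that
  proof (induction m rule: dec_induct)
    case base
    have "free_computation \<Gamma> (card S) \<eta> (enat (card S)) \<alpha> \<Psi> (\<lambda>i. rat_indet (\<eta> (\<alpha> i)))"
      by (auto simp: free_computation_iff indices_enat step_ok_def)
    then show ?case by blast
  next
    case (step m)
    have mn: "enat m \<le> n" using step.prems by (rule order_trans [rotated]) simp
    obtain \<xi> where \<xi>: "free_computation \<Gamma> (card S) \<eta> (enat m) \<alpha> \<Psi> \<xi>" using step.IH mn by blast
    have runm: "prerun (pattern ` \<Gamma>) S T (enat m) \<alpha> \<Psi>" by (rule prerun_restrict [OF run step.hyps(1) mn])
    have idx: "Suc m \<in> indices n" using step.prems by (simp add: indices_def)
    have less: "card S < Suc m" using step.hyps by simp
    obtain P t a where P: "P \<in> \<Gamma>" "a \<in> pattern P" "\<alpha> (Suc m) = a + t" "\<alpha> ` \<Psi> (Suc m) = shift t (pattern P)"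
      "shift t (pattern P) \<subseteq> T" "\<Psi> (Suc m) \<subseteq> {1..Suc m}" "Suc m \<in> \<Psi> (Suc m)" "inj_on \<alpha> (\<Psi> (Suc m))"
      and ex: "\<And>b. b \<in> pattern P - {a} \<Longrightarrow> \<exists>j\<in>\<Psi> (Suc m) - {Suc m}. \<alpha> j = b + t"
      using step_data [OF run idx less] by metis
    define u where "u b = \<xi> (inv_into (\<Psi> (Suc m)) \<alpha> (b + t))" for b
    have u: "u (\<alpha> j - t) = \<xi> j" if "j \<in> \<Psi> (Suc m) - {Suc m}" for j
      using that P(8) by (simp add: u_def)
    have "derivable \<Gamma> S \<eta> T (b + t) (u b)" if b: "b \<in> pattern P - {a}" for b
    proof -
      obtain j where j: "j \<in> \<Psi> (Suc m) - {Suc m}" "\<alpha> j = b + t" using ex [OF b] by blast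
      then have "j \<in> indices (enat m)" using P(6) by (force simp: indices_enat)
      then show ?thesis using free_computation_derivable [OF runm \<xi>] u [OF j(1)] j(2) by force
    qed
    then have den: "den_at P a u \<noteq> 0"
      using proper P(1,2,5) unfolding derivation_proper_def by blast
    define \<xi>' where "\<xi>' = \<xi>(Suc m := - num_at P a u / den_at P a u)"
    have u': "u (\<alpha> j - t) = \<xi>' j" if "j \<in> \<Psi> (Suc m) - {Suc m}" for j
      using u [OF that] that by (simp add: \<xi>'_def)
    have "step_ok \<Gamma> (card S) \<eta> \<alpha> \<Psi> \<xi>' (Suc m)"
      using step_ok_iff [of "card S" "Suc m" \<Psi> \<alpha> P a t u \<xi>' \<eta>, OF less P(7,8,1-4) u'] den
      by (simp add: \<xi>'_def)
    moreover have "step_ok \<Gamma> (card S) \<eta> \<alpha> \<Psi> \<xi>' i" if i: "i \<in> {1..m}" for i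
    proof -
      have "step_ok \<Gamma> (card S) \<eta> \<alpha> \<Psi> \<xi> i" using \<xi> i by (simp add: free_computation_iff indices_enat)
      then have "step_ok \<Gamma> (card S) \<eta> \<alpha> \<Psi> \<xi>' i \<longleftrightarrow> \<xi>' i = \<xi> i"
        by (intro step_ok_cong [OF runm runm]) (use i in \<open>auto simp: indices_enat \<xi>'_def\<close>)
      then show ?thesis using i by (simp add: \<xi>'_def)
    qed
    ultimately show ?case
      by (intro exI [of _ \<xi>']) (auto simp: free_computation_iff indices_enat atLeastAtMostSuc_conv)
  qed
  then obtain \<Xi> where \<Xi>: "\<And>m. card S \<le> m \<Longrightarrow> enat m \<le> n \<Longrightarrow> free_computation \<Gamma> (card S) \<eta> (enat m) \<alpha> \<Psi> (\<Xi> m)"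
    by metis
  \<comment> \<open>Diagonal choice; the maximum is there because the finite computations are
    available from length \<open>card S\<close> on.\<close>
  define \<xi> where "\<xi> i = \<Xi> (max i (card S)) i" for i
  have "step_ok \<Gamma> (card S) \<eta> \<alpha> \<Psi> \<xi> i" if i: "i \<in> indices n" for i
  proof -
    let ?m = "max i (card S)"
    have runk: "prerun (pattern ` \<Gamma>) S T (enat (max k (card S))) \<alpha> \<Psi>"
      "free_computation \<Gamma> (card S) \<eta> (enat (max k (card S))) \<alpha> \<Psi> (\<Xi> (max k (card S)))" if "k \<le> i" for k
    proof -
      have "enat i \<le> n" "enat (card S) \<le> n" using i run by (simp_all add: indices_def prerun_def)
      then have "enat (max k (card S)) \<le> n" using that by (auto simp: max_def intro: order_trans [of _ "enat i"])
      then show "prerun (pattern ` \<Gamma>) S T (enat (max k (card S))) \<alpha> \<Psi>"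
        "free_computation \<Gamma> (card S) \<eta> (enat (max k (card S))) \<alpha> \<Psi> (\<Xi> (max k (card S)))"
        using prerun_restrict [OF run] \<Xi> by simp_all
    qed
    have eq: "\<xi> k = \<Xi> ?m k" if "k \<in> {1..i}" for k
    proof -
      have "\<Xi> ?m k = \<Xi> (max k (card S)) k"
        by (rule free_computation_unique [OF runk(1) runk(1) _ _ _ runk(2) runk(2)])
           (use that in \<open>auto simp: indices_enat\<close>)
      then show ?thesis by (simp add: \<xi>_def)
    qed
    have i1: "i \<in> {1..i}" "i \<in> indices (enat ?m)" using i by (auto simp: indices_def)
    then have "step_ok \<Gamma> (card S) \<eta> \<alpha> \<Psi> (\<Xi> ?m) i" using runk(2) [of i] by (simp add: free_computation_iff)
    then have "step_ok \<Gamma> (card S) \<eta> \<alpha> \<Psi> \<xi> i \<longleftrightarrow> \<xi> i = \<Xi> ?m i"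
      using eq i1(2) by (intro step_ok_cong [OF runk(1) runk(1)]) auto
    then show ?thesis using eq i1(1) by blast
  qed
  then show ?thesis by (intro exI [of _ \<xi>]) (simp add: free_computation_iff)
qed

lemma proper_overI:
  assumes "\<And>S \<eta>. finite S \<Longrightarrow> percolating_seed (pattern ` \<Gamma>) S T \<Longrightarrow> bij_betw \<eta> S {1..card S} \<Longrightarrow>
    derivation_proper \<Gamma> S \<eta> T"
  shows "proper_over \<Gamma> T"
  unfolding proper_over_def
  using ml assms free_computation_exists by (auto simp: run_iff_prerun)

lemma consistent_fromI:
  assumes "proper_over \<Gamma> T" "finite S" "percolating_seed (pattern ` \<Gamma>) S T"
    and "\<And>\<eta>. bij_betw \<eta> S {1..card S} \<Longrightarrow> derivation_consistent \<Gamma> S \<eta> T"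
  shows "consistent_from \<Gamma> S T"
  unfolding consistent_from_def
proof (intro conjI assms(1-3) allI impI ballI)
  fix \<eta> n \<alpha> \<Psi> \<xi> i j
  assume *: "bij_betw \<eta> S {1..card S} \<and> run (pattern ` \<Gamma>) S T n \<alpha> \<Psi> \<and> free_computation \<Gamma> (card S) \<eta> n \<alpha> \<Psi> \<xi>"
    and ij: "i \<in> indices n" "j \<in> indices n" "\<alpha> i = \<alpha> j"
  then have run: "prerun (pattern ` \<Gamma>) S T n \<alpha> \<Psi>" and fc: "free_computation \<Gamma> (card S) \<eta> n \<alpha> \<Psi> \<xi>"
    by (simp_all add: run_iff_prerun)
  have "derivable \<Gamma> S \<eta> T (\<alpha> k) (\<xi> k)" if "k \<in> indices n" for k
    by (rule free_computation_derivable [OF run fc that])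
  then have "derivable \<Gamma> S \<eta> T (\<alpha> i) (\<xi> i)" "derivable \<Gamma> S \<eta> T (\<alpha> i) (\<xi> j)" using ij by force+
  then show "\<xi> i = \<xi> j" using assms(4) * unfolding derivation_consistent_def by blast
qed

text \<open>Adding S0 to the seed makes it percolate the plane, where properness is assumed.
  Derivations from S inside T remain derivations from the larger seed.\<close>

lemma derivation_proper_region:
  assumes proper: "proper_over \<Gamma> UNIV" and S0: "finite S0" "percolating_seed (pattern ` \<Gamma>) S0 UNIV"
    and S: "finite S" "percolating_seed (pattern ` \<Gamma>) S T" "bij_betw \<eta> S {1..card S}"
  shows "derivation_proper \<Gamma> S \<eta> T"
proof -
  let ?S = "S \<union> S0"
  obtain \<eta>' where \<eta>': "bij_betw \<eta>' ?S {1..card ?S}" "\<And>s. s \<in> S \<Longrightarrow> \<eta>' s = \<eta> s"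
    using extend_bijection [of ?S S \<eta>] S S0(1) by auto
  have "percolating_seed (pattern ` \<Gamma>) ?S UNIV"
    using S0(2) occupied_mono [of S0 ?S UNIV UNIV] by (intro percolating_seedI) (auto simp: percolating_seed_def)
  then have "derivation_proper \<Gamma> ?S \<eta>' UNIV"
    using S(1) S0(1) by (intro proper_over_imp_derivation_proper [OF proper _ _ \<eta>'(1)]) auto
  then show ?thesis by (rule derivation_proper_mono) (use \<eta>'(2) in auto)
qed

section \<open>Solutions on a region and specialisation to them\<close>

lemma derivable_exists:
  assumes "derivation_proper \<Gamma> S \<eta> T" "a \<in> occupied (pattern ` \<Gamma>) S T"
  shows "\<exists>x. derivable \<Gamma> S \<eta> T a x"
  using assms(2)
proof (induction rule: occupied.induct)
  case (seed a)
  then show ?case using derivable.seed by blast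
next
  case (step D a)
  obtain P t where P: "P \<in> \<Gamma>" "D = shift t (pattern P)" using step.hyps(1) by (auto simp: copies_def)
  obtain b where b: "b \<in> pattern P" "a = b + t" using step.hyps(3) P(2) by blast
  have "\<exists>x. derivable \<Gamma> S \<eta> T (c + t) x" if "c \<in> pattern P - {b}" for c
    using step.IH [of "c + t"] that b(2) P(2) by auto
  then obtain u where u: "\<And>c. c \<in> pattern P - {b} \<Longrightarrow> derivable \<Gamma> S \<eta> T (c + t) (u c)" by metis
  then have "den_at P b u \<noteq> 0"
    using assms(1) P b(1) step.hyps(2) unfolding derivation_proper_def by blast
  then show ?case
    unfolding b(2) using derivable.step [OF P(1) step.hyps(2) [unfolded P(2)] b(1) u] by blast
qed

text \<open>Nonzero denominators are demanded at every point of every copy, so that a computation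
  specialised to these values can solve for any point.\<close>

definition solution :: "(int ^ 'd) set \<Rightarrow> (int ^ 'd \<Rightarrow> 'a ratfun) \<Rightarrow> bool" where
  "solution T v \<longleftrightarrow> (\<forall>P\<in>\<Gamma>. \<forall>t. shift t (pattern P) \<subseteq> T \<longrightarrow>
     (\<forall>a\<in>pattern P. den_at P a (\<lambda>b. v (b + t)) \<noteq> 0 \<and>
        v (a + t) = - num_at P a (\<lambda>b. v (b + t)) / den_at P a (\<lambda>b. v (b + t))))"

lemma solution_exists:
  assumes "derivation_proper \<Gamma> S \<eta> T" "percolating_seed (pattern ` \<Gamma>) S T" "derivation_consistent \<Gamma> S \<eta> T"
  obtains v where "\<And>a. a \<in> T \<Longrightarrow> derivable \<Gamma> S \<eta> T a (v a)" "solution T v"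
proof -
  have "\<forall>a\<in>T. \<exists>x. derivable \<Gamma> S \<eta> T a x"
    using derivable_exists [OF assms(1)] assms(2) unfolding percolating_seed_def by blast
  then obtain v where v: "\<And>a. a \<in> T \<Longrightarrow> derivable \<Gamma> S \<eta> T a (v a)" by metis
  have "solution T v"
    unfolding solution_def
  proof (intro ballI allI impI)
    fix P t a assume P: "P \<in> \<Gamma>" "shift t (pattern P) \<subseteq> T" "a \<in> pattern P"
    let ?u = "\<lambda>b. v (b + t)"
    have u: "derivable \<Gamma> S \<eta> T (b + t) (?u b)" if "b \<in> pattern P" for b using v that P(2) by blast
    have den: "den_at P a ?u \<noteq> 0"
      by (rule assms(1) [unfolded derivation_proper_def, rule_format, OF P]) (use u in simp)
    moreover have "derivable \<Gamma> S \<eta> T (a + t) (- num_at P a ?u / den_at P a ?u)"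
      by (rule derivable.step [OF P u den]) simp
    ultimately show "den_at P a ?u \<noteq> 0 \<and> v (a + t) = - num_at P a ?u / den_at P a ?u"
      using assms(3) [unfolded derivation_consistent_def, rule_format, OF u [OF P(3)]] by simp
  qed
  then show thesis using that v by blast
qed

text \<open>Replace the indeterminates of the seed by the values of a solution on its translate by
  g. No denominator of the computation vanishes there, and each step reproduces the
  solution.\<close>

lemma derivable_specialises:
  assumes "derivable \<Gamma> S \<eta> T a x" "solution (shift g T) v" "\<And>s. s \<in> S \<Longrightarrow> \<sigma> (\<eta> s) = v (s + g)"
  shows "specialises (\<eta> ` S) \<sigma> x (v (a + g))"
  using assms(1)
proof (induction rule: derivable.induct)
  case (seed a)
  then show ?case using specialises_indet [of "\<eta> a" "\<eta> ` S" \<sigma>] assms(3) by simp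
next
  case (step P t a u)
  let ?w = "\<lambda>b. v (b + (t + g))"
  have "shift (t + g) (pattern P) \<subseteq> shift g T"
  proof
    fix x assume "x \<in> shift (t + g) (pattern P)"
    then obtain b where "b \<in> pattern P" "x = (b + t) + g" by (auto simp: add.assoc)
    then show "x \<in> shift g T" using step.hyps(2) by blast
  qed
  then have sol: "den_at P a ?w \<noteq> 0" "v (a + (t + g)) = - num_at P a ?w / den_at P a ?w"
    using assms(2) step.hyps(1,3) unfolding solution_def by blast+
  have sp: "specialises (\<eta> ` S) \<sigma> (u b) (?w b)" if "b \<in> pattern P - {a}" for b
    using step.IH [OF that] by (simp add: add.assoc)
  note nd = num_denom_props [OF step.hyps(3) deg [OF step.hyps(1,3)]]
  have "specialises (\<eta> ` S) \<sigma> (num_at P a u) (num_at P a ?w)"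
    "specialises (\<eta> ` S) \<sigma> (den_at P a u) (den_at P a ?w)"
    unfolding num_at_def den_at_def by (rule specialises_eval, rule sp, use nd in blast)+
  then have "specialises (\<eta> ` S) \<sigma> (- num_at P a u / den_at P a u) (v (a + (t + g)))"
    unfolding sol(2) by (intro specialises_divide specialises_uminus sol(1))
  then show ?case by (simp add: add.assoc)
qed

end

section \<open>Extending solutions\<close>

context difference_system
begin

lemma same_pattern: "P \<in> \<Gamma> \<Longrightarrow> Q \<in> \<Gamma> \<Longrightarrow> pattern P = pattern Q \<Longrightarrow> P = Q"
proof (rule ccontr)
  assume P: "P \<in> \<Gamma>" "Q \<in> \<Gamma>" "P \<noteq> Q" and eq: "pattern P = pattern Q"
  have "\<forall>P\<in>\<Gamma>. \<forall>Q\<in>\<Gamma>. P \<noteq> Q \<longrightarrow> (\<forall>t. pattern P \<noteq> shift t (pattern Q))"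
    using pd unfolding pd_system_def by (rule conjunct2)
  from this [rule_format, OF P, of 0] show False using eq by simp
qed

lemma step_specialises:
  assumes "P \<in> \<Gamma>" "a \<in> pattern P" "\<And>b. b \<in> pattern P - {a} \<Longrightarrow> specialises V \<sigma> (u b) (w b)"
    and "den_at P a w \<noteq> 0"
  shows "specialises V \<sigma> (- num_at P a u / den_at P a u) (- num_at P a w / den_at P a w)"
proof -
  note nd = num_denom_props [OF assms(2) deg [OF assms(1,2)]]
  have "specialises V \<sigma> (num_at P a u) (num_at P a w)" "specialises V \<sigma> (den_at P a u) (den_at P a w)"
    unfolding num_at_def den_at_def by (rule specialises_eval, rule assms(3), use nd in blast)+
  then show ?thesis by (intro specialises_divide specialises_uminus assms(4))
qed

lemma solution_mono: "solution T v \<Longrightarrow> T' \<subseteq> T \<Longrightarrow> solution T' v"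
  unfolding solution_def by (intro ballI allI impI) (simp add: image_subset_iff subset_iff)

lemma solutionD:
  assumes "solution T v" "P \<in> \<Gamma>" "shift t (pattern P) \<subseteq> T" "a \<in> pattern P"
  shows "den_at P a (\<lambda>b. v (b + t)) \<noteq> 0"
    and "v (a + t) = - num_at P a (\<lambda>b. v (b + t)) / den_at P a (\<lambda>b. v (b + t))"
  using assms unfolding solution_def by simp_all

lemma derivable_value:
  assumes "derivable \<Gamma> S \<eta> T a x" "solution T v" "\<And>s. s \<in> S \<Longrightarrow> v s = rat_indet (\<eta> s)"
  shows "x = v a"
  using assms(1)
proof (induction rule: derivable.induct)
  case (seed a)
  then show ?case using assms(3) by simp
next
  case (step P t a u)
  have "num_at P a u = num_at P a (\<lambda>b. v (b + t))" "den_at P a u = den_at P a (\<lambda>b. v (b + t))"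
    using num_den_cong [OF step.hyps(1,3), of u "\<lambda>b. v (b + t)"] step.IH by auto
  then show ?case using solutionD(2) [OF assms(2) step.hyps(1-3)] by simp
qed

text \<open>Two values derived at a both specialise to v a, so the numerator of their difference
  vanishes at the values on S; by independence it is the zero polynomial.\<close>

lemma independent_imp_consistent:
  assumes "solution T v" "\<And>s. s \<in> S \<Longrightarrow> \<sigma> (\<eta> s) = v s"
    and indep: "\<And>p. pattern p \<subseteq> \<eta> ` S \<Longrightarrow> mpoly_eval rat_const \<sigma> p = 0 \<Longrightarrow> p = 0"
  shows "derivation_consistent \<Gamma> S \<eta> T"
  unfolding derivation_consistent_def
proof (intro allI impI)
  fix a x y assume "derivable \<Gamma> S \<eta> T a x" "derivable \<Gamma> S \<eta> T a y"
  then have xy: "specialises (\<eta> ` S) \<sigma> x (v a)" "specialises (\<eta> ` S) \<sigma> y (v a)"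
    using derivable_specialises [of S \<eta> T a _ 0 v \<sigma>] assms(1,2) by simp_all
  have "specialises (\<eta> ` S) \<sigma> (x + - y) (v a + - v a)"
    by (rule specialises_add [OF xy(1) specialises_uminus [OF xy(2)]])
  then obtain p q where "pattern p \<subseteq> \<eta> ` S" "mpoly_eval rat_const \<sigma> q \<noteq> 0" "x + - y = Fract p q"
    "v a + - v a = mpoly_eval rat_const \<sigma> p / mpoly_eval rat_const \<sigma> q"
    by (rule specialisesE)
  then show "x = y" using indep [of p] by (simp add: fract_collapse)
qed

text \<open>R percolates, so the \<open>card S\<close> indeterminates on S arise by specialising
  rational functions to the values on R. At most \<open>card S\<close> values can generate that many
  indeterminates only if they are independent.\<close>

lemma percolating_independent:
  assumes S: "bij_betw \<eta> S {1..card S}" "S \<subseteq> T" "\<And>s. s \<in> S \<Longrightarrow> v s = rat_indet (\<eta> s)" "solution T v"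
    and R: "finite R" "percolating_seed (pattern ` \<Gamma>) R T" "bij_betw \<rho> R {1..card R}" "derivation_proper \<Gamma> R \<rho> T"
    and card: "card R \<le> card S" and \<sigma>: "\<And>r. r \<in> R \<Longrightarrow> \<sigma> (\<rho> r) = v r"
    and p: "pattern p \<subseteq> \<rho> ` R" "mpoly_eval rat_const \<sigma> p = 0"
  shows "p = 0"
proof -
  have J: "finite (\<rho> ` R)" "card (\<rho> ` R) \<le> card S"
    using R(1,3) card by (simp_all add: bij_betw_def)
  have "\<exists>x. specialises (\<rho> ` R) \<sigma> x (rat_indet i)" if i: "i \<in> {1..card S}" for i
  proof -
    have "i \<in> \<eta> ` S" using S(1) i unfolding bij_betw_def by blast
    then obtain s where s: "s \<in> S" "i = \<eta> s" by (elim imageE)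
    then have "s \<in> occupied (pattern ` \<Gamma>) R T" using R(2) S(2) by (auto simp: percolating_seed_def)
    then obtain x where x: "derivable \<Gamma> R \<rho> T s x" using derivable_exists [OF R(4)] by blast
    have "specialises (\<rho> ` R) \<sigma> x (v s)"
      using derivable_specialises [OF x, of 0 v \<sigma>] S(4) \<sigma> by simp
    then show ?thesis using S(3) [OF s(1)] s(2) by auto
  qed
  then obtain r where "\<And>i. i \<in> {1..card S} \<Longrightarrow> specialises (\<rho> ` R) \<sigma> (r i) (rat_indet i)" by metis
  then show ?thesis by (rule algebraically_independent [OF J _ p])
qed

end

lemma (in pattern_pair) grows_trans:
  assumes "grows T S T' S'" "grows T' S' T'' S''"
  shows "grows T S T'' S''"
  using assms(2) by (induction rule: grows.induct) (use assms(1) in \<open>auto intro: grows.intros\<close>)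

section \<open>Consistency for two equations in the plane\<close>

locale pair_system = difference_system \<Gamma> + pattern_pair A B
  for \<Gamma> :: "(int ^ 2, 'a::field) mpoly set" and A B +
  fixes S0
  assumes patterns: "pattern ` \<Gamma> = {A, B}"
    and proper: "proper_over \<Gamma> UNIV"
    and S0: "finite S0" "percolating_seed {A, B} S0 UNIV"
begin

lemma proper_region:
  "finite S \<Longrightarrow> percolating_seed {A, B} S T \<Longrightarrow> bij_betw \<eta> S {1..card S} \<Longrightarrow> derivation_proper \<Gamma> S \<eta> T"
  by (rule derivation_proper_region [OF proper S0(1) S0(2) [folded patterns]]) (simp_all add: patterns)

lemma proper_over_region: "proper_over \<Gamma> T"
  by (rule proper_overI, rule proper_region) (simp_all add: patterns)

definition generic_solution ::
    "(int ^ 2) set \<Rightarrow> (int ^ 2) set \<Rightarrow> (int ^ 2 \<Rightarrow> nat) \<Rightarrow> (int ^ 2 \<Rightarrow> 'a ratfun) \<Rightarrow> bool" where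
  "generic_solution T S \<eta> v \<longleftrightarrow> finite S \<and> percolating_seed {A, B} S T \<and> bij_betw \<eta> S {1..card S} \<and>
     solution T v \<and> (\<forall>s\<in>S. v s = rat_indet (\<eta> s))"

lemma generic_solution_derivable:
  assumes "generic_solution T S \<eta> v" "a \<in> T"
  shows "derivable \<Gamma> S \<eta> T a (v a)"
proof -
  have "derivation_proper \<Gamma> S \<eta> T" "a \<in> occupied (pattern ` \<Gamma>) S T"
    using assms proper_region by (auto simp: generic_solution_def percolating_seed_def patterns)
  then obtain x where "derivable \<Gamma> S \<eta> T a x" using derivable_exists by blast
  moreover from this have "x = v a"
    by (rule derivable_value) (use assms(1) in \<open>auto simp: generic_solution_def\<close>)
  ultimately show ?thesis by simp
qed

lemma consistent_imp_generic_solution: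
  assumes "finite S" "percolating_seed {A, B} S T" "bij_betw \<eta> S {1..card S}" "derivation_consistent \<Gamma> S \<eta> T"
  shows "\<exists>v. generic_solution T S \<eta> v"
proof -
  obtain v where v: "\<And>a. a \<in> T \<Longrightarrow> derivable \<Gamma> S \<eta> T a (v a)" "solution T v"
    using solution_exists [OF proper_region [OF assms(1-3)] _ assms(4)] assms(2) unfolding patterns by blast
  have "v s = rat_indet (\<eta> s)" if "s \<in> S" for s
  proof -
    have "s \<in> T" using that assms(2) by (auto simp: percolating_seed_def)
    show ?thesis
      using assms(4) [unfolded derivation_consistent_def, rule_format, OF v(1) [OF \<open>s \<in> T\<close>] derivable.seed [OF that]] .
  qed
  then show ?thesis using assms v(2) by (auto simp: generic_solution_def)
qed

lemma pattern_cases: "P \<in> \<Gamma> \<Longrightarrow> pattern P = A \<or> pattern P = B"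
  using patterns by blast

text \<open>Percolating C without z lets the computation avoid z until the end; z can then be
  computed in each of two ways and the results compared over C.\<close>

definition corner_seed :: "int ^ 2 \<Rightarrow> (int ^ 2) set \<Rightarrow> bool" where
  "corner_seed z S \<longleftrightarrow> finite S \<and> percolating_seed {A, B} S (C - {z}) \<and> percolating_seed {A, B} S C"

lemma corner_seed_exists:
  assumes "exposed a b"
  obtains S where "corner_seed (a + b) S" "grows {} {} C S"
proof -
  obtain S where S: "grows {} {} (C - {a + b}) S" using grows_C_remove [OF assms] .
  have C: "grows {} {} C S" by (rule grows_C [OF assms S])
  show thesis
    using that [OF _ C] grows_percolating [OF S percolating_seed_empty]
      grows_percolating [OF C percolating_seed_empty] grows_subset [OF S]
    by (simp add: corner_seed_def)
qed

text \<open>Specialise the computation of \<open>a + b\<close> from a corner seed, carried out in the two possible ways.\<close>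

lemma corner_agreement:
  assumes S: "corner_seed (a + b) S" "bij_betw \<eta> S {1..card S}" "derivation_consistent \<Gamma> S \<eta> C"
    and v: "solution (shift g (C - {a + b})) v"
    and P: "P \<in> \<Gamma>" "pattern P = A" "a \<in> A" "den_at P a (\<lambda>x. v (x + (b + g))) \<noteq> 0"
    and Q: "Q \<in> \<Gamma>" "pattern Q = B" "b \<in> B" "den_at Q b (\<lambda>x. v (x + (a + g))) \<noteq> 0"
  shows "num_at P a (\<lambda>x. v (x + (b + g))) / den_at P a (\<lambda>x. v (x + (b + g))) =
    num_at Q b (\<lambda>x. v (x + (a + g))) / den_at Q b (\<lambda>x. v (x + (a + g)))"
proof -
  let ?C0 = "C - {a + b}"
  have finS: "finite S" and perc0: "percolating_seed {A, B} S ?C0" and perc: "percolating_seed {A, B} S C"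
    using S(1) by (auto simp: corner_seed_def)
  have "\<exists>x. derivable \<Gamma> S \<eta> ?C0 c x" if "c \<in> ?C0" for c
    using derivable_exists [OF proper_region [OF finS perc0 S(2)], of c] perc0 that
    by (simp add: percolating_seed_def patterns)
  then obtain x where x: "\<And>c. c \<in> ?C0 \<Longrightarrow> derivable \<Gamma> S \<eta> ?C0 c (x c)" by metis
  \<comment> \<open>Specialises the indeterminates of the corner seed to the given values on its
    translate by g.\<close>
  define \<sigma> where "\<sigma> k = v (inv_into S \<eta> k + g)" for k
  have \<sigma>: "\<sigma> (\<eta> s) = v (s + g)" if "s \<in> S" for s
    using that S(2) by (simp add: \<sigma>_def bij_betw_def)
  have sp: "specialises (\<eta> ` S) \<sigma> (x c) (v (c + g))" if "c \<in> ?C0" for c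
    by (rule derivable_specialises [OF x [OF that] v \<sigma>])
  have xC: "derivable \<Gamma> S \<eta> C c (x c)" if "c \<in> ?C0" for c
    by (rule derivable_mono [OF x [OF that]]) auto
  \<comment> \<open>One way of computing the corner, with e placed at a + b. It is used for P with h
    = b and for Q with h = a.\<close>
  have *: "derivable \<Gamma> S \<eta> C (a + b) (- num_at E e (\<lambda>y. x (y + h)) / den_at E e (\<lambda>y. x (y + h))) \<and>
      specialises (\<eta> ` S) \<sigma> (- num_at E e (\<lambda>y. x (y + h)) / den_at E e (\<lambda>y. x (y + h)))
        (- num_at E e (\<lambda>y. v (y + (h + g))) / den_at E e (\<lambda>y. v (y + (h + g))))"
    if E: "E \<in> \<Gamma>" "e \<in> pattern E" "e + h = a + b" "shift h (pattern E) \<subseteq> C" "den_at E e (\<lambda>y. v (y + (h + g))) \<noteq> 0"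
    for E e h
  proof
    have C0: "y + h \<in> ?C0" if "y \<in> pattern E - {e}" for y
      using that E(3,4) by (auto simp flip: E(3))
    have "den_at E e (\<lambda>y. x (y + h)) \<noteq> 0"
      by (rule proper_region [OF finS perc S(2), unfolded derivation_proper_def, rule_format, OF E(1,4,2)])
         (rule xC [OF C0])
    then have "derivable \<Gamma> S \<eta> C (e + h) (- num_at E e (\<lambda>y. x (y + h)) / den_at E e (\<lambda>y. x (y + h)))"
      by (intro derivable.step [OF E(1,4,2)] xC C0)
    then show "derivable \<Gamma> S \<eta> C (a + b) (- num_at E e (\<lambda>y. x (y + h)) / den_at E e (\<lambda>y. x (y + h)))"
      by (simp only: E(3))
    show "specialises (\<eta> ` S) \<sigma> (- num_at E e (\<lambda>y. x (y + h)) / den_at E e (\<lambda>y. x (y + h)))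
        (- num_at E e (\<lambda>y. v (y + (h + g))) / den_at E e (\<lambda>y. v (y + (h + g))))"
    proof (rule step_specialises [OF E(1,2) _ E(5)])
      fix y assume "y \<in> pattern E - {e}"
      then show "specialises (\<eta> ` S) \<sigma> (x (y + h)) (v (y + (h + g)))"
        using sp [OF C0, of y] by (simp add: add.assoc)
    qed
  qed
  have subA: "shift b (pattern P) \<subseteq> C"
    using plus_in_hull_sum [OF fin _ Q(3)] by (auto simp: P(2))
  have subB: "shift a (pattern Q) \<subseteq> C"
    using plus_in_hull_sum [OF fin P(3)] by (auto simp: Q(2) add.commute)
  have 1: "a \<in> pattern P" "b \<in> pattern Q" "b + a = a + b" using P Q by (simp_all add: add.commute)
  note p = * [OF P(1) 1(1) refl subA P(4)] and q = * [OF Q(1) 1(2,3) subB Q(4)]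
  have "- num_at P a (\<lambda>y. x (y + b)) / den_at P a (\<lambda>y. x (y + b)) =
      - num_at Q b (\<lambda>y. x (y + a)) / den_at Q b (\<lambda>y. x (y + a))"
    using S(3) [unfolded derivation_consistent_def, rule_format, OF p [THEN conjunct1] q [THEN conjunct1]] .
  then have "- num_at P a (\<lambda>x. v (x + (b + g))) / den_at P a (\<lambda>x. v (x + (b + g))) =
      - num_at Q b (\<lambda>x. v (x + (a + g))) / den_at Q b (\<lambda>x. v (x + (a + g)))"
    using specialises_unique [OF p [THEN conjunct2]] q [THEN conjunct2] by simp
  then show ?thesis by simp
qed

text \<open>No equation inside the enlarged region involves z, so its value can be a fresh
  indeterminate.\<close>

lemma generic_solution_free:
  assumes gs: "generic_solution T S \<eta> v" and z: "z \<notin> T"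
    and no: "\<not> (\<exists>D\<in>copies {A, B}. z \<in> D \<and> D \<subseteq> insert z T)"
    and perc: "percolating_seed {A, B} (insert z S) (insert z T)"
  shows "generic_solution (insert z T) (insert z S) (\<eta>(z := Suc (card S))) (v(z := rat_indet (Suc (card S))))"
proof -
  have S: "finite S" "S \<subseteq> T" "bij_betw \<eta> S {1..card S}" "solution T v" "\<And>s. s \<in> S \<Longrightarrow> v s = rat_indet (\<eta> s)"
    using gs by (auto simp: generic_solution_def percolating_seed_def)
  have zS: "z \<notin> S" using S(2) z by blast
  have "bij_betw (\<eta>(z := Suc (card S))) S {1..card S}"
    using S(3) zS by (subst bij_betw_cong [of _ _ \<eta>]) auto
  then have "bij_betw (\<eta>(z := Suc (card S))) (S \<union> {z}) ({1..card S} \<union> {(\<eta>(z := Suc (card S))) z})"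
    by (intro notIn_Un_bij_betw zS) auto
  moreover have "{1..card S} \<union> {Suc (card S)} = {1..card (insert z S)}" using S(1) zS by auto
  ultimately have "bij_betw (\<eta>(z := Suc (card S))) (insert z S) {1..card (insert z S)}" by simp
  moreover have "solution (insert z T) (v(z := rat_indet (Suc (card S))))"
    unfolding solution_def
  proof (intro ballI allI impI)
    fix P t a assume P: "P \<in> \<Gamma>" "shift t (pattern P) \<subseteq> insert z T" "a \<in> pattern P"
    have copy: "shift t (pattern P) \<in> copies {A, B}" using pattern_cases [OF P(1)] by (auto simp: copies_pair_iff)
    have zD: "z \<notin> shift t (pattern P)"
    proof
      assume "z \<in> shift t (pattern P)"
      then have "\<exists>D\<in>copies {A, B}. z \<in> D \<and> D \<subseteq> insert z T" using copy P(2) by (intro bexI conjI)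
      then show False using no by (rule notE [rotated])
    qed
    then have sub: "shift t (pattern P) \<subseteq> T" using P(2) by blast
    let ?v = "v(z := rat_indet (Suc (card S)))"
    have eq: "?v (b + t) = v (b + t)" if "b \<in> pattern P" for b using that zD by auto
    show "den_at P a (\<lambda>b. ?v (b + t)) \<noteq> 0 \<and>
        ?v (a + t) = - num_at P a (\<lambda>b. ?v (b + t)) / den_at P a (\<lambda>b. ?v (b + t))"
      using solutionD [OF S(4) P(1) sub P(3)] eq [OF P(3)]
        num_den_cong [OF P(1,3), of "\<lambda>b. ?v (b + t)" "\<lambda>b. v (b + t)"] eq by simp
  qed
  ultimately show ?thesis
    using S(1,5) zS perc by (auto simp: generic_solution_def)
qed

text \<open>The value at z is computed from one available copy. Another copy through z has the other
  pattern, and then both sit in a translate of C, where consistency over C excludes a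
  conflict.\<close>

lemma generic_solution_forced:
  assumes gs: "generic_solution T S \<eta> v" and good: "good_step T z a b"
    and yes: "\<exists>D\<in>copies {A, B}. z \<in> D \<and> D \<subseteq> insert z T"
    and perc: "percolating_seed {A, B} S (insert z T)"
    and corner: "\<And>a b. exposed a b \<Longrightarrow> \<exists>S \<eta>. corner_seed (a + b) S \<and> bij_betw \<eta> S {1..card S} \<and>
      derivation_consistent \<Gamma> S \<eta> C"
  shows "\<exists>y. generic_solution (insert z T) S \<eta> (v(z := y))"
proof -
  let ?T = "insert z T"
  have S: "finite S" "S \<subseteq> T" "bij_betw \<eta> S {1..card S}" "solution T v" "\<And>s. s \<in> S \<Longrightarrow> v s = rat_indet (\<eta> s)"
    using gs by (auto simp: generic_solution_def percolating_seed_def)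
  have z: "z \<notin> T" and ab: "exposed a b" "a \<in> A" "b \<in> B"
    using good by (auto simp: good_step_def exposed_def unique_max_def)
  have atA: "e = a \<and> t = z - a" if "e \<in> A" "z = e + t" "shift t A \<subseteq> ?T" for e t
  proof -
    have "t = z - a" using good that unfolding good_step_def by blast
    then show ?thesis using that(2) by simp
  qed
  have atB: "e = b \<and> t = z - b" if "e \<in> B" "z = e + t" "shift t B \<subseteq> ?T" for e t
  proof -
    have "t = z - b" using good that unfolding good_step_def by blast
    then show ?thesis using that(2) by simp
  qed
  note den_ne = proper_region [OF S(1) perc S(3), unfolded derivation_proper_def, rule_format]
  have derT: "derivable \<Gamma> S \<eta> ?T c (v c)" if "c \<in> T" for c
    by (rule derivable_mono [OF generic_solution_derivable [OF gs that]]) auto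
  define val where "val P t e = - num_at P e (\<lambda>x. v (x + t)) / den_at P e (\<lambda>x. v (x + t))" for P t e
  have in_T: "x + t \<in> T" if "shift t (pattern P) \<subseteq> ?T" "x \<in> pattern P - {e}" "z = e + t" for P t e x
    using that by auto
  have den: "den_at P e (\<lambda>x. v (x + t)) \<noteq> 0"
    if "P \<in> \<Gamma>" "e \<in> pattern P" "z = e + t" "shift t (pattern P) \<subseteq> ?T" for P e t
    by (rule den_ne [OF that(1,4,2)]) (rule derT [OF in_T [OF that(4) _ that(3)]])
  have agree: "val P t e = val P' t' e'"
    if P: "P \<in> \<Gamma>" "e \<in> pattern P" "z = e + t" "shift t (pattern P) \<subseteq> ?T"
      and P': "P' \<in> \<Gamma>" "e' \<in> pattern P'" "z = e' + t'" "shift t' (pattern P') \<subseteq> ?T"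
    for P e t P' e' t'
  proof -
    \<comment> \<open>The translate of C without its corner z lies in T, so the solution there can
      be the target of the specialisation.\<close>
    have mixed: "val P (z - a) a = val P' (z - b) b"
      if P: "P \<in> \<Gamma>" "pattern P = A" "shift (z - a) A \<subseteq> ?T"
        and P': "P' \<in> \<Gamma>" "pattern P' = B" "shift (z - b) B \<subseteq> ?T"
      for P P'
    proof -
      let ?g = "z - a - b"
      have gC: "shift ?g C \<subseteq> ?T" using good P(3) P'(3) unfolding good_step_def by simp
      have zg: "z \<notin> shift ?g (C - {a + b})"
      proof
        assume "z \<in> shift ?g (C - {a + b})"
        then obtain c where c: "c \<in> C - {a + b}" "c + ?g = z" by force
        have "(c - (a + b)) + z = c + ?g" by (simp add: algebra_simps)
        then have "c - (a + b) = 0" unfolding c(2) by simp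
        then show False using c(1) by simp
      qed
      have "shift ?g (C - {a + b}) \<subseteq> shift ?g C" by (rule image_mono) (rule Diff_subset)
      then have "shift ?g (C - {a + b}) \<subseteq> ?T" using gC by (rule order_trans)
      then have "shift ?g (C - {a + b}) \<subseteq> T" by (rule subset_insert [OF zg, THEN iffD1])
      then have sol: "solution (shift ?g (C - {a + b})) v" by (rule solution_mono [OF S(4)])
      obtain S1 \<eta>1 where S1: "corner_seed (a + b) S1" "bij_betw \<eta>1 S1 {1..card S1}"
        "derivation_consistent \<Gamma> S1 \<eta>1 C" using corner [OF ab(1)] by blast
      have g: "b + ?g = z - a" "a + ?g = z - b" by simp_all
      have d: "den_at P a (\<lambda>x. v (x + (b + ?g))) \<noteq> 0" "den_at P' b (\<lambda>x. v (x + (a + ?g))) \<noteq> 0"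
        unfolding g using den [OF P(1), of a "z - a"] den [OF P'(1), of b "z - b"] P P' ab by simp_all
      show ?thesis
        using corner_agreement [OF S1 sol P(1,2) ab(2) d(1) P'(1,2) ab(3) d(2)]
        unfolding val_def g by simp
    qed
    show ?thesis
      using pattern_cases [OF P(1)] pattern_cases [OF P'(1)]
    proof (elim disjE)
      assume pat: "pattern P = A" "pattern P' = A"
      then have "P' = P" using same_pattern P(1) P'(1) by metis
      then show ?thesis using atA [of e t] atA [of e' t'] P P' pat by simp
    next
      assume pat: "pattern P = B" "pattern P' = B"
      then have "P' = P" using same_pattern P(1) P'(1) by metis
      then show ?thesis using atB [of e t] atB [of e' t'] P P' pat by simp
    next
      assume pat: "pattern P = A" "pattern P' = B"
      have "e = a \<and> t = z - a" "e' = b \<and> t' = z - b"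
        by (rule atA [OF P(2) [unfolded pat(1)] P(3) P(4) [unfolded pat(1)]])
           (rule atB [OF P'(2) [unfolded pat(2)] P'(3) P'(4) [unfolded pat(2)]])
      then show ?thesis using mixed [OF P(1) pat(1) _ P'(1) pat(2)] P(4) P'(4) pat by simp
    next
      assume pat: "pattern P = B" "pattern P' = A"
      have "e = b \<and> t = z - b" "e' = a \<and> t' = z - a"
        by (rule atB [OF P(2) [unfolded pat(1)] P(3) P(4) [unfolded pat(1)]])
           (rule atA [OF P'(2) [unfolded pat(2)] P'(3) P'(4) [unfolded pat(2)]])
      then show ?thesis using mixed [OF P'(1) pat(2) _ P(1) pat(1)] P(4) P'(4) pat by simp
    qed
  qed
  obtain D where D: "D \<in> copies {A, B}" "z \<in> D" "D \<subseteq> ?T" using yes by (elim bexE conjE)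
  then obtain t0 E0 where E0: "D = shift t0 E0" "E0 = A \<or> E0 = B" by (auto simp: copies_pair_iff)
  then obtain P0 where P0: "P0 \<in> \<Gamma>" "pattern P0 = E0" using patterns by (metis imageE insertI1 insertI2)
  have "z \<in> shift t0 (pattern P0)" using D(2) E0(1) P0(2) by simp
  then obtain e0 where e0: "e0 \<in> pattern P0" "z = e0 + t0" by (elim imageE)
  have sub0: "shift t0 (pattern P0) \<subseteq> ?T" using D(3) E0(1) P0(2) by simp
  define v' where "v' = v(z := val P0 t0 e0)"
  have v'T: "v' c = v c" if "c \<in> T" for c using that z by (auto simp: v'_def)
  have derz: "derivable \<Gamma> S \<eta> ?T z (v' z)"
  proof -
    have "derivable \<Gamma> S \<eta> ?T (e0 + t0) (val P0 t0 e0)"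
      unfolding val_def
      by (intro derivable.step [OF P0(1) sub0 e0(1)] den [OF P0(1) e0 sub0])
         (rule derT [OF in_T [OF sub0 _ e0(2)]])
    then show ?thesis by (simp add: v'_def flip: e0(2))
  qed
  have der': "derivable \<Gamma> S \<eta> ?T c (v' c)" if "c \<in> ?T" for c
    using that derz derT v'T by (cases "c = z") auto
  have "solution ?T v'"
    unfolding solution_def
  proof (intro ballI allI impI)
    fix P t x assume P: "P \<in> \<Gamma>" "shift t (pattern P) \<subseteq> ?T" "x \<in> pattern P"
    let ?u = "\<lambda>b. v' (b + t)"
    have d: "den_at P x ?u \<noteq> 0"
      by (rule den_ne [OF P]) (rule der', use P(2) in \<open>simp add: image_subset_iff\<close>)
    \<comment> \<open>Vanishing of P does not depend on the point solved for: it is checked at z if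
      the copy contains z, and then solved for x.\<close>
    have "mpoly_eval rat_const ?u P = 0"
    proof (cases "z \<in> shift t (pattern P)")
      case True
      then obtain e where e: "e \<in> pattern P" "z = e + t" by (elim imageE)
      have nd: "num_at P e ?u = num_at P e (\<lambda>b. v (b + t))" "den_at P e ?u = den_at P e (\<lambda>b. v (b + t))"
        using num_den_cong [OF P(1) e(1), of ?u "\<lambda>b. v (b + t)"] v'T in_T [OF P(2) _ e(2)] by auto
      have "?u e = val P t e"
        using agree [OF P0(1) e0 sub0 P(1) e P(2)] by (simp add: v'_def flip: e(2))
      then show ?thesis
        using den [OF P(1) e P(2)] unfolding eval_num_den [OF P(1) e(1)] nd val_def by simp
    next
      case False
      have sub: "shift t (pattern P) \<subseteq> T" by (rule subset_insert [OF False, THEN iffD1, OF P(2)])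
      have nd: "num_at P x ?u = num_at P x (\<lambda>b. v (b + t))" "den_at P x ?u = den_at P x (\<lambda>b. v (b + t))"
        using num_den_cong [OF P(1,3), of ?u "\<lambda>b. v (b + t)"] v'T sub by auto
      have "?u x = v (x + t)" using v'T sub P(3) by (simp add: image_subset_iff)
      then show ?thesis
        using solutionD [OF S(4) P(1) sub P(3)] unfolding eval_num_den [OF P(1,3)] nd by simp
    qed
    then have "?u x * den_at P x ?u = - num_at P x ?u"
      unfolding eval_num_den [OF P(1,3)] by (simp add: add_eq_0_iff)
    then show "den_at P x ?u \<noteq> 0 \<and> v' (x + t) = - num_at P x ?u / den_at P x ?u"
      by (intro conjI d nonzero_eq_divide_eq [THEN iffD2, OF d])
  qed
  moreover have "\<forall>s\<in>S. v' s = rat_indet (\<eta> s)" using S(2,5) v'T by auto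
  ultimately have "generic_solution ?T S \<eta> v'" using S perc by (simp add: generic_solution_def)
  then show ?thesis unfolding v'_def by blast
qed

lemma generic_solution_grows:
  assumes "grows T S T' S'" "generic_solution T S \<eta> v"
    and corner: "\<And>a b. exposed a b \<Longrightarrow> \<exists>S \<eta>. corner_seed (a + b) S \<and> bij_betw \<eta> S {1..card S} \<and>
      derivation_consistent \<Gamma> S \<eta> C"
  shows "\<exists>\<eta>' v'. generic_solution T' S' \<eta>' v' \<and> (\<forall>a\<in>T. v' a = v a \<and> \<eta>' a = \<eta> a)"
  using assms(1)
proof (induction rule: grows.induct)
  case start
  then show ?case using assms(2) by blast
next
  case (free T' S' z a b)
  then obtain \<eta>' v' where gs: "generic_solution T' S' \<eta>' v'" "\<forall>a\<in>T. v' a = v a \<and> \<eta>' a = \<eta> a" by blast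
  have z: "z \<notin> T'" using free.hyps(2) by (simp add: good_step_def)
  have "percolating_seed {A, B} (insert z S') (insert z T')"
    by (rule grows_percolating [OF grows.free [OF grows.start free.hyps(2,3)]])
       (use gs(1) in \<open>simp add: generic_solution_def\<close>)
  note new = generic_solution_free [OF gs(1) z free.hyps(3) this]
  have "z \<notin> T" using grows_subset [OF free.hyps(1)] z by blast
  then show ?case using new gs(2) by (intro exI conjI) (assumption, auto)
next
  case (forced T' S' z a b)
  then obtain \<eta>' v' where gs: "generic_solution T' S' \<eta>' v'" "\<forall>a\<in>T. v' a = v a \<and> \<eta>' a = \<eta> a" by blast
  have z: "z \<notin> T'" using forced.hyps(2) by (simp add: good_step_def)
  have perc: "percolating_seed {A, B} S' (insert z T')"
    by (rule grows_percolating [OF grows.forced [OF grows.start forced.hyps(2,3)]])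
       (use gs(1) in \<open>simp add: generic_solution_def\<close>)
  obtain y where "generic_solution (insert z T') S' \<eta>' (v'(z := y))"
    using generic_solution_forced [OF gs(1) forced.hyps(2,3) perc corner] by blast
  moreover have "z \<notin> T" using grows_subset [OF forced.hyps(1)] z by blast
  ultimately show ?case using gs(2) by (intro exI conjI) (assumption, auto)
qed

text \<open>R occupies F within some finite region, which is enclosed in a convex region F' grown
  from F; the count of solutions on F' then compares S with R.\<close>

lemma card_le_region:
  assumes "grows {} {} F S" "hull_closed F" "supported F" "finite R" "F \<subseteq> occupied {A, B} R UNIV"
  shows "card S \<le> card R"
proof -
  have finF: "finite F" using assms(2) by (simp add: hull_closed_def)
  have "\<forall>a\<in>F. \<exists>T0. finite T0 \<and> a \<in> occupied {A, B} R T0"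
    using occupied_finite_region [of "{A, B}" _ R UNIV] fin assms(5) by blast
  then obtain T0 where T0: "\<And>a. a \<in> F \<Longrightarrow> finite (T0 a) \<and> a \<in> occupied {A, B} R (T0 a)" by metis
  obtain F' where F': "hull_closed F'" "F \<union> (\<Union>a\<in>F. T0 a) \<subseteq> F'"
    using supported_superset [of "F \<union> (\<Union>a\<in>F. T0 a)"] finF T0 by (metis finite_UN finite_Un)
  have "F \<subseteq> occupied {A, B} R F'"
  proof
    fix a assume a: "a \<in> F"
    then have "T0 a \<subseteq> F'" using F'(2) by blast
    then show "a \<in> occupied {A, B} R F'" using T0 [OF a] occupied_mono [of R R "T0 a" F'] by blast
  qed
  moreover obtain S' where "grows F S F' S'"
    using grows_exists [OF F'(1) assms(2) _ disjI2 [OF assms(3)]] F'(2) by blast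
  ultimately show ?thesis using card_le_percolating [OF assms(1)] assms(4) by blast
qed

lemma percolates_plane:
  assumes "percolating_seed {A, B} S F" "R \<subseteq> F" "percolating_seed {A, B} R UNIV"
  shows "percolating_seed {A, B} S UNIV"
proof (rule percolating_seedI)
  have "R \<subseteq> occupied {A, B} S UNIV"
    using assms(1,2) occupied_mono [of S S F UNIV "{A, B}"] unfolding percolating_seed_def by simp
  then show "UNIV \<subseteq> occupied {A, B} S UNIV"
    using assms(3) occupied_trans [of UNIV UNIV R "{A, B}" S] by (simp add: percolating_seed_def)
qed simp

lemma bij_inverse: "bij_betw \<eta> S {1..card S} \<Longrightarrow> s \<in> S \<Longrightarrow> inv_into S \<eta> (\<eta> s) = s"
  by (rule bij_betw_inv_into_left)

text \<open>A seed S1 grown for C is grown further to a seed S2 of a region containing the given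
  seed S. Then S2 percolates the plane and is no larger than S, so the solution has independent
  values on S2, and in particular on S1.\<close>

lemma plane_imp_region:
  assumes "consistent_over \<Gamma> UNIV"
  shows "consistent_over \<Gamma> C"
proof -
  obtain S where S: "consistent_from \<Gamma> S UNIV" using assms unfolding consistent_over_def by blast
  then have finS: "finite S" and percS: "percolating_seed {A, B} S UNIV"
    by (auto simp: consistent_from_def patterns)
  obtain \<eta> where \<eta>: "bij_betw \<eta> S {1..card S}"
    using ex_bij_betw_finite_nat [OF finS] finite_same_card_bij [OF finS, of "{1..card S}"] by auto
  obtain v where v: "generic_solution UNIV S \<eta> v"
    using consistent_imp_generic_solution [OF finS percS \<eta> consistent_from_imp_derivation_consistent [OF S \<eta>]] by blast
  obtain a b where ab: "exposed a b" using exposed_exists by blast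
  obtain S1 where S1: "corner_seed (a + b) S1" "grows {} {} C S1" using corner_seed_exists [OF ab] .
  have fin1: "finite S1" and perc1: "percolating_seed {A, B} S1 C" using S1(1) by (auto simp: corner_seed_def)
  obtain F where F: "hull_closed F" "supported F" "S \<subseteq> F" "C \<subseteq> F" using supported_superset [OF finS] .
  obtain S2 where S2: "grows C S1 F S2"
    using grows_exists [OF F(1) hull_closed_C F(4) disjI2 [OF supported_C]] by blast
  have grow2: "grows {} {} F S2" by (rule grows_trans [OF S1(2) S2])
  have fin2: "finite S2" and sub12: "S1 \<subseteq> S2" using grows_subset [OF grow2] grows_subset [OF S2] by auto
  have perc2: "percolating_seed {A, B} S2 UNIV"
    by (rule percolates_plane [OF grows_percolating [OF S2 perc1] F(3) percS])
  \<comment> \<open>S occupies the whole plane, in particular F, while S2 was grown for F and so has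
    least size.\<close>
  have card: "card S2 \<le> card S"
    using card_le_region [OF grow2 F(1,2) finS] percS by (simp add: percolating_seed_def)
  have "derivation_consistent \<Gamma> S1 \<eta>1 C" if \<eta>1: "bij_betw \<eta>1 S1 {1..card S1}" for \<eta>1
  proof -
    obtain \<eta>2 where \<eta>2: "bij_betw \<eta>2 S2 {1..card S2}" "\<And>s. s \<in> S1 \<Longrightarrow> \<eta>2 s = \<eta>1 s"
      using extend_bijection [OF fin2 sub12 \<eta>1] by blast
    define \<sigma> where "\<sigma> k = v (inv_into S2 \<eta>2 k)" for k
    have \<sigma>: "\<sigma> (\<eta>2 s) = v s" if "s \<in> S2" for s by (simp add: \<sigma>_def bij_inverse [OF \<eta>2(1) that])
    have vS: "solution UNIV v" "\<And>s. s \<in> S \<Longrightarrow> v s = rat_indet (\<eta> s)"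
      using v by (auto simp: generic_solution_def)
    have indep: "p = 0" if "pattern p \<subseteq> \<eta>2 ` S2" "mpoly_eval rat_const \<sigma> p = 0" for p
      using percolating_independent [OF \<eta> subset_UNIV vS(2,1) fin2 _ \<eta>2(1) proper_region [OF fin2 perc2 \<eta>2(1)] card \<sigma> that]
        perc2 by (simp add: patterns)
    show ?thesis
    proof (rule independent_imp_consistent)
      show "solution C v" by (rule solution_mono [OF vS(1)]) simp
      show "\<sigma> (\<eta>1 s) = v s" if "s \<in> S1" for s using \<sigma> [of s] \<eta>2(2) [OF that] that sub12 by auto
      fix p :: "(nat, 'a) mpoly" assume p: "pattern p \<subseteq> \<eta>1 ` S1" "mpoly_eval rat_const \<sigma> p = 0"
      have "\<eta>1 ` S1 \<subseteq> \<eta>2 ` S2" using \<eta>2(2) sub12 by force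
      then show "p = 0" using indep p by blast
    qed
  qed
  then have "consistent_from \<Gamma> S1 C"
    using fin1 perc1 by (intro consistent_fromI proper_over_region) (simp_all add: patterns)
  then show ?thesis unfolding consistent_over_def by blast
qed

text \<open>The generic solution on C is grown to a region F containing S0, which fixes a seed S1 of
  the plane. Any two derivations from S1 use a finite region, and growing the solution over that
  region makes them agree.\<close>

lemma region_imp_plane:
  assumes "consistent_over \<Gamma> C"
  shows "consistent_over \<Gamma> UNIV"
proof -
  obtain S where S: "consistent_from \<Gamma> S C" using assms unfolding consistent_over_def by blast
  then have finS: "finite S" and percS: "percolating_seed {A, B} S C"
    by (auto simp: consistent_from_def patterns)
  obtain \<eta> where \<eta>: "bij_betw \<eta> S {1..card S}"
    using finite_same_card_bij [OF finS, of "{1..card S}"] by auto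
  obtain v where v: "generic_solution C S \<eta> v"
    using consistent_imp_generic_solution [OF finS percS \<eta> consistent_from_imp_derivation_consistent [OF S \<eta>]] by blast
  have SC: "S \<subseteq> C" using percS by (simp add: percolating_seed_def)
  have vS: "solution C v" "\<And>s. s \<in> S \<Longrightarrow> v s = rat_indet (\<eta> s)" using v by (auto simp: generic_solution_def)
  \<comment> \<open>Corner seeds are grown seeds of C, hence no larger than S, so consistency passes
    from S to them.\<close>
  have corner: "\<exists>S1 \<eta>1. corner_seed (a + b) S1 \<and> bij_betw \<eta>1 S1 {1..card S1} \<and> derivation_consistent \<Gamma> S1 \<eta>1 C"
    if ab: "exposed a b" for a b
  proof -
    obtain S1 where S1: "corner_seed (a + b) S1" "grows {} {} C S1" using corner_seed_exists [OF ab] .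
    have fin1: "finite S1" and perc1: "percolating_seed {A, B} S1 C" using S1(1) by (auto simp: corner_seed_def)
    have "C \<subseteq> occupied {A, B} S C" using percS by (simp add: percolating_seed_def)
    then have card: "card S1 \<le> card S" by (rule card_le_percolating [OF S1(2) grows.start _ finS])
    obtain \<eta>1 where \<eta>1: "bij_betw \<eta>1 S1 {1..card S1}"
      using finite_same_card_bij [OF fin1, of "{1..card S1}"] by auto
    define \<sigma> where "\<sigma> k = v (inv_into S1 \<eta>1 k)" for k
    have \<sigma>: "\<sigma> (\<eta>1 s) = v s" if "s \<in> S1" for s by (simp add: \<sigma>_def bij_inverse [OF \<eta>1 that])
    have "derivation_consistent \<Gamma> S1 \<eta>1 C"
    proof (rule independent_imp_consistent [OF vS(1) \<sigma>])
      fix p :: "(nat, 'a) mpoly" assume p: "pattern p \<subseteq> \<eta>1 ` S1" "mpoly_eval rat_const \<sigma> p = 0"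
      show "p = 0"
        using percolating_independent [OF \<eta> SC vS(2,1) fin1 _ \<eta>1 proper_region [OF fin1 perc1 \<eta>1] card \<sigma> p]
          perc1 by (simp add: patterns)
    qed
    then show ?thesis using S1(1) \<eta>1 by blast
  qed
  \<comment> \<open>Including S0 makes every percolating seed of F percolate the plane.\<close>
  obtain F where F: "hull_closed F" "supported F" "S0 \<subseteq> F" "C \<subseteq> F" using supported_superset [OF S0(1)] .
  obtain S1 where S1: "grows C S F S1"
    using grows_exists [OF F(1) hull_closed_C F(4) disjI2 [OF supported_C]] by blast
  obtain \<eta>1 v1 where gs1: "generic_solution F S1 \<eta>1 v1" using generic_solution_grows [OF S1 v corner] by blast
  have fin1: "finite S1" and perc1: "percolating_seed {A, B} S1 F" and \<eta>1: "bij_betw \<eta>1 S1 {1..card S1}"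
    and v1: "solution F v1" "\<And>s. s \<in> S1 \<Longrightarrow> v1 s = rat_indet (\<eta>1 s)"
    using gs1 by (auto simp: generic_solution_def)
  have S1F: "S1 \<subseteq> F" using perc1 by (simp add: percolating_seed_def)
  have perc: "percolating_seed {A, B} S1 UNIV" by (rule percolates_plane [OF perc1 F(3) S0(2)])
  have "derivation_consistent \<Gamma> S1 \<rho> UNIV" if \<rho>: "bij_betw \<rho> S1 {1..card S1}" for \<rho>
    unfolding derivation_consistent_def
  proof (intro allI impI)
    fix a x y assume xy: "derivable \<Gamma> S1 \<rho> UNIV a x" "derivable \<Gamma> S1 \<rho> UNIV a y"
    obtain X where X: "finite X" "derivable \<Gamma> S1 \<rho> X a x" using derivable_finite_region [OF xy(1)] by blast
    obtain Y where Y: "finite Y" "derivable \<Gamma> S1 \<rho> Y a y" using derivable_finite_region [OF xy(2)] by blast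
    have "finite (F \<union> X \<union> Y)" using F(1) X(1) Y(1) by (simp add: hull_closed_def)
    then obtain F' where F': "hull_closed F'" "F \<union> X \<union> Y \<subseteq> F'" using supported_superset by metis
    obtain S2 where S2: "grows F S1 F' S2"
      using grows_exists [OF F'(1) F(1) _ disjI2 [OF F(2)]] F'(2) by blast
    obtain \<eta>2 v2 where gs2: "generic_solution F' S2 \<eta>2 v2" "\<forall>a\<in>F. v2 a = v1 a \<and> \<eta>2 a = \<eta>1 a"
      using generic_solution_grows [OF S2 gs1 corner] by blast
    define \<sigma> where "\<sigma> k = v1 (inv_into S1 \<rho> k)" for k
    have \<sigma>: "\<sigma> (\<rho> s) = v1 s" if "s \<in> S1" for s by (simp add: \<sigma>_def bij_inverse [OF \<rho> that])
    \<comment> \<open>Whatever points the growth from F to F' leaves free, the values on F, and so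
      on S1, are unchanged and still independent.\<close>
    have "derivation_consistent \<Gamma> S1 \<rho> F'"
    proof (rule independent_imp_consistent)
      show "solution F' v2" using gs2(1) by (simp add: generic_solution_def)
      show "\<sigma> (\<rho> s) = v2 s" if "s \<in> S1" for s using \<sigma> [OF that] gs2(2) S1F that by auto
      fix p :: "(nat, 'a) mpoly" assume p: "pattern p \<subseteq> \<rho> ` S1" "mpoly_eval rat_const \<sigma> p = 0"
      show "p = 0"
        using percolating_independent [OF \<eta>1 S1F v1(2,1) fin1 _ \<rho> proper_region [OF fin1 perc1 \<rho>] le_refl \<sigma> p]
          perc1 by (simp add: patterns)
    qed
    moreover have "derivable \<Gamma> S1 \<rho> F' a x" "derivable \<Gamma> S1 \<rho> F' a y"
      using F'(2) by (auto intro: derivable_mono [OF X(2)] derivable_mono [OF Y(2)])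
    ultimately show "x = y" by (simp add: derivation_consistent_def)
  qed
  then have "consistent_from \<Gamma> S1 UNIV"
    using fin1 perc by (intro consistent_fromI proper) (simp_all add: patterns)
  then show ?thesis unfolding consistent_over_def by blast
qed

end

text \<open>If one pattern is empty, the other one is a single point, and all values are equal to one constant.\<close>

lemma (in difference_system) consistent_over_singleton:
  assumes patterns: "pattern ` \<Gamma> = {{}, {b}}" and proper: "proper_over \<Gamma> UNIV"
  shows "consistent_over \<Gamma> UNIV"
proof -
  have all: "a \<in> occupied {{}, {b}} {} UNIV" for a
  proof (rule occupied.step [of "{a}"])
    have "{a} = shift (a - b) {b}" by simp
    then show "{a} \<in> copies {{}, {b}}" unfolding copies_def by blast
  qed auto
  have perc: "percolating_seed (pattern ` \<Gamma>) {} UNIV"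
    unfolding patterns by (rule percolating_seedI) (use all in auto)
  obtain Q where Q: "Q \<in> \<Gamma>" "pattern Q = {b}" using patterns by (metis imageE insertI1 insertI2)
  \<comment> \<open>The pattern {b} has no point besides b, so the assignment 0 is a mere
    placeholder.\<close>
  let ?c = "- num_at Q b (\<lambda>_. 0) / den_at Q b (\<lambda>_. 0)"
  have "x = ?c" if "derivable \<Gamma> {} \<eta> UNIV a x" for \<eta> a x
    using that
  proof (induction rule: derivable.induct)
    case (step P t e u)
    then have "pattern P = {b}" using patterns by auto
    then have "P = Q" "e = b" using same_pattern [OF step.hyps(1) Q(1)] Q(2) step.hyps(3) by simp_all
    then show ?case
      using num_den_cong [OF Q(1), of b u "\<lambda>_. 0"] Q(2) by simp
  qed simp
  then have "derivation_consistent \<Gamma> {} \<eta> UNIV" for \<eta>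
    unfolding derivation_consistent_def by blast
  then have "consistent_from \<Gamma> {} UNIV"
    using perc by (intro consistent_fromI proper) simp_all
  then show ?thesis unfolding consistent_over_def by blast
qed

text \<open>The empty seed percolates the empty region and nothing is derivable there. This is the
  region of the theorem when one pattern is empty.\<close>

lemma (in difference_system) consistent_over_empty: "consistent_over \<Gamma> {}"
proof -
  have none: "\<not> derivable \<Gamma> S \<eta> {} a x" if "S \<subseteq> {}" for S \<eta> a x
  proof
    assume "derivable \<Gamma> S \<eta> {} a x"
    then show False by (induction rule: derivable.induct) (use that in auto)
  qed
  have "proper_over \<Gamma> {}"
    by (rule proper_overI) (auto simp: derivation_proper_def percolating_seed_def)
  moreover have "percolating_seed (pattern ` \<Gamma>) {} {}" by (rule percolating_seedI) auto
  ultimately have "consistent_from \<Gamma> {} {}"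
    by (intro consistent_fromI) (use none in \<open>auto simp: derivation_consistent_def\<close>)
  then show ?thesis unfolding consistent_over_def by blast
qed

theorem theorem3:
  fixes \<Gamma> :: "(int ^ 2, 'a::field) mpoly set"
    and P Q :: "(int ^ 2, 'a) mpoly"
    and A B :: "(int ^ 2) set"
  assumes "pd_system \<Gamma>"
    and "\<Gamma> = {P, Q}" and "P \<noteq> Q"
    and "A = pattern P" and "B = pattern Q"
    and "multilinear \<Gamma>"
    and "proper_over \<Gamma> UNIV"
    and "\<exists>S. finite S \<and> percolating_seed {A, B} S UNIV"
  shows "consistent_over \<Gamma> UNIV \<longleftrightarrow>
    consistent_over \<Gamma>
      {z. real_vec z \<in> convex hull (real_vec ` A) + convex hull (real_vec ` B)}"
proof -
  interpret difference_system \<Gamma> by unfold_locales (fact assms(1), fact assms(6))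
  obtain S0 where S0: "finite S0" "percolating_seed {A, B} S0 UNIV" using assms(8) by blast
  have fin: "finite A" "finite B" by (simp_all add: assms(4,5) finite_pattern)
  have patterns: "pattern ` \<Gamma> = {A, B}" by (simp add: assms(2,4,5))
  have max: "(\<exists>a. unique_max A w a) \<or> (\<exists>b. unique_max B w b)" if "w \<noteq> 0" for w
    by (rule percolating_imp_unique_max [OF S0 that])
  show ?thesis
  proof (cases "A = {} \<or> B = {}")
    case True
    \<comment> \<open>A Minkowski sum with the empty set is empty, and the other pattern is a single
      point, so both sides of the equivalence hold.\<close>
    then have "{z. real_vec z \<in> convex hull (real_vec ` A) + convex hull (real_vec ` B)} = {}"
      by (auto simp: set_plus_def)
    moreover have "\<exists>b. pattern ` \<Gamma> = {{}, {b}}"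
      using True
    proof
      assume A: "A = {}"
      then have "\<exists>b. B = {b}" using max by (intro singleton_if_other_empty fin) (auto simp: unique_max_def)
      then show ?thesis using A patterns by auto
    next
      assume B: "B = {}"
      then have "\<exists>a. A = {a}" using max by (intro singleton_if_other_empty fin) (auto simp: unique_max_def)
      then show ?thesis using B patterns by (auto simp: insert_commute)
    qed
    ultimately show ?thesis
      using consistent_over_singleton [OF _ assms(7)] consistent_over_empty by auto
  next
    case False
    then interpret pair_system \<Gamma> A B S0
    proof unfold_locales
      show "finite A" "finite B" by (fact fin)+
      show "A \<noteq> {}" "B \<noteq> {}" using False by simp_all
      show "(\<exists>a. unique_max A w a) \<or> (\<exists>b. unique_max B w b)" if "w \<noteq> 0" for w by (rule max [OF that])
      show "pattern ` \<Gamma> = {A, B}" by (fact patterns)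
      show "proper_over \<Gamma> UNIV" by (fact assms(7))
      show "finite S0" "percolating_seed {A, B} S0 UNIV" by (fact S0)+
    qed
    show ?thesis
      unfolding hull_sum_eq [OF fin(1) ne(1) fin(2) ne(2)]
      using plane_imp_region region_imp_plane by blast
  qed
qed

end
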